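(* For every domain size $k$, every $\alpha\in(0,1]$, every $\varepsilon_1,\varepsilon_2\in(0,1]$, and every $\delta\in(0,1]$, there exists a public-coin protocol for closeness testing between two unknown distributions $\mathbf p,\mathbf q$ over $[k]$ with distance parameter $\alpha$ using $$n_1=O\!\left(\frac{\sqrt k}{\alpha^2}+\frac{k^{2/3}}{\alpha^{4/3}\varepsilon_1^{2/3}}\log^{1/3}\frac1\delta+\frac{\sqrt k}{\alpha\varepsilon_1}\sqrt{\log\frac1\delta}\right)$$ users holding samples from $\mathbf p$ and $n_2=O\!\left(\left(\frac{\varepsilon_1}{\varepsilon_2}\right)^2 n_1\right)$ users holding samples from $\mathbf q$, which is $(\varepsilon_1,\delta)$-shuffle differentially private for the samples from $\mathbf p$ and $(\varepsilon_2,\delta)$-shuffle differentially private for the samples from $\mathbf q$.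
   Context: Closeness testing: given $\alpha\in(0,1]$ and independent samples from unknown distributions $\mathbf p,\mathbf q$ over $[k]$, output accept with probability at least $2/3$ if $\mathbf p=\mathbf q$, and reject with probability at least $2/3$ if $d_{TV}(\mathbf p,\mathbf q)=\frac12\|\mathbf p-\mathbf q\|_1>\alpha$. Heterogeneous shuffle model: $n_1$ users each hold one independent sample from $\mathbf p$, and $n_2$ users each hold one independent sample from $\mathbf q$. Each user of the first group applies a randomizer $R_i$ to their sample and a public random string $U$ of length $r$ (independent of the data, known to all parties), producing a (possibly multi-message) output; a shuffler $S_1$ concatenates all messages of the first group and applies a uniformly random permutation. Likewise each user of the second group applies $R'_i$, and a separate shuffler $S_2$ concatenates and uniformly permutes the second group's messages. The analyzer receives the outputs of $S_1$, $S_2$ and $U$, and outputs accept/reject satisfying the closeness testing guarantee. The protocol is private-coin if $r=0$, public-coin otherwise. It is $(\varepsilon_1,\delta)$-shuffle differentially private for the first group if the output of $S_1$, as a randomized function of the dataset $(x_1,\dots,x_{n_1})$, is $(\varepsilon_1,\delta)$-differentially private with respect to datasets differing in one entry: $\Pr[\text{output}\in S]\le e^{\varepsilon_1}\Pr[\text{output}'\in S]+\delta$ for all measurable $S$; similarly for the second group with $S_2$ and $\varepsilon_2$.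
   Formalization: In the bounds, log(1/δ) is read as max(1, log(1/δ)) and (ε₁/ε₂)² as max(1, (ε₁/ε₂)²); taken literally the bounds fail at δ = 1 (non-private lower bound k^{2/3}) and for ε₁ much smaller than ε₂ (n₂ would be 0). *)

theory Defs
  imports "HOL-Probability.Probability" "HOL-Combinatorics.Permutations"
begin

text \<open>
  Samples are natural numbers; the domain \<open>[k]\<close> is \<open>{1..k}\<close>. All output spaces are discrete, so
  every set of outputs is measurable and randomized maps are functions into \<open>pmf\<close>.
\<close>

definition tv_dist :: "nat \<Rightarrow> nat pmf \<Rightarrow> nat pmf \<Rightarrow> real" where
  "tv_dist k p q = 1 / 2 * (\<Sum>x\<in>{1..k}. \<bar>pmf p x - pmf q x\<bar>)"

text \<open>Datasets are lists; neighbouring means that a single entry is replaced.\<close>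

definition neighbouring :: "'a list \<Rightarrow> 'a list \<Rightarrow> bool" where
  "neighbouring xs ys \<longleftrightarrow> (\<exists>i<length xs. \<exists>y. ys = xs[i := y])"

definition differentially_private ::
    "real \<Rightarrow> real \<Rightarrow> 'a set \<Rightarrow> nat \<Rightarrow> ('a list \<Rightarrow> 'b pmf) \<Rightarrow> bool" where
  "differentially_private \<epsilon> \<delta> X n M \<longleftrightarrow>
     (\<forall>xs ys S. set xs \<subseteq> X \<and> set ys \<subseteq> X \<and> length xs = n \<and> length ys = n \<and> neighbouring xs ys \<longrightarrow>
        measure_pmf.prob (M xs) S \<le> exp \<epsilon> * measure_pmf.prob (M ys) S + \<delta>)"

text \<open>
  A randomizer \<open>R i u x\<close> is the distribution of the list of messages sent by user \<open>i\<close> on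
  public string \<open>u\<close> and sample \<open>x\<close>. The analyzer returns \<open>True\<close> for accept, and may be
  randomized.
\<close>

type_synonym 'm randomizer = "nat \<Rightarrow> bool list \<Rightarrow> nat \<Rightarrow> 'm list pmf"

record 'm shuffle_protocol =
  users1 :: nat
  users2 :: nat
  coins :: nat
  rand1 :: "'m randomizer"
  rand2 :: "'m randomizer"
  analyzer :: "'m list \<Rightarrow> 'm list \<Rightarrow> bool list \<Rightarrow> bool pmf"

definition public_string :: "nat \<Rightarrow> bool list pmf" where
  "public_string r = pmf_of_set {u. length u = r}"

definition public_coin :: "'m shuffle_protocol \<Rightarrow> bool" where
  "public_coin P \<longleftrightarrow> coins P \<noteq> 0"

definition shuffle :: "'m list \<Rightarrow> 'm list pmf" where
  "shuffle ms = map_pmf (\<lambda>\<sigma>. permute_list \<sigma> ms) (pmf_of_set {\<sigma>. \<sigma> permutes {..<length ms}})"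

text \<open>
  The output of the shuffler of a group with dataset \<open>xs\<close>: \<open>Pi_pmf\<close> makes the users' local
  randomness independent (its second argument is only a default value for indices that are not users).
\<close>

definition shuffler_output :: "'m randomizer \<Rightarrow> bool list \<Rightarrow> nat list \<Rightarrow> 'm list pmf" where
  "shuffler_output R u xs =
     do {
       msgs \<leftarrow> Pi_pmf {..<length xs} [] (\<lambda>i. R i u (xs ! i));
       shuffle (concat (map msgs [0..<length xs]))
     }"

definition run_protocol :: "'m shuffle_protocol \<Rightarrow> nat pmf \<Rightarrow> nat pmf \<Rightarrow> bool pmf" where
  "run_protocol P p q =
     do {
       u \<leftarrow> public_string (coins P);
       xs \<leftarrow> replicate_pmf (users1 P) p;
       ys \<leftarrow> replicate_pmf (users2 P) q;
       s1 \<leftarrow> shuffler_output (rand1 P) u xs;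
       s2 \<leftarrow> shuffler_output (rand2 P) u ys;
       analyzer P s1 s2 u
     }"

definition closeness_tester :: "nat \<Rightarrow> real \<Rightarrow> 'm shuffle_protocol \<Rightarrow> bool" where
  "closeness_tester k \<alpha> P \<longleftrightarrow>
     (\<forall>p q. set_pmf p \<subseteq> {1..k} \<and> set_pmf q \<subseteq> {1..k} \<longrightarrow>
        (p = q \<longrightarrow> pmf (run_protocol P p q) True \<ge> 2 / 3) \<and>
        (tv_dist k p q > \<alpha> \<longrightarrow> pmf (run_protocol P p q) False \<ge> 2 / 3))"

text \<open>
  The public string is known to everybody, so privacy is required for each of its values. This
  implies privacy of the pair of the public string and the shuffler output, and privacy on average
  over the public string.
\<close>

definition shuffle_private ::
    "nat \<Rightarrow> real \<Rightarrow> real \<Rightarrow> nat \<Rightarrow> nat \<Rightarrow> 'm randomizer \<Rightarrow> bool" where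
  "shuffle_private k \<epsilon> \<delta> r n R \<longleftrightarrow>
     (\<forall>u. length u = r \<longrightarrow> differentially_private \<epsilon> \<delta> {1..k} n (shuffler_output R u))"

text \<open>
  The logarithm inside the asymptotic bound is floored at 1, which matters only for
  \<open>\<delta> > exp (- 1)\<close>. Without the floor the bound at \<open>\<delta> = 1\<close>, \<open>\<epsilon>\<^sub>1 = \<epsilon>\<^sub>2 = 1\<close> would be a constant times
  \<open>sqrt k / \<alpha>\<^sup>2\<close> for both groups, contradicting the lower bound of order
  \<open>k powr (2/3) / \<alpha> powr (4/3)\<close> for closeness testing without privacy.
\<close>

definition log_inv :: "real \<Rightarrow> real" where
  "log_inv \<delta> = max 1 (ln (1 / \<delta>))"

text \<open>
  The ratio of the group sizes, again floored at 1, which matters only for \<open>\<epsilon>\<^sub>1 < \<epsilon>\<^sub>2\<close>. Without the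
  floor, \<open>\<epsilon>\<^sub>1 \<rightarrow> 0\<close> with the other parameters fixed would leave the second group without any users,
  since \<open>\<epsilon>\<^sub>1\<^sup>2\<close> times the bound for the first group tends to 0.
\<close>

definition size_ratio :: "real \<Rightarrow> real \<Rightarrow> real" where
  "size_ratio \<epsilon>\<^sub>1 \<epsilon>\<^sub>2 = max 1 ((\<epsilon>\<^sub>1 / \<epsilon>\<^sub>2)\<^sup>2)"

end

(*
  A public hash function maps [k] to N = O(L) cells, so that the noise needed to hide a user in the
  histogram of a group is spread over few cells. User 0 of each group adds binomial noise to every
  cell, and a coupling that shifts the noise of two cells by one gives privacy. The analyzer splits
  each group into three blocks. The first estimates the mass of every cell and thus weights
  w_b ~ 1 / (1 + L (p_b + q_b)), which neutralise heavy cells; the other two give independent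
  unbiased estimates V, W of the difference d = p - q on the cells. The statistic sum w_b V_b W_b has
  mean sum w_b d_b^2, and since it is bilinear, its variance only involves second moments. That hashing
  keeps the weighted signal sum w_b d_b^2 large also follows from second moments, by the duality
  x^2 / a >= 2 x y - a y^2 with the test vector g_x = d_x / (1 + L (p_x + q_x)). The number L of cells
  balances the loss of hashing against the total noise.
*)

theory Submission
  imports Defs
begin

section \<open>Moments of random vectors with dominated covariance\<close>

text \<open>Cell counts are dependent, so every estimate is controlled by a diagonal bound on the
  quadratic form of its covariance, which is stable under independent sums. A cell of mass u is
  estimated with variance at most u / n + \<tau>, where \<tau> is the noise variance after scaling
  by the sample sizes. The conditions L <= n and L^2 * \<tau> <= 1 make this of order 1 / L^2 at
  mass 1 / L, the scale at which a weight starts to decay. In the far case the signal is at least of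
  order \<alpha>^2 / k, while the noise variance of the statistic is of order 1 / (L * n^2) + L *
  \<tau>^2, with \<tau> of order log / (\<epsilon>^2 * n^2). Solving for n gives the two costs that
  \<open>L\<close> has to balance: k / (\<alpha>^2 * sqrt L) and L^(1/4) * sqrt (k * log) /
  (\<alpha> * \<epsilon>). The hash function must be exactly uniform although the public string
  consists of bits, hence the number of cells is a power of two. Of the error 1/3 in the far case,
  1/6 is spent on a signal that hashing or the weights make too small, and 1/6 on Chebyshev for the
  statistic.\<close>

abbreviation mean :: "'a pmf \<Rightarrow> ('a \<Rightarrow> real) \<Rightarrow> real" where
  "mean M f \<equiv> measure_pmf.expectation M f"

section \<open>Expectations over finitely supported distributions\<close>

lemma mean_bind:
  assumes "finite (set_pmf M)" "\<And>x. x \<in> set_pmf M \<Longrightarrow> finite (set_pmf (f x))"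
  shows "mean (bind_pmf M f) g = mean M (\<lambda>x. mean (f x) g)"
proof -
  have "mean (bind_pmf M f) g = (\<Sum>a\<in>set_pmf M. pmf M a *\<^sub>R mean (f a) g)"
    by (rule pmf_expectation_bind) (use assms in auto)
  also have "\<dots> = mean M (\<lambda>x. mean (f x) g)"
    using assms by (subst integral_measure_pmf[of "set_pmf M"]) auto
  finally show ?thesis .
qed

lemma mean_mono:
  assumes "finite (set_pmf M)" "\<And>x. x \<in> set_pmf M \<Longrightarrow> f x \<le> g x"
  shows "mean M f \<le> mean M g"
  using assms by (intro integral_mono_AE) (auto intro: integrable_measure_pmf_finite simp: AE_measure_pmf_iff)

lemma mean_cong:
  assumes "\<And>x. x \<in> set_pmf M \<Longrightarrow> f x = g x"
  shows "mean M f = mean M g"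
  using assms by (intro integral_cong_AE) (auto simp: AE_measure_pmf_iff)

lemma mean_add:
  assumes "finite (set_pmf M)"
  shows "mean M (\<lambda>x. f x + g x) = mean M f + mean M g"
  using assms by (simp add: integrable_measure_pmf_finite)

lemma mean_diff:
  assumes "finite (set_pmf M)"
  shows "mean M (\<lambda>x. f x - g x) = mean M f - mean M g"
  using assms by (simp add: integrable_measure_pmf_finite)

lemma mean_sum:
  assumes "finite (set_pmf M)"
  shows "mean M (\<lambda>x. \<Sum>i\<in>I. f i x) = (\<Sum>i\<in>I. mean M (f i))"
  using assms by (simp add: integrable_measure_pmf_finite)

lemma mean_add_const:
  assumes "finite (set_pmf M)"
  shows "mean M (\<lambda>x. f x + c) = mean M f + c"
  using assms by (simp add: integrable_measure_pmf_finite)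

lemma mean_cmult: "mean M (\<lambda>x. c * f x) = c * mean M f"
  by simp

lemma prob_le_mean:
  assumes fin: "finite (set_pmf M)" and "\<And>x. x \<in> set_pmf M \<Longrightarrow> 0 \<le> g x"
    and "\<And>x. x \<in> set_pmf M \<Longrightarrow> x \<in> S \<Longrightarrow> 1 \<le> g x"
  shows "measure_pmf.prob M S \<le> mean M g"
proof -
  have "measure_pmf.prob M S = mean M (indicator S)" by simp
  also have "\<dots> \<le> mean M g"
    using assms by (intro mean_mono) (auto simp: indicator_def)
  finally show ?thesis .
qed

lemma prob_bind:
  assumes "finite (set_pmf M)" "\<And>x. x \<in> set_pmf M \<Longrightarrow> finite (set_pmf (f x))"
  shows "measure_pmf.prob (bind_pmf M f) S = mean M (\<lambda>x. measure_pmf.prob (f x) S)"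
  using mean_bind[where g = "indicator S", OF assms] by simp

text \<open>The covariance matrix lies below the diagonal matrix \<open>s\<close> in the Loewner
  order, expressed through all test vectors \<open>v\<close>.\<close>

definition cov_dominated ::
    "'b set \<Rightarrow> ('b \<Rightarrow> real) pmf \<Rightarrow> ('b \<Rightarrow> real) \<Rightarrow> ('b \<Rightarrow> real) \<Rightarrow> bool" where
  "cov_dominated B M d s \<longleftrightarrow> finite (set_pmf M) \<and>
     (\<forall>v. mean M (\<lambda>V. \<Sum>b\<in>B. v b * V b) = (\<Sum>b\<in>B. v b * d b) \<and>
          mean M (\<lambda>V. (\<Sum>b\<in>B. v b * (V b - d b))\<^sup>2) \<le> (\<Sum>b\<in>B. (v b)\<^sup>2 * s b))"

context
  fixes B :: "'b set" and M d s
  assumes cd: "cov_dominated B M d s" and finB: "finite B"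
begin

lemma cov_dominated_finite: "finite (set_pmf M)"
  using cd by (simp add: cov_dominated_def)

lemma cov_dominated_mean_zero: "mean M (\<lambda>V. \<Sum>b\<in>B. v b * (V b - d b)) = 0"
proof -
  have "mean M (\<lambda>V. \<Sum>b\<in>B. v b * (V b - d b))
      = mean M (\<lambda>V. (\<Sum>b\<in>B. v b * V b) - (\<Sum>b\<in>B. v b * d b))"
    by (simp add: right_diff_distrib sum_subtractf)
  also have "\<dots> = 0"
    using cd by (subst mean_diff) (auto simp: cov_dominated_def)
  finally show ?thesis .
qed

lemma cov_dominated_var:
  "mean M (\<lambda>V. (\<Sum>b\<in>B. v b * (V b - d b))\<^sup>2) \<le> (\<Sum>b\<in>B. (v b)\<^sup>2 * s b)"
  using cd by (simp add: cov_dominated_def)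

text \<open>The test vector is the unit vector at \<open>b\<close>; the last bound is the
  decomposition into squared mean and variance.\<close>

lemma cov_dominated_coord:
  assumes "b \<in> B"
  shows "mean M (\<lambda>V. V b) = d b" "mean M (\<lambda>V. (V b - d b)\<^sup>2) \<le> s b"
    "mean M (\<lambda>V. (V b)\<^sup>2) \<le> (d b)\<^sup>2 + s b"
proof -
  have *: "(\<Sum>c\<in>B. of_bool (c = b) * f c) = f b" for f :: "'b \<Rightarrow> real"
    using finB assms by (subst sum.cong[OF refl, of B _ "\<lambda>c. if c = b then f b else 0"]) auto
  have **: "(\<Sum>c\<in>B. (of_bool (c = b))\<^sup>2 * f c) = f b" for f :: "'b \<Rightarrow> real"
    using finB assms by (subst sum.cong[OF refl, of B _ "\<lambda>c. if c = b then f b else 0"]) auto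
  show 1: "mean M (\<lambda>V. V b) = d b"
    using conjunct1[OF cd[unfolded cov_dominated_def, THEN conjunct2, rule_format, of "\<lambda>c. of_bool (c = b)"]]
    by (simp only: *)
  show 2: "mean M (\<lambda>V. (V b - d b)\<^sup>2) \<le> s b"
    using cov_dominated_var[of "\<lambda>c. of_bool (c = b)"] by (simp only: * **)
  have "mean M (\<lambda>V. (V b)\<^sup>2) = mean M (\<lambda>V. (V b - d b)\<^sup>2 + (2 * d b * V b - (d b)\<^sup>2))"
    by (intro mean_cong) (simp add: power2_eq_square algebra_simps)
  also have "\<dots> = mean M (\<lambda>V. (V b - d b)\<^sup>2) + (2 * d b * d b - (d b)\<^sup>2)"
    using cov_dominated_finite by (simp add: integrable_measure_pmf_finite 1)
  finally show "mean M (\<lambda>V. (V b)\<^sup>2) \<le> (d b)\<^sup>2 + s b"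
    using 2 by (simp add: power2_eq_square)
qed

end

lemma cov_dominatedI:
  assumes "finite (set_pmf M)"
    and "\<And>v. mean M (\<lambda>V. \<Sum>b\<in>B. v b * V b) = (\<Sum>b\<in>B. v b * d b)"
    and "\<And>v. mean M (\<lambda>V. (\<Sum>b\<in>B. v b * (V b - d b))\<^sup>2) \<le> (\<Sum>b\<in>B. (v b)\<^sup>2 * s b)"
  shows "cov_dominated B M d s"
  using assms by (auto simp: cov_dominated_def)

text \<open>Independence removes the cross term of the centred forms, so the bounds add. This one
  rule builds counts from samples, adds noise to counts and forms the sum and the difference of the
  two groups.\<close>

lemma cov_dominated_lincomb:
  fixes a c :: real
  assumes M: "cov_dominated B M d s" and M': "cov_dominated B M' d' s'" and B: "finite B"
  shows "cov_dominated B
    (do {V \<leftarrow> M; W \<leftarrow> M'; return_pmf (\<lambda>b. a * V b + c * W b)})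
    (\<lambda>b. a * d b + c * d' b) (\<lambda>b. a\<^sup>2 * s b + c\<^sup>2 * s' b)"
proof (rule cov_dominatedI)
  note fin = cov_dominated_finite[OF M B] cov_dominated_finite[OF M' B]
  show "finite (set_pmf (do {V \<leftarrow> M; W \<leftarrow> M'; return_pmf (\<lambda>b. a * V b + c * W b)}))"
    using fin by simp
  fix v
  let ?S = "\<lambda>f. (\<Sum>b\<in>B. v b * f b) :: real"
  have lin: "?S (\<lambda>b. a * V b + c * W b) = a * ?S V + c * ?S W" for V W
    by (simp add: sum.distrib sum_distrib_left algebra_simps)
  have "mean (do {V \<leftarrow> M; W \<leftarrow> M'; return_pmf (\<lambda>b. a * V b + c * W b)}) ?S
      = mean M (\<lambda>V. mean M' (\<lambda>W. a * ?S V + c * ?S W))"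
    using fin by (simp add: mean_bind lin)
  also have "\<dots> = mean M (\<lambda>V. a * ?S V + c * ?S d')"
    using M' fin by (simp add: mean_add cov_dominated_def)
  also have "\<dots> = a * ?S d + c * ?S d'"
    using M fin by (simp add: mean_add cov_dominated_def)
  finally show "mean (do {V \<leftarrow> M; W \<leftarrow> M'; return_pmf (\<lambda>b. a * V b + c * W b)}) ?S
      = ?S (\<lambda>b. a * d b + c * d' b)" by (simp add: lin)
  define X where "X V = (\<Sum>b\<in>B. v b * (V b - d b))" for V
  define Y where "Y W = (\<Sum>b\<in>B. v b * (W b - d' b))" for W
  have lin2: "(\<Sum>b\<in>B. v b * (a * V b + c * W b - (a * d b + c * d' b))) = a * X V + c * Y W" for V W
    unfolding X_def Y_def by (simp add: sum_distrib_left flip: sum.distrib) (simp add: algebra_simps)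
  have "mean (do {V \<leftarrow> M; W \<leftarrow> M'; return_pmf (\<lambda>b. a * V b + c * W b)})
         (\<lambda>V. (\<Sum>b\<in>B. v b * (V b - (a * d b + c * d' b)))\<^sup>2)
      = mean M (\<lambda>V. mean M' (\<lambda>W. (a * X V + c * Y W)\<^sup>2))"
    using fin by (simp add: mean_bind lin2)
  also have "\<dots> = mean M (\<lambda>V. mean M' (\<lambda>W. c\<^sup>2 * (Y W)\<^sup>2 + (2 * a * c * X V) * Y W + a\<^sup>2 * (X V)\<^sup>2))"
    by (simp add: power2_eq_square algebra_simps)
  also have "\<dots> = mean M (\<lambda>V. c\<^sup>2 * mean M' (\<lambda>W. (Y W)\<^sup>2) + a\<^sup>2 * (X V)\<^sup>2)"
    using fin cov_dominated_mean_zero[OF M' B, of v] by (simp add: mean_add Y_def)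
  also have "\<dots> = a\<^sup>2 * mean M (\<lambda>V. (X V)\<^sup>2) + c\<^sup>2 * mean M' (\<lambda>W. (Y W)\<^sup>2)"
    using fin by (simp add: mean_add)
  also have "\<dots> \<le> a\<^sup>2 * (\<Sum>b\<in>B. (v b)\<^sup>2 * s b) + c\<^sup>2 * (\<Sum>b\<in>B. (v b)\<^sup>2 * s' b)"
    unfolding X_def Y_def
    by (intro add_mono mult_left_mono cov_dominated_var[OF M B] cov_dominated_var[OF M' B]) auto
  also have "\<dots> = (\<Sum>b\<in>B. (v b)\<^sup>2 * (a\<^sup>2 * s b + c\<^sup>2 * s' b))"
    by (simp add: sum_distrib_left sum.distrib algebra_simps)
  finally show "mean (do {V \<leftarrow> M; W \<leftarrow> M'; return_pmf (\<lambda>b. a * V b + c * W b)})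
         (\<lambda>V. (\<Sum>b\<in>B. v b * (V b - (a * d b + c * d' b)))\<^sup>2)
      \<le> (\<Sum>b\<in>B. (v b)\<^sup>2 * (a\<^sup>2 * s b + c\<^sup>2 * s' b))" .
qed

lemma cov_dominated_mono:
  assumes "cov_dominated B M d s" "\<And>b. b \<in> B \<Longrightarrow> d b = d' b" "\<And>b. b \<in> B \<Longrightarrow> s b \<le> s' b"
  shows "cov_dominated B M d' s'"
proof (rule cov_dominatedI)
  show "finite (set_pmf M)" using assms by (simp add: cov_dominated_def)
  fix v
  show "mean M (\<lambda>V. \<Sum>b\<in>B. v b * V b) = (\<Sum>b\<in>B. v b * d' b)"
    using assms by (simp add: cov_dominated_def)
  have "mean M (\<lambda>V. (\<Sum>b\<in>B. v b * (V b - d' b))\<^sup>2) = mean M (\<lambda>V. (\<Sum>b\<in>B. v b * (V b - d b))\<^sup>2)"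
    using assms by (intro mean_cong arg_cong[where f = "\<lambda>x. x\<^sup>2"] sum.cong) auto
  also have "\<dots> \<le> (\<Sum>b\<in>B. (v b)\<^sup>2 * s b)" using assms by (simp add: cov_dominated_def)
  also have "\<dots> \<le> (\<Sum>b\<in>B. (v b)\<^sup>2 * s' b)" using assms by (intro sum_mono mult_left_mono) auto
  finally show "mean M (\<lambda>V. (\<Sum>b\<in>B. v b * (V b - d' b))\<^sup>2) \<le> (\<Sum>b\<in>B. (v b)\<^sup>2 * s' b)" .
qed

text \<open>The statistic is bilinear in two independent copies, so no fourth moments are needed.\<close>

lemma bilinear_variance:
  assumes M: "cov_dominated B M d s" and B: "finite B" and s: "\<And>b. b \<in> B \<Longrightarrow> 0 \<le> s b"
  shows "mean M (\<lambda>V. mean M (\<lambda>W. ((\<Sum>b\<in>B. w b * V b * W b) - (\<Sum>b\<in>B. w b * (d b)\<^sup>2))\<^sup>2))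
    \<le> 2 * (\<Sum>b\<in>B. (w b)\<^sup>2 * (d b)\<^sup>2 * s b) + (\<Sum>b\<in>B. (w b)\<^sup>2 * (s b)\<^sup>2)"
proof -
  note fin = cov_dominated_finite[OF M B]
  define X where "X V = (\<Sum>b\<in>B. w b * d b * (V b - d b))" for V
  define Y where "Y V W = (\<Sum>b\<in>B. w b * V b * (W b - d b))" for V W
  \<comment> \<open>One factor is centred at a time: \<open>Y\<close> replaces W by d with V kept,
    then \<open>X\<close> replaces V by d. Given V, the mean of \<open>Y\<close> is zero, so its
    product with \<open>X\<close> averages out.\<close>
  have split: "(\<Sum>b\<in>B. w b * V b * W b) - (\<Sum>b\<in>B. w b * (d b)\<^sup>2) = Y V W + X V" for V W
    unfolding X_def Y_def
    by (simp add: sum_subtractf[symmetric] sum.distrib[symmetric])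
       (simp add: algebra_simps power2_eq_square)
  have "mean M (\<lambda>W. (Y V W + X V)\<^sup>2) \<le> (\<Sum>b\<in>B. (w b)\<^sup>2 * s b * (V b)\<^sup>2) + (X V)\<^sup>2" for V
  proof -
    have "mean M (\<lambda>W. (Y V W + X V)\<^sup>2) = mean M (\<lambda>W. (Y V W)\<^sup>2 + (2 * X V) * Y V W + (X V)\<^sup>2)"
      by (simp add: power2_eq_square algebra_simps)
    also have "\<dots> = mean M (\<lambda>W. (Y V W)\<^sup>2) + (X V)\<^sup>2"
      using fin cov_dominated_mean_zero[OF M B, of "\<lambda>b. w b * V b"] by (simp add: mean_add Y_def)
    also have "mean M (\<lambda>W. (Y V W)\<^sup>2) \<le> (\<Sum>b\<in>B. (w b * V b)\<^sup>2 * s b)"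
      unfolding Y_def by (rule cov_dominated_var[OF M B])
    also have "\<dots> = (\<Sum>b\<in>B. (w b)\<^sup>2 * s b * (V b)\<^sup>2)" by (simp add: power_mult_distrib mult_ac)
    finally show ?thesis by simp
  qed
  then have "mean M (\<lambda>V. mean M (\<lambda>W. (Y V W + X V)\<^sup>2))
      \<le> mean M (\<lambda>V. (\<Sum>b\<in>B. (w b)\<^sup>2 * s b * (V b)\<^sup>2) + (X V)\<^sup>2)"
    by (intro mean_mono fin)
  also have "\<dots> = (\<Sum>b\<in>B. (w b)\<^sup>2 * s b * mean M (\<lambda>V. (V b)\<^sup>2)) + mean M (\<lambda>V. (X V)\<^sup>2)"
    using fin by (simp add: mean_add mean_sum)
  also have "\<dots> \<le> (\<Sum>b\<in>B. (w b)\<^sup>2 * s b * ((d b)\<^sup>2 + s b)) + (\<Sum>b\<in>B. (w b * d b)\<^sup>2 * s b)"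
    unfolding X_def using s
    by (intro add_mono sum_mono mult_left_mono cov_dominated_coord(3)[OF M B] cov_dominated_var[OF M B]) auto
  also have "\<dots> = 2 * (\<Sum>b\<in>B. (w b)\<^sup>2 * (d b)\<^sup>2 * s b) + (\<Sum>b\<in>B. (w b)\<^sup>2 * (s b)\<^sup>2)"
    by (simp add: sum_distrib_left flip: sum.distrib) (simp add: power2_eq_square algebra_simps)
  finally show ?thesis unfolding split .
qed

section \<open>Noisy histograms of samples\<close>

lemma mean_square_add_indep:
  assumes "finite (set_pmf M)" "finite (set_pmf M')" "mean M f = 0" "mean M' g = 0"
  shows "mean M (\<lambda>x. mean M' (\<lambda>y. (f x + g y)\<^sup>2)) = mean M (\<lambda>x. (f x)\<^sup>2) + mean M' (\<lambda>y. (g y)\<^sup>2)"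
proof -
  have "mean M' (\<lambda>y. (f x + g y)\<^sup>2) = (f x)\<^sup>2 + mean M' (\<lambda>y. (g y)\<^sup>2)" for x
  proof -
    have "mean M' (\<lambda>y. (f x + g y)\<^sup>2) = mean M' (\<lambda>y. (g y)\<^sup>2 + (2 * f x) * g y + (f x)\<^sup>2)"
      by (simp add: power2_eq_square algebra_simps)
    also have "\<dots> = (f x)\<^sup>2 + mean M' (\<lambda>y. (g y)\<^sup>2)"
      using assms by (simp add: mean_add)
    finally show ?thesis .
  qed
  then show ?thesis using assms by (simp add: mean_add)
qed

lemma binomial_half_moments:
  shows "mean (binomial_pmf t (1/2)) real = t / 2"
    and "mean (binomial_pmf t (1/2)) (\<lambda>x. (real x - t / 2)\<^sup>2) = t / 4"
proof (induction t)
  case 0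
  have "binomial_pmf 0 (1/2) = return_pmf 0" by (rule binomial_pmf_0) simp
  then show "mean (binomial_pmf 0 (1/2)) real = real 0 / 2"
    and "mean (binomial_pmf 0 (1/2)) (\<lambda>x. (real x - real 0 / 2)\<^sup>2) = real 0 / 4" by simp_all
next
  case (Suc t)
  let ?b = "binomial_pmf t (1/2)"
  let ?c = "bernoulli_pmf (1/2) :: bool pmf"
  have fin: "finite (set_pmf ?b)" by simp
  have rec: "mean (binomial_pmf (Suc t) (1/2)) g = mean ?c (\<lambda>b. mean ?b (\<lambda>x. g (of_bool b + x)))"
    for g :: "nat \<Rightarrow> real"
    by (subst binomial_pmf_Suc) (simp_all add: mean_bind of_bool_def)
  show 1: "mean (binomial_pmf (Suc t) (1/2)) real = real (Suc t) / 2"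
    unfolding rec using Suc by (simp add: integrable_measure_pmf_finite)
  have "mean (binomial_pmf (Suc t) (1/2)) (\<lambda>x. (real x - real (Suc t) / 2)\<^sup>2)
      = mean ?c (\<lambda>b. mean ?b (\<lambda>x. ((of_bool b - 1/2) + (real x - t/2))\<^sup>2))"
    unfolding rec by (intro mean_cong arg_cong[where f = "\<lambda>x. x\<^sup>2"]) (simp add: field_simps)
  also have "\<dots> = mean ?c (\<lambda>b. (of_bool b - 1/2)\<^sup>2) + mean ?b (\<lambda>x. (real x - t/2)\<^sup>2)"
    using Suc by (intro mean_square_add_indep) (simp_all add: integrable_measure_pmf_finite)
  also have "\<dots> = real (Suc t) / 4"
    using Suc by (simp add: field_simps power2_eq_square)
  finally show "mean (binomial_pmf (Suc t) (1/2)) (\<lambda>x. (real x - real (Suc t) / 2)\<^sup>2)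
      = real (Suc t) / 4" .
qed

lemma finite_set_replicate_pmf [simp]:
  "finite (set_pmf p) \<Longrightarrow> finite (set_pmf (replicate_pmf n p))"
  by (induction n) auto

lemma cov_dominated_iid_coords:
  fixes \<eta> :: "nat pmf" and \<mu> \<sigma> :: real
  assumes fin: "finite (set_pmf \<eta>)" and "mean \<eta> real = \<mu>"
    and var: "mean \<eta> (\<lambda>x. (real x - \<mu>)\<^sup>2) = \<sigma>"
  shows "cov_dominated {..<N} (map_pmf (\<lambda>m b. real (m ! b) - \<mu>) (replicate_pmf N \<eta>)) (\<lambda>_. 0) (\<lambda>_. \<sigma>)"
proof (rule cov_dominatedI)
  show "finite (set_pmf (map_pmf (\<lambda>m b. real (m ! b) - \<mu>) (replicate_pmf N \<eta>)))"
    using fin by simp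
  have mean0: "mean \<eta> (\<lambda>x. a * (real x - \<mu>)) = 0" for a
    using assms by (simp add: integrable_measure_pmf_finite)
  have "mean (replicate_pmf N \<eta>) (\<lambda>m. \<Sum>b<N. v b * (real (m ! b) - \<mu>)) = 0 \<and>
    mean (replicate_pmf N \<eta>) (\<lambda>m. (\<Sum>b<N. v b * (real (m ! b) - \<mu>))\<^sup>2) = (\<Sum>b<N. (v b)\<^sup>2 * \<sigma>)" for v
  proof (induction N arbitrary: v)
    case 0
    then show ?case by simp
  next
    case (Suc N)
    let ?X = "\<lambda>m. \<Sum>b<N. v (Suc b) * (real (m ! b) - \<mu>)"
    have rec: "mean (replicate_pmf (Suc N) \<eta>) (\<lambda>m. f (\<Sum>b<Suc N. v b * (real (m ! b) - \<mu>)))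
      = mean \<eta> (\<lambda>x. mean (replicate_pmf N \<eta>) (\<lambda>m. f (v 0 * (real x - \<mu>) + ?X m)))"
      for f :: "real \<Rightarrow> real"
      using fin unfolding sum.lessThan_Suc_shift by (simp add: mean_bind del: sum.lessThan_Suc)
    have 1: "mean (replicate_pmf (Suc N) \<eta>) (\<lambda>m. \<Sum>b<Suc N. v b * (real (m ! b) - \<mu>)) = 0"
      unfolding rec[of "\<lambda>x. x"] using fin Suc[of "\<lambda>b. v (Suc b)"] mean0[of "v 0"]
      by (simp only: mean_add finite_set_replicate_pmf) simp
    have "mean (replicate_pmf (Suc N) \<eta>) (\<lambda>m. (\<Sum>b<Suc N. v b * (real (m ! b) - \<mu>))\<^sup>2)
      = mean \<eta> (\<lambda>x. (v 0 * (real x - \<mu>))\<^sup>2) + mean (replicate_pmf N \<eta>) (\<lambda>m. (?X m)\<^sup>2)"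
      unfolding rec[of "\<lambda>x. x\<^sup>2"] using fin Suc[of "\<lambda>b. v (Suc b)"] mean0[of "v 0"]
      by (intro mean_square_add_indep) auto
    also have "\<dots> = (v 0)\<^sup>2 * \<sigma> + (\<Sum>b<N. (v (Suc b))\<^sup>2 * \<sigma>)"
      using Suc[of "\<lambda>b. v (Suc b)"] var by (simp add: power_mult_distrib)
    finally show ?case using 1 by (simp only: sum.lessThan_Suc_shift)
  qed
  then show "mean (map_pmf (\<lambda>m b. real (m ! b) - \<mu>) (replicate_pmf N \<eta>)) (\<lambda>V. \<Sum>b<N. v b * V b)
      = (\<Sum>b<N. v b * 0)"
    and "mean (map_pmf (\<lambda>m b. real (m ! b) - \<mu>) (replicate_pmf N \<eta>)) (\<lambda>V. (\<Sum>b<N. v b * (V b - 0))\<^sup>2)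
      \<le> (\<Sum>b<N. (v b)\<^sup>2 * \<sigma>)" for v by simp_all
qed

text \<open>A hashed sample is a random unit vector (or zero outside of \<open>B\<close>) with
  covariance diag P - P P^T; dropping the rank-one part leaves the diagonal.\<close>

lemma cov_dominated_sample:
  assumes fin: "finite (set_pmf p)" and B: "finite B"
  shows "cov_dominated B (map_pmf (\<lambda>x b. of_bool (h x = b)) p) (pmf (map_pmf h p)) (pmf (map_pmf h p))"
proof (rule cov_dominatedI)
  have P: "mean p (\<lambda>x. of_bool (h x = b)) = pmf (map_pmf h p) b" for b
  proof -
    have "mean p (\<lambda>x. of_bool (h x = b)) = mean p (indicator (h -` {b}))"
      by (intro mean_cong) (auto simp: indicator_def)
    then show ?thesis by (simp add: pmf_map)
  qed
  show "finite (set_pmf (map_pmf (\<lambda>x b. of_bool (h x = b)) p))" using fin by simp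
  fix v :: "'b \<Rightarrow> real"
  define Y where "Y x = (\<Sum>b\<in>B. v b * of_bool (h x = b))" for x
  let ?P = "pmf (map_pmf h p)"
  show 1: "mean (map_pmf (\<lambda>x b. of_bool (h x = b)) p) (\<lambda>V. \<Sum>b\<in>B. v b * V b) = (\<Sum>b\<in>B. v b * ?P b)"
    using fin by (simp add: mean_sum P)
  have Y: "mean p Y = (\<Sum>b\<in>B. v b * ?P b)" using 1 by (simp add: Y_def[abs_def])
  \<comment> \<open>At most one summand is nonzero, so squaring the sum squares its
    coefficient.\<close>
  have Y2: "(Y x)\<^sup>2 = (\<Sum>b\<in>B. (v b)\<^sup>2 * of_bool (h x = b))" for x
  proof (cases "h x \<in> B")
    case True
    have "(\<Sum>b\<in>B. f b * of_bool (h x = b)) = f (h x)" for f :: "'b \<Rightarrow> real"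
      using B True by (subst sum.cong[OF refl, of B _ "\<lambda>c. if c = h x then f (h x) else 0"]) auto
    then show ?thesis by (simp add: Y_def)
  next
    case False
    have "(\<Sum>b\<in>B. f b * of_bool (h x = b)) = 0" for f :: "'b \<Rightarrow> real"
      using False by (intro sum.neutral) auto
    then show ?thesis by (simp add: Y_def)
  qed
  have "mean (map_pmf (\<lambda>x b. of_bool (h x = b)) p) (\<lambda>V. (\<Sum>b\<in>B. v b * (V b - ?P b))\<^sup>2)
      = mean p (\<lambda>x. (Y x - mean p Y)\<^sup>2)"
    by (simp add: Y Y_def right_diff_distrib sum_subtractf)
  also have "\<dots> = mean p (\<lambda>x. (Y x)\<^sup>2 - (2 * mean p Y) * Y x + (mean p Y)\<^sup>2)"
    by (simp add: power2_eq_square algebra_simps)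
  also have "\<dots> = mean p (\<lambda>x. (Y x)\<^sup>2) - (mean p Y)\<^sup>2"
    using fin by (simp add: integrable_measure_pmf_finite power2_eq_square)
  also have "\<dots> \<le> mean p (\<lambda>x. (Y x)\<^sup>2)" by simp
  also have "\<dots> = (\<Sum>b\<in>B. (v b)\<^sup>2 * ?P b)" unfolding Y2 using fin by (simp add: mean_sum P)
  finally show "mean (map_pmf (\<lambda>x b. of_bool (h x = b)) p) (\<lambda>V. (\<Sum>b\<in>B. v b * (V b - ?P b))\<^sup>2)
      \<le> (\<Sum>b\<in>B. (v b)\<^sup>2 * ?P b)" .
qed

lemma cov_dominated_counts:
  assumes fin: "finite (set_pmf p)" and B: "finite B"
  shows "cov_dominated B (map_pmf (\<lambda>xs b. real (count_list (map h xs) b)) (replicate_pmf n p))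
    (\<lambda>b. n * pmf (map_pmf h p) b) (\<lambda>b. n * pmf (map_pmf h p) b)"
proof (induction n)
  case 0
  show ?case by (rule cov_dominatedI) simp_all
next
  case (Suc n)
  have eq: "map_pmf (\<lambda>xs b. real (count_list (map h xs) b)) (replicate_pmf (Suc n) p)
    = (do {V \<leftarrow> map_pmf (\<lambda>x b. of_bool (h x = b)) p;
        W \<leftarrow> map_pmf (\<lambda>xs b. real (count_list (map h xs) b)) (replicate_pmf n p);
        return_pmf (\<lambda>b. 1 * V b + 1 * W b)})"
    by (simp add: map_pmf_def bind_assoc_pmf bind_return_pmf)
       (intro bind_pmf_cong arg_cong[where f = return_pmf] ext refl, auto)
  show ?case unfolding eq
    by (rule cov_dominated_mono[OF cov_dominated_lincomb[OF cov_dominated_sample[OF fin B] Suc B]])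
       (simp_all add: algebra_simps)
qed

text \<open>What one third of a group amounts to once the shuffler is removed: noisy counts, centred
  by the noise mean t / 2 and scaled to frequencies.\<close>

definition block :: "('a \<Rightarrow> nat) \<Rightarrow> nat \<Rightarrow> nat \<Rightarrow> nat \<Rightarrow> 'a pmf \<Rightarrow> (nat \<Rightarrow> real) pmf" where
  "block h n N t p = do {
     xs \<leftarrow> replicate_pmf n p;
     m \<leftarrow> replicate_pmf N (binomial_pmf t (1/2));
     return_pmf (\<lambda>b. (real (count_list (map h xs) b) + real (m ! b) - t / 2) / n)}"

lemma cov_dominated_block:
  assumes fin: "finite (set_pmf p)" and n: "n > 0"
  shows "cov_dominated {..<N} (block h n N t p) (pmf (map_pmf h p))
    (\<lambda>b. pmf (map_pmf h p) b / n + t / (4 * (real n)\<^sup>2))"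
proof -
  have eq: "block h n N t p = (do {V \<leftarrow> map_pmf (\<lambda>xs b. real (count_list (map h xs) b)) (replicate_pmf n p);
        W \<leftarrow> map_pmf (\<lambda>m b. real (m ! b) - t / 2) (replicate_pmf N (binomial_pmf t (1/2)));
        return_pmf (\<lambda>b. (1/n) * V b + (1/n) * W b)})"
    unfolding block_def
    by (simp add: map_pmf_def bind_assoc_pmf bind_return_pmf add_divide_distrib diff_divide_distrib
          del: replicate_pmf.simps binomial_pmf_def) (simp add: algebra_simps)
  show ?thesis unfolding eq
    by (rule cov_dominated_mono[OF cov_dominated_lincomb[OF cov_dominated_counts[OF fin]
          cov_dominated_iid_coords[OF _ binomial_half_moments]]])
       (use n in \<open>simp_all add: field_simps power2_eq_square\<close>)
qed

section \<open>The weighted test for a fixed hash function\<close>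

text \<open>\<open>F\<close> is a noisy estimate and may be negative; the truncation at 0 keeps
  every weight in (0, 1].\<close>

definition weight :: "real \<Rightarrow> (nat \<Rightarrow> real) \<Rightarrow> nat \<Rightarrow> real" where
  "weight L F b = 1 / (1 + max 0 (L * F b))"

definition weighted_stat :: "nat \<Rightarrow> real \<Rightarrow> (nat \<Rightarrow> real) \<Rightarrow> (nat \<Rightarrow> real) \<Rightarrow> (nat \<Rightarrow> real) \<Rightarrow> real" where
  "weighted_stat N L F V W = (\<Sum>b<N. weight L F b * V b * W b)"

definition trial :: "nat \<Rightarrow> real \<Rightarrow> (nat \<Rightarrow> real) pmf \<Rightarrow> (nat \<Rightarrow> real) pmf \<Rightarrow> real pmf" where
  "trial N L Mu Md = do {F \<leftarrow> Mu; V \<leftarrow> Md; W \<leftarrow> Md; return_pmf (weighted_stat N L F V W)}"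

lemma weight_pos: "0 < weight L F b" and weight_le_1: "weight L F b \<le> 1"
  by (auto simp: weight_def)

text \<open>If \<open>F b\<close> is at least u / 2, the weight caps the product at 2 / L. Otherwise
  the estimation error exceeds u / 2 and pays for u itself.\<close>

lemma weighted_estimate_bound:
  assumes L: "L > 0" and u: "0 \<le> u"
  shows "(weight L F b * u)\<^sup>2 \<le> 4 / L\<^sup>2 + 4 * (F b - u)\<^sup>2"
proof (cases "F b \<ge> u / 2")
  case True
  have "L * (u / 2) \<le> L * F b" using True L by (intro mult_left_mono) auto
  then have "L * u \<le> 2 * (1 + max 0 (L * F b))" by (simp add: max_def)
  then have "weight L F b * u \<le> 2 / L"
    using L unfolding weight_def by (subst le_divide_eq) (auto simp: field_simps)
  moreover have "0 \<le> weight L F b * u" using weight_pos[of L F b] u by simp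
  ultimately have "(weight L F b * u)\<^sup>2 \<le> (2 / L)\<^sup>2" by (intro power_mono)
  then show ?thesis by (simp add: power_divide add_increasing2)
next
  case False
  have "weight L F b * u \<le> 1 * u" using weight_le_1 u by (intro mult_right_mono)
  also have "\<dots> \<le> 2 * (u - F b)" using False by simp
  finally have "(weight L F b * u)\<^sup>2 \<le> (2 * (u - F b))\<^sup>2"
    using u weight_pos[of L F b] by (intro power_mono) auto
  also have "\<dots> = 4 * (F b - u)\<^sup>2" by (simp add: power2_eq_square algebra_simps)
  finally show ?thesis by (simp add: add_increasing)
qed

text \<open>The situation for a fixed hash function: \<open>u\<close> and \<open>d\<close> stand for
  the sum and the difference of the hashed distributions. Having 1024 cells per unit of
  \<open>L\<close> keeps the collision losses below the constants used later.\<close>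

locale trial_setup =
  fixes N :: nat and L n \<tau> :: real and Mu Md :: "(nat \<Rightarrow> real) pmf" and u d s :: "nat \<Rightarrow> real"
  assumes Mu: "cov_dominated {..<N} Mu u s" and Md: "cov_dominated {..<N} Md d s"
    and u_nonneg: "\<And>b. 0 \<le> u b" and s_nonneg: "\<And>b. 0 \<le> s b" and s_le: "\<And>b. s b \<le> u b / n + \<tau>"
    and sum_u: "(\<Sum>b<N. u b) \<le> 2"
    and L: "1 \<le> L" "L \<le> n" and \<tau>: "0 \<le> \<tau>" "L\<^sup>2 * \<tau> \<le> 1" and N: "real N = 1024 * L"
begin

text \<open>The constants come from \<open>mean_noise\<close>: 16400 = 16 + 16 * 1024 and 2048 = 2 *
  1024, where 1024 = N / L.\<close>

definition var_bound :: real where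
  "var_bound = 16400 / (L * n\<^sup>2) + 2048 * L * \<tau>\<^sup>2"

abbreviation signal :: "(nat \<Rightarrow> real) \<Rightarrow> real" where
  "signal F \<equiv> \<Sum>b<N. weight L F b * (d b)\<^sup>2"

abbreviation noise :: "(nat \<Rightarrow> real) \<Rightarrow> real" where
  "noise F \<equiv> \<Sum>b<N. (weight L F b)\<^sup>2 * (s b)\<^sup>2"

lemma fin: "finite (set_pmf Mu)" "finite (set_pmf Md)"
  using Mu Md by (auto simp: cov_dominated_def)

lemma fin_trial: "finite (set_pmf (trial N L Mu Md))"
  using fin by (simp add: trial_def)

lemma noise_nonneg: "0 \<le> noise F" by (intro sum_nonneg) auto

text \<open>The weights act on the sampling part u / n, where they replace u by about 1 / L up to
  the estimation error; the privacy part \<tau> is paid in all \<open>N\<close> cells.\<close>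

lemma mean_noise: "mean Mu noise \<le> var_bound"
proof -
  have n: "n > 0" using L by simp
  have pt: "(weight L F b)\<^sup>2 * (s b)\<^sup>2 \<le> 2 / n\<^sup>2 * (4 / L\<^sup>2 + 4 * (F b - u b)\<^sup>2) + 2 * \<tau>\<^sup>2" for F b
  proof -
    have "(s b)\<^sup>2 \<le> (u b / n + \<tau>)\<^sup>2" using s_le s_nonneg by (intro power_mono)
    also have "\<dots> \<le> 2 * (u b / n)\<^sup>2 + 2 * \<tau>\<^sup>2" using sum_squares_bound[of "u b / n" \<tau>]
      by (simp add: power2_sum)
    finally have "(weight L F b)\<^sup>2 * (s b)\<^sup>2 \<le> (weight L F b)\<^sup>2 * (2 * (u b / n)\<^sup>2 + 2 * \<tau>\<^sup>2)"
      by (intro mult_left_mono) auto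
    also have "\<dots> = 2 / n\<^sup>2 * (weight L F b * u b)\<^sup>2 + 2 * ((weight L F b)\<^sup>2 * \<tau>\<^sup>2)"
      by (simp add: power_mult_distrib power_divide algebra_simps)
    also have "\<dots> \<le> 2 / n\<^sup>2 * (4 / L\<^sup>2 + 4 * (F b - u b)\<^sup>2) + 2 * (1 * \<tau>\<^sup>2)"
      using weighted_estimate_bound[of L "u b" F b] u_nonneg[of b] L weight_pos[of L F b] weight_le_1[of L F b]
      by (intro add_mono mult_left_mono mult_right_mono) (auto simp: power_le_one)
    finally show ?thesis by simp
  qed
  have "mean Mu noise \<le> mean Mu (\<lambda>F. \<Sum>b<N. (8 / n\<^sup>2) * (F b - u b)\<^sup>2 + (8 / (n\<^sup>2 * L\<^sup>2) + 2 * \<tau>\<^sup>2))"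
    by (intro mean_mono fin sum_mono order_trans[OF pt]) (simp add: algebra_simps)
  also have "\<dots> = (\<Sum>b<N. (8 / n\<^sup>2) * mean Mu (\<lambda>F. (F b - u b)\<^sup>2) + (8 / (n\<^sup>2 * L\<^sup>2) + 2 * \<tau>\<^sup>2))"
    using fin by (simp only: mean_sum mean_add_const) simp
  also have "\<dots> \<le> (\<Sum>b<N. (8 / n\<^sup>2) * (u b / n + \<tau>) + (8 / (n\<^sup>2 * L\<^sup>2) + 2 * \<tau>\<^sup>2))"
    using cov_dominated_coord(2)[OF Mu finite_lessThan] s_le
    by (intro sum_mono add_mono mult_left_mono) (force intro: order_trans)+
  also have "\<dots> = (8 / n\<^sup>2) * ((\<Sum>b<N. u b) / n) + N * ((8 / n\<^sup>2) * \<tau> + (8 / (n\<^sup>2 * L\<^sup>2) + 2 * \<tau>\<^sup>2))"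
    by (simp add: sum.distrib sum_distrib_left[symmetric] sum_divide_distrib[symmetric] distrib_left)
  also have "\<dots> \<le> (8 / n\<^sup>2) * (2 / L) + N * ((8 / n\<^sup>2) * (1 / L\<^sup>2) + (8 / (n\<^sup>2 * L\<^sup>2) + 2 * \<tau>\<^sup>2))"
    using sum_u L \<tau> n sum_nonneg[of "{..<N}" u] u_nonneg
    by (intro add_mono mult_left_mono frac_le) (auto simp: field_simps)
  also have "\<dots> = var_bound"
    unfolding var_bound_def N using L n by (simp add: field_simps power2_eq_square)
  finally show ?thesis .
qed

text \<open>Each single product of weight and \<open>s\<close> is at most the l2 norm
  \<open>sqrt (noise F)\<close>, which turns the mixed term of the variance into signal times
  noise.\<close>

lemma bilinear_variance_noise:
  "mean Md (\<lambda>V. mean Md (\<lambda>W. (weighted_stat N L F V W - signal F)\<^sup>2))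
    \<le> 2 * (signal F * sqrt (noise F)) + noise F"
proof -
  have "mean Md (\<lambda>V. mean Md (\<lambda>W. (weighted_stat N L F V W - signal F)\<^sup>2))
    \<le> 2 * (\<Sum>b<N. (weight L F b)\<^sup>2 * (d b)\<^sup>2 * s b) + noise F"
    unfolding weighted_stat_def by (rule bilinear_variance[OF Md _ s_nonneg]) simp
  also have "(\<Sum>b<N. (weight L F b)\<^sup>2 * (d b)\<^sup>2 * s b) \<le> (\<Sum>b<N. weight L F b * (d b)\<^sup>2 * sqrt (noise F))"
  proof (intro sum_mono)
    fix b assume b: "b \<in> {..<N}"
    have "(weight L F b * s b)\<^sup>2 \<le> noise F"
      using member_le_sum[OF b, of "\<lambda>b. (weight L F b)\<^sup>2 * (s b)\<^sup>2"] by (simp add: power_mult_distrib)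
    then have "weight L F b * s b \<le> sqrt (noise F)" by (rule real_le_rsqrt)
    then have "(weight L F b * (d b)\<^sup>2) * (weight L F b * s b) \<le> weight L F b * (d b)\<^sup>2 * sqrt (noise F)"
      using weight_pos[of L F b] by (intro mult_left_mono) auto
    then show "(weight L F b)\<^sup>2 * (d b)\<^sup>2 * s b \<le> weight L F b * (d b)\<^sup>2 * sqrt (noise F)"
      by (simp add: power2_eq_square mult_ac)
  qed
  also have "\<dots> = signal F * sqrt (noise F)" by (simp add: sum_distrib_right)
  finally show ?thesis by simp
qed

lemma prob_trial:
  "measure_pmf.prob (trial N L Mu Md) S
    = mean Mu (\<lambda>F. measure_pmf.prob (do {V \<leftarrow> Md; W \<leftarrow> Md; return_pmf (weighted_stat N L F V W)}) S)"
  unfolding trial_def using fin by (subst prob_bind) auto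

lemma fixed_weights_prob:
  assumes "\<And>z. 0 \<le> g z" "\<And>z. z \<in> S \<Longrightarrow> 1 \<le> g z"
  shows "measure_pmf.prob (do {V \<leftarrow> Md; W \<leftarrow> Md; return_pmf (weighted_stat N L F V W)}) S
    \<le> mean Md (\<lambda>V. mean Md (\<lambda>W. g (weighted_stat N L F V W)))"
proof -
  have "measure_pmf.prob (do {V \<leftarrow> Md; W \<leftarrow> Md; return_pmf (weighted_stat N L F V W)}) S
      \<le> mean (do {V \<leftarrow> Md; W \<leftarrow> Md; return_pmf (weighted_stat N L F V W)}) g"
    using assms fin by (intro prob_le_mean) auto
  also have "\<dots> = mean Md (\<lambda>V. mean Md (\<lambda>W. g (weighted_stat N L F V W)))"
    using fin by (simp add: mean_bind)
  finally show ?thesis .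
qed

text \<open>With d = 0 the signal vanishes for all weights, so Chebyshev involves only the average
  noise.\<close>

lemma null_error:
  assumes d: "\<And>b. b < N \<Longrightarrow> d b = 0" and T: "T > 0"
  shows "measure_pmf.prob (trial N L Mu Md) {z. z > T} \<le> var_bound / T\<^sup>2"
proof -
  have "measure_pmf.prob (do {V \<leftarrow> Md; W \<leftarrow> Md; return_pmf (weighted_stat N L F V W)}) {z. z > T}
      \<le> noise F / T\<^sup>2" for F
  proof -
    have S: "signal F = 0" using d by simp
    have "measure_pmf.prob (do {V \<leftarrow> Md; W \<leftarrow> Md; return_pmf (weighted_stat N L F V W)}) {z. z > T}
      \<le> mean Md (\<lambda>V. mean Md (\<lambda>W. (weighted_stat N L F V W)\<^sup>2 / T\<^sup>2))"
      by (rule fixed_weights_prob) (use T in \<open>auto simp: power_mono\<close>)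
    also have "\<dots> \<le> noise F / T\<^sup>2"
      using bilinear_variance_noise[of F] T by (simp add: S divide_right_mono)
    finally show ?thesis .
  qed
  then have "measure_pmf.prob (trial N L Mu Md) {z. z > T} \<le> mean Mu (\<lambda>F. noise F / T\<^sup>2)"
    unfolding prob_trial by (intro mean_mono fin)
  also have "\<dots> \<le> var_bound / T\<^sup>2"
    using mean_noise T by (simp add: divide_right_mono)
  finally show ?thesis .
qed

text \<open>Either the weights have lost the signal, which the indicator counts, or Chebyshev
  applies at half of the actual signal, which is then at least \<open>S0\<close>.\<close>

lemma fixed_weights_far:
  assumes S0: "S0 > 0"
  shows "measure_pmf.prob (do {V \<leftarrow> Md; W \<leftarrow> Md; return_pmf (weighted_stat N L F V W)}) {z. z \<le> S0 / 2}
    \<le> of_bool (signal F < S0) + 1/12 + 196 / S0\<^sup>2 * noise F" (is "?P \<le> _")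
proof (cases "signal F < S0")
  case True
  have "0 \<le> 196 / S0\<^sup>2 * noise F" using noise_nonneg[of F] by simp
  moreover have "?P \<le> 1" by (rule measure_pmf.prob_le_1)
  ultimately show ?thesis using True by (simp only: of_bool_eq)
next
  case False
  define s0 where "s0 = signal F"
  define v where "v = sqrt (noise F)"
  have s0: "S0 \<le> s0" "0 < s0" using False S0 by (auto simp: s0_def)
  have v: "0 \<le> v" "v\<^sup>2 = noise F" using noise_nonneg[of F] by (auto simp: v_def)
  have "?P \<le> mean Md (\<lambda>V. mean Md (\<lambda>W. (weighted_stat N L F V W - s0)\<^sup>2 / (s0 / 2)\<^sup>2))"
  proof (rule fixed_weights_prob)
    fix z assume "z \<in> {z. z \<le> S0 / 2}"
    then have "s0 / 2 \<le> s0 - z" using s0 by simp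
    then have "(s0 / 2)\<^sup>2 \<le> (s0 - z)\<^sup>2" using s0 by (intro power_mono) auto
    then show "1 \<le> (z - s0)\<^sup>2 / (s0 / 2)\<^sup>2" using s0 by (simp add: power2_commute)
  qed simp
  also have "\<dots> \<le> (2 * (s0 * v) + v\<^sup>2) / (s0 / 2)\<^sup>2"
    using bilinear_variance_noise[of F] v unfolding s0_def v_def by (simp add: divide_right_mono)
  also have "\<dots> = 4 * (2 * (s0 * v) + v\<^sup>2) / s0\<^sup>2" using s0 by (simp add: field_simps power2_eq_square)
  also have "\<dots> \<le> 4 * (s0\<^sup>2 / 48 + 49 * v\<^sup>2) / s0\<^sup>2"
  proof -
    \<comment> \<open>AM-GM with parameter 48: after multiplication by 4 it leaves 4 / 48 = 1 / 12
      and 4 * 49 = 196.\<close>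
    have "0 \<le> (s0 - 48 * v)\<^sup>2" by simp
    then have "2 * (s0 * v) \<le> s0\<^sup>2 / 48 + 48 * v\<^sup>2"
      by (simp add: power2_eq_square algebra_simps)
    then show ?thesis by (intro divide_right_mono mult_left_mono) auto
  qed
  also have "\<dots> = 1 / 12 + 196 * v\<^sup>2 / s0\<^sup>2" using s0 by (simp add: field_simps)
  also have "\<dots> \<le> 1 / 12 + 196 * v\<^sup>2 / S0\<^sup>2"
    using s0 S0 by (intro add_left_mono divide_left_mono power_mono mult_pos_pos) auto
  finally show ?thesis using False v by simp
qed

text \<open>AM-GM turns the overshoot L * (F - u) into a variance, so the truncation in the weight
  does no harm. The variance is controlled by \<open>L \<le> n\<close> and
  \<open>L\<^sup>2 * \<tau> \<le> 1\<close>.\<close>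

lemma mean_weight_inverse:
  assumes "b < N"
  shows "mean Mu (\<lambda>F. 1 / weight L F b) \<le> 2 * (1 + L * u b)"
proof -
  have pt: "1 / weight L F b \<le> (L\<^sup>2 / 2) * (F b - u b)\<^sup>2 + (3 / 2 + L * u b)" for F
  proof -
    have "0 \<le> (L * (F b - u b) - 1)\<^sup>2" by simp
    then have "L * F b \<le> L * u b + 1/2 + (L\<^sup>2 / 2) * (F b - u b)\<^sup>2"
      by (simp add: power2_eq_square algebra_simps)
    moreover have "0 \<le> L * u b + 1/2 + (L\<^sup>2 / 2) * (F b - u b)\<^sup>2" using L u_nonneg[of b] by simp
    ultimately show ?thesis by (simp add: weight_def)
  qed
  have "mean Mu (\<lambda>F. 1 / weight L F b) \<le> mean Mu (\<lambda>F. (L\<^sup>2 / 2) * (F b - u b)\<^sup>2 + (3 / 2 + L * u b))"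
    by (intro mean_mono fin pt)
  also have "\<dots> = (L\<^sup>2 / 2) * mean Mu (\<lambda>F. (F b - u b)\<^sup>2) + (3 / 2 + L * u b)"
    using fin by (simp only: mean_add_const) simp
  also have "\<dots> \<le> (L\<^sup>2 / 2) * (u b / n + \<tau>) + (3 / 2 + L * u b)"
    using cov_dominated_coord(2)[OF Mu finite_lessThan, of b] s_le[of b] assms L
    by (intro add_mono mult_left_mono) auto
  finally have 1: "mean Mu (\<lambda>F. 1 / weight L F b) \<le> (L\<^sup>2 / 2) * (u b / n + \<tau>) + (3 / 2 + L * u b)" .
  have "(L\<^sup>2 / 2) * (u b / n + \<tau>) \<le> L * u b / 2 + 1 / 2"
  proof -
    have "L\<^sup>2 * (u b / n) = (L * u b) * (L / n)" by (simp add: power2_eq_square)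
    also have "\<dots> \<le> (L * u b) * 1" using L u_nonneg[of b] by (intro mult_left_mono) auto
    finally show ?thesis using \<tau> by (simp add: algebra_simps)
  qed
  with 1 have "mean Mu (\<lambda>F. 1 / weight L F b) \<le> L * u b / 2 + 1 / 2 + (3 / 2 + L * u b)" by linarith
  moreover have "0 \<le> L * u b" using L u_nonneg[of b] by simp
  ultimately show ?thesis by (simp add: algebra_simps)
qed

text \<open>
  The signal is bounded below through \<open>x\<^sup>2 / a \<ge> 2 x y - a y\<^sup>2\<close>, which trades the random weights in
  denominators for an expression that is linear in their inverses. Any test vector \<open>g\<close> may be used.
\<close>

lemma far_error:
  fixes g :: "nat \<Rightarrow> real"
  assumes \<Phi>: "\<Phi> > 0" and S0: "S0 > 0" "S0 \<le> \<Phi> / 1440"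
  shows "measure_pmf.prob (trial N L Mu Md) {z. z \<le> S0 / 2}
    \<le> 1/12 + 196 * var_bound / S0\<^sup>2 + 4 * ((\<Sum>b<N. d b * g b) - \<Phi>)\<^sup>2 / \<Phi>\<^sup>2
       + (\<Sum>b<N. (g b)\<^sup>2 * (1 + L * u b)) / (180 * \<Phi>)"
proof -
  define G where "G = (\<Sum>b<N. d b * g b)"
  define H where "H F = (\<Sum>b<N. (g b)\<^sup>2 * (1 / weight L F b))" for F
  have H_nonneg: "0 \<le> H F" for F unfolding H_def
    using weight_pos[of L F] by (intro sum_nonneg mult_nonneg_nonneg) (auto intro: less_imp_le)
  \<comment> \<open>The duality with x = d, a = 1 / weight and y = g / 720; the nonnegative
    difference of the two sides is a weighted square.\<close>
  have lower: "(1/360) * G - (1/720)\<^sup>2 * H F \<le> signal F" for F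
  proof -
    have "2 * (1/720) * (d b * g b) - (1/720)\<^sup>2 * ((g b)\<^sup>2 * (1 / weight L F b)) \<le> weight L F b * (d b)\<^sup>2" for b
    proof -
      have w: "weight L F b > 0" by (rule weight_pos)
      have "0 \<le> weight L F b * (d b - (1/720) * g b / weight L F b)\<^sup>2" using w by simp
      also have "\<dots> = weight L F b * (d b)\<^sup>2
          - (2 * (1/720) * (d b * g b) - (1/720)\<^sup>2 * ((g b)\<^sup>2 * (1 / weight L F b)))"
        using w by (simp add: field_simps power2_eq_square)
      finally show ?thesis by simp
    qed
    then have "(\<Sum>b<N. 2 * (1/720) * (d b * g b) - (1/720)\<^sup>2 * ((g b)\<^sup>2 * (1 / weight L F b))) \<le> signal F"
      by (intro sum_mono)
    then show ?thesis by (simp add: G_def H_def sum_subtractf sum_distrib_left)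
  qed
  \<comment> \<open>A lost signal forces G below \<Phi> / 2 (Chebyshev) or H above 360 * \<Phi>
    (Markov), since otherwise the lower bound is at least \<Phi> / 720 - \<Phi> / 1440 = \<Phi> /
    1440. The scale 1 / 720 is chosen for this.\<close>
  have bad: "of_bool (signal F < S0) \<le> 4 * (G - \<Phi>)\<^sup>2 / \<Phi>\<^sup>2 + H F / (360 * \<Phi>)" for F
  proof (cases "signal F < S0")
    case True
    have "\<not> (G \<ge> \<Phi> / 2 \<and> H F \<le> 360 * \<Phi>)"
    proof
      assume *: "G \<ge> \<Phi> / 2 \<and> H F \<le> 360 * \<Phi>"
      then have "(1/360) * (\<Phi> / 2) - (1/720)\<^sup>2 * (360 * \<Phi>) \<le> (1/360) * G - (1/720)\<^sup>2 * H F"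
        by (intro diff_mono mult_left_mono) auto
      also have "\<dots> < \<Phi> / 1440" using lower[of F] True S0 by simp
      finally show False by (simp add: power2_eq_square)
    qed
    then consider "\<Phi> / 2 \<le> \<Phi> - G" | "360 * \<Phi> \<le> H F" by fastforce
    then show ?thesis
    proof cases
      case 1
      then have "(\<Phi> / 2)\<^sup>2 \<le> (\<Phi> - G)\<^sup>2" using \<Phi> by (intro power_mono) auto
      then have "1 \<le> 4 * (G - \<Phi>)\<^sup>2 / \<Phi>\<^sup>2"
        using \<Phi> by (simp add: power_divide power2_commute)
      then show ?thesis using True H_nonneg[of F] \<Phi> by (simp add: add_increasing2)
    next
      case 2
      then have "1 \<le> H F / (360 * \<Phi>)" using \<Phi> by simp
      then show ?thesis using True by (simp add: add_increasing)
    qed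
  qed (use H_nonneg \<Phi> in simp)
  have "measure_pmf.prob (trial N L Mu Md) {z. z \<le> S0 / 2}
      \<le> mean Mu (\<lambda>F. 196 / S0\<^sup>2 * noise F + 1 / (360 * \<Phi>) * H F + (1/12 + 4 * (G - \<Phi>)\<^sup>2 / \<Phi>\<^sup>2))"
    unfolding prob_trial
  proof (intro mean_mono fin order_trans[OF fixed_weights_far[OF S0(1)]])
    fix F show "of_bool (signal F < S0) + 1/12 + 196 / S0\<^sup>2 * noise F
      \<le> 196 / S0\<^sup>2 * noise F + 1 / (360 * \<Phi>) * H F + (1/12 + 4 * (G - \<Phi>)\<^sup>2 / \<Phi>\<^sup>2)"
      using bad[of F] by simp
  qed
  also have "\<dots> = 196 / S0\<^sup>2 * mean Mu noise + 1 / (360 * \<Phi>) * mean Mu H + (1/12 + 4 * (G - \<Phi>)\<^sup>2 / \<Phi>\<^sup>2)"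
    using fin by (simp only: mean_add_const mean_add) simp
  also have "\<dots> \<le> 196 / S0\<^sup>2 * var_bound
      + 1 / (360 * \<Phi>) * (2 * (\<Sum>b<N. (g b)\<^sup>2 * (1 + L * u b))) + (1/12 + 4 * (G - \<Phi>)\<^sup>2 / \<Phi>\<^sup>2)"
  proof (intro add_mono mult_left_mono mean_noise order_refl)
    have "mean Mu H = (\<Sum>b<N. (g b)\<^sup>2 * mean Mu (\<lambda>F. 1 / weight L F b))"
      unfolding H_def using fin by (simp only: mean_sum mean_cmult)
    also have "\<dots> \<le> (\<Sum>b<N. (g b)\<^sup>2 * (2 * (1 + L * u b)))"
      by (intro sum_mono mult_left_mono mean_weight_inverse) auto
    finally show "mean Mu H \<le> 2 * (\<Sum>b<N. (g b)\<^sup>2 * (1 + L * u b))"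
      by (simp only: sum_distrib_left mult.left_commute)
  qed (use \<Phi> in auto)
  finally show ?thesis by (simp add: G_def)
qed

end

section \<open>Collisions of a uniform hash function\<close>

text \<open>A uniform function from \<open>A\<close> to the cells; its values outside of
  \<open>A\<close> are fixed to 0, so the support is finite.\<close>

definition hash_pmf :: "nat set \<Rightarrow> nat \<Rightarrow> (nat \<Rightarrow> nat) pmf" where
  "hash_pmf A N = Pi_pmf A 0 (\<lambda>_. pmf_of_set {..<N})"

definition collide :: "(nat \<Rightarrow> nat) \<Rightarrow> nat \<Rightarrow> nat \<Rightarrow> real" where
  "collide h x y = of_bool (h x = h y)"

text \<open>The push-forward along \<open>h\<close> of the signed vector \<open>f\<close> on
  \<open>A\<close>.\<close>

definition fibre_sum :: "nat set \<Rightarrow> (nat \<Rightarrow> real) \<Rightarrow> (nat \<Rightarrow> nat) \<Rightarrow> nat \<Rightarrow> real" where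
  "fibre_sum A f h b = (\<Sum>x\<in>A. f x * of_bool (h x = b))"

lemma collide_commute: "collide h x y = collide h y x"
  by (auto simp: collide_def)

lemma collide_refl [simp]: "collide h x x = 1"
  by (simp add: collide_def)

context
  fixes A :: "nat set" and N :: nat
  assumes A: "finite A" and N: "N > 0"
begin

lemma lessThan_N_nonempty [simp]: "{..<N} \<noteq> {}"
  using N by auto

lemma set_hash_pmf: "set_pmf (hash_pmf A N) = PiE_dflt A 0 (\<lambda>_. {..<N})"
  using A by (simp add: hash_pmf_def set_Pi_pmf o_def)

lemma finite_hash_pmf [simp]: "finite (set_pmf (hash_pmf A N))"
  unfolding set_hash_pmf using A by (intro finite_PiE_dflt) auto

lemma hash_less: "h \<in> set_pmf (hash_pmf A N) \<Longrightarrow> x \<in> A \<Longrightarrow> h x < N"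
  by (auto simp: set_hash_pmf PiE_dflt_def)

text \<open>Resampling the value of the hash function at \<open>z\<close> yields all joint collision probabilities.\<close>

lemma mean_collide_mult:
  assumes z: "z \<in> A" and w: "w \<in> A" "w \<noteq> z" and f: "\<And>h v. f (h(z := v)) = f h"
  shows "mean (hash_pmf A N) (\<lambda>h. collide h z w * f h) = (1 / N) * mean (hash_pmf A N) f"
proof -
  let ?M = "Pi_pmf (A - {z}) 0 (\<lambda>_. pmf_of_set {..<N})"
  have fin: "finite (set_pmf ?M)"
    using A by (auto simp: set_Pi_pmf o_def intro!: finite_PiE_dflt)
  have eq: "hash_pmf A N = do {y \<leftarrow> pmf_of_set {..<N}; h \<leftarrow> ?M; return_pmf (h(z := y))}"
    unfolding hash_pmf_def using A z Pi_pmf_insert'[of "A - {z}" z 0 "\<lambda>_. pmf_of_set {..<N}"]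
    by (simp add: insert_absorb)
  have eq': "hash_pmf A N = do {h \<leftarrow> ?M; y \<leftarrow> pmf_of_set {..<N}; return_pmf (h(z := y))}"
    unfolding eq by (rule bind_commute_pmf)
  have rec: "mean (hash_pmf A N) F = mean ?M (\<lambda>h. mean (pmf_of_set {..<N}) (\<lambda>y. F (h(z := y))))" for F
    unfolding eq' using fin by (simp add: mean_bind)
  have "mean (hash_pmf A N) (\<lambda>h. collide h z w * f h) = mean ?M (\<lambda>h. (1 / N) * f h)"
    unfolding rec
  proof (intro mean_cong)
    fix h assume "h \<in> set_pmf ?M"
    then have hw: "h w < N" using A w by (auto simp: set_Pi_pmf PiE_dflt_def)
    have "mean (pmf_of_set {..<N}) (\<lambda>y. of_bool (y = h w)) = (\<Sum>y<N. of_bool (y = h w)) / N"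
      by (simp add: integral_pmf_of_set)
    also have "(\<Sum>y<N. of_bool (y = h w)) = (1::real)"
      using hw by (subst sum.cong[OF refl, of _ _ "\<lambda>y. if y = h w then 1 else 0"]) auto
    finally show "mean (pmf_of_set {..<N}) (\<lambda>y. collide (h(z := y)) z w * f (h(z := y))) = (1 / N) * f h"
      using w f by (simp add: collide_def)
  qed
  also have "\<dots> = (1 / N) * mean ?M f" by simp
  also have "mean ?M f = mean (hash_pmf A N) f"
    unfolding rec using f by simp
  finally show ?thesis .
qed

lemma mean_collide:
  assumes "x \<in> A" "y \<in> A"
  shows "mean (hash_pmf A N) (\<lambda>h. collide h x y) = (if x = y then 1 else 1 / N)"
  using mean_collide_mult[of x y "\<lambda>_. 1"] assms by auto

text \<open>If the unordered pairs differ, one endpoint of the first lies outside of the second;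
  resampling the hash value there factors out 1 / N.\<close>

lemma mean_collide_collide:
  assumes "x \<in> A" "y \<in> A" "x \<noteq> y" "z \<in> A" "w \<in> A" "z \<noteq> w" "{x, y} \<noteq> {z, w}"
  shows "mean (hash_pmf A N) (\<lambda>h. collide h x y * collide h z w) = 1 / (real N)\<^sup>2"
proof -
  have *: "mean (hash_pmf A N) (\<lambda>h. collide h x y * collide h z w) = 1 / (real N)\<^sup>2"
    if "x \<in> A" "y \<in> A" "x \<noteq> y" "z \<in> A" "w \<in> A" "z \<noteq> w" "x \<noteq> z" "x \<noteq> w" for x y z w
    using that mean_collide_mult[of x y "\<lambda>h. collide h z w"] mean_collide[of z w]
    by (simp add: collide_def power2_eq_square)
  consider "x \<noteq> z" "x \<noteq> w" | "y \<noteq> z" "y \<noteq> w" using assms by auto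
  then show ?thesis
  proof cases
    case 1
    then show ?thesis using *[of x y z w] assms by simp
  next
    case 2
    then show ?thesis using *[of y x z w] assms by (simp add: collide_commute[of _ y x])
  qed
qed

lemma fibre_sum_mult:
  assumes "h \<in> set_pmf (hash_pmf A N)"
  shows "(\<Sum>b<N. fibre_sum A f h b * e b) = (\<Sum>x\<in>A. f x * e (h x))"
proof -
  have "(\<Sum>b<N. fibre_sum A f h b * e b) = (\<Sum>x\<in>A. \<Sum>b<N. f x * of_bool (h x = b) * e b)"
    unfolding fibre_sum_def sum_distrib_right by (rule sum.swap)
  also have "\<dots> = (\<Sum>x\<in>A. f x * e (h x))"
  proof (intro sum.cong refl)
    fix x assume "x \<in> A"
    with assms have "h x < N" by (rule hash_less)
    then show "(\<Sum>b<N. f x * of_bool (h x = b) * e b) = f x * e (h x)"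
      by (subst sum.cong[OF refl, of _ _ "\<lambda>b. if b = h x then f x * e (h x) else 0"]) auto
  qed
  finally show ?thesis .
qed

lemma fibre_sum_collide: "fibre_sum A f h (h x) = (\<Sum>y\<in>A. f y * collide h x y)"
  by (auto simp: fibre_sum_def collide_def intro!: sum.cong)

text \<open>Distinct points collide with probability 1 / N, so only the diagonal adds to the square
  of the sum divided by N.\<close>

lemma mean_fibre_sum_square:
  "mean (hash_pmf A N) (\<lambda>h. \<Sum>b<N. (fibre_sum A f h b)\<^sup>2) \<le> (\<Sum>x\<in>A. (f x)\<^sup>2) + (\<Sum>x\<in>A. f x)\<^sup>2 / N"
proof -
  have "mean (hash_pmf A N) (\<lambda>h. \<Sum>b<N. (fibre_sum A f h b)\<^sup>2)
      = mean (hash_pmf A N) (\<lambda>h. \<Sum>x\<in>A. \<Sum>y\<in>A. f x * f y * collide h x y)"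
    by (intro mean_cong)
       (simp add: power2_eq_square fibre_sum_mult fibre_sum_collide sum_distrib_left mult.assoc)
  also have "\<dots> = (\<Sum>x\<in>A. \<Sum>y\<in>A. f x * f y * (if x = y then 1 else 1 / N))"
    by (simp only: mean_sum finite_hash_pmf mean_cmult) (simp add: mean_collide cong: sum.cong)
  also have "\<dots> = (\<Sum>x\<in>A. \<Sum>y\<in>A. (if x = y then (1 - 1 / N) * (f y)\<^sup>2 else 0) + f x * f y / N)"
    by (intro sum.cong refl) (auto simp: power2_eq_square algebra_simps)
  also have "\<dots> = (1 - 1 / N) * (\<Sum>x\<in>A. (f x)\<^sup>2) + (\<Sum>x\<in>A. f x)\<^sup>2 / N"
  proof -
    have "(\<Sum>x\<in>A. \<Sum>y\<in>A. f x * f y / N) = (\<Sum>x\<in>A. f x)\<^sup>2 / N"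
      by (simp only: power2_eq_square sum_product sum_divide_distrib)
    then show ?thesis using A by (simp add: sum.distrib flip: sum_distrib_left)
  qed
  also have "(1 - 1 / N) * (\<Sum>x\<in>A. (f x)\<^sup>2) \<le> 1 * (\<Sum>x\<in>A. (f x)\<^sup>2)"
    by (intro mult_right_mono sum_nonneg) auto
  finally show ?thesis by simp
qed

text \<open>Written linearly in equality indicators, each of which collapses a double sum. The
  coefficients are fixed by the values 1 / N^2, 1 / N and 1 for three, two and one distinct
  points.\<close>

lemma mean_triple_collide:
  assumes "x \<in> A" "y \<in> A" "z \<in> A"
  shows "mean (hash_pmf A N) (\<lambda>h. collide h z x * collide h z y)
    = 1 / (real N)\<^sup>2 + (1 / N - 1 / (real N)\<^sup>2) * (of_bool (x = y) + of_bool (x = z) + of_bool (y = z))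
      + (1 - 3 / N + 2 / (real N)\<^sup>2) * of_bool (x = z \<and> y = z)"
proof -
  have sq: "collide h x y * collide h x y = collide h x y" for h x y by (simp add: collide_def)
  have NN: "mean (hash_pmf A N) (\<lambda>h. collide h z x * collide h z y) = 1 / (real N)\<^sup>2"
    if "x \<noteq> y" "x \<noteq> z" "y \<noteq> z"
    using that assms by (intro mean_collide_collide) auto
  show ?thesis
    using assms NN
    by (cases "x = y"; cases "x = z"; cases "y = z") (auto simp: sq mean_collide)
qed

text \<open>Weighting a cell by its own mass amounts to averaging over the elements z of the cell,
  so the second moment is required in the cell that contains z.\<close>

lemma mean_square_at:
  assumes z: "z \<in> A"
  shows "mean (hash_pmf A N) (\<lambda>h. (fibre_sum A f h (h z))\<^sup>2)
    \<le> 2 * (f z)\<^sup>2 + (\<Sum>x\<in>A. (f x)\<^sup>2) / N + 2 * (\<Sum>x\<in>A. f x)\<^sup>2 / (real N)\<^sup>2"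
proof -
  define S where "S = (\<Sum>x\<in>A. f x)"
  define Q where "Q = (\<Sum>x\<in>A. (f x)\<^sup>2)"
  define a where "a = 1 / real N"
  have a: "0 < a" "a \<le> 1" using N by (auto simp: a_def)
  have Q: "0 \<le> Q" unfolding Q_def by (intro sum_nonneg) auto
  have "mean (hash_pmf A N) (\<lambda>h. (fibre_sum A f h (h z))\<^sup>2)
      = mean (hash_pmf A N) (\<lambda>h. \<Sum>x\<in>A. \<Sum>y\<in>A. (f x * f y) * (collide h z x * collide h z y))"
    by (intro mean_cong) (simp add: power2_eq_square fibre_sum_collide sum_product algebra_simps)
  also have "\<dots> = (\<Sum>x\<in>A. \<Sum>y\<in>A. (f x * f y) *
      (a\<^sup>2 + (a - a\<^sup>2) * (of_bool (x = y) + of_bool (x = z) + of_bool (y = z))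
      + (1 - 3 * a + 2 * a\<^sup>2) * of_bool (x = z \<and> y = z)))"
    using z by (simp only: mean_sum finite_hash_pmf mean_cmult)
      (intro sum.cong refl, simp add: mean_triple_collide a_def power_divide)
  also have "\<dots> = (\<Sum>x\<in>A. \<Sum>y\<in>A. a\<^sup>2 * (f x * f y) + (if x = y then (a - a\<^sup>2) * (f y)\<^sup>2 else 0)
      + (if x = z then (a - a\<^sup>2) * f z * f y else 0) + (if y = z then (a - a\<^sup>2) * f z * f x else 0)
      + (if y = z then (if x = z then (1 - 3 * a + 2 * a\<^sup>2) * (f z)\<^sup>2 else 0) else 0))"
    by (intro sum.cong refl) (auto simp: power2_eq_square algebra_simps)
  also have "\<dots> = a\<^sup>2 * S\<^sup>2 + (a - a\<^sup>2) * Q + 2 * ((a - a\<^sup>2) * f z * S) + (1 - 3 * a + 2 * a\<^sup>2) * (f z)\<^sup>2"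
  proof -
    have "(\<Sum>x\<in>A. \<Sum>y\<in>A. if x = z then (a - a\<^sup>2) * f z * f y else 0) = (a - a\<^sup>2) * f z * S"
      unfolding S_def using A z by (subst sum.swap) (simp add: sum.delta' sum_distrib_left)
    moreover have "(\<Sum>x\<in>A. \<Sum>y\<in>A. a\<^sup>2 * (f x * f y)) = a\<^sup>2 * S\<^sup>2"
      unfolding S_def power2_eq_square[of "sum f A"] sum_product by (simp add: sum_distrib_left)
    moreover have "(\<Sum>x\<in>A. \<Sum>y\<in>A. if x = y then (a - a\<^sup>2) * (f y)\<^sup>2 else 0) = (a - a\<^sup>2) * Q"
      unfolding Q_def using A by (simp add: sum_distrib_left)
    moreover have "(\<Sum>x\<in>A. \<Sum>y\<in>A. if y = z then (a - a\<^sup>2) * f z * f x else 0) = (a - a\<^sup>2) * f z * S"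
      unfolding S_def using A z by (simp add: sum_distrib_left)
    moreover have "(\<Sum>x\<in>A. \<Sum>y\<in>A. if y = z then (if x = z then (1 - 3 * a + 2 * a\<^sup>2) * (f z)\<^sup>2 else 0) else 0)
      = (1 - 3 * a + 2 * a\<^sup>2) * (f z)\<^sup>2" using A z by simp
    ultimately show ?thesis by (simp only: sum.distrib)
  qed
  also have "\<dots> \<le> a\<^sup>2 * S\<^sup>2 + a * Q + ((f z)\<^sup>2 + a\<^sup>2 * S\<^sup>2) + 1 * (f z)\<^sup>2"
  proof (intro add_mono mult_right_mono Q order_refl)
    have "2 * ((a - a\<^sup>2) * f z * S) = (2 * (a * S) * f z) * (1 - a)"
      by (simp add: power2_eq_square algebra_simps)
    also have "\<dots> \<le> ((f z)\<^sup>2 + a\<^sup>2 * S\<^sup>2) * (1 - a)"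
      using sum_squares_bound[of "a * S" "f z"] a by (intro mult_right_mono) (simp_all add: power_mult_distrib)
    also have "\<dots> \<le> ((f z)\<^sup>2 + a\<^sup>2 * S\<^sup>2) * 1"
      using a by (intro mult_left_mono) auto
    finally show "2 * ((a - a\<^sup>2) * f z * S) \<le> (f z)\<^sup>2 + a\<^sup>2 * S\<^sup>2" by simp
    have "a * a \<le> a * 1" using a by (intro mult_left_mono) auto
    then show "1 - 3 * a + 2 * a\<^sup>2 \<le> 1" using a by (simp add: power2_eq_square)
  qed (use a in \<open>auto simp: power2_eq_square\<close>)
  finally show ?thesis
    by (simp add: a_def S_def Q_def power_divide)
qed

text \<open>Distinct pairs collide pairwise independently, so only equal pairs contribute to the variance.\<close>

lemma off_diagonal_variance:
  fixes a :: "nat \<times> nat \<Rightarrow> real"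
  defines "D \<equiv> {(x, y). x \<in> A \<and> y \<in> A \<and> x \<noteq> y}"
  shows "mean (hash_pmf A N) (\<lambda>h. (\<Sum>(x, y)\<in>D. a (x, y) * (collide h x y - 1 / N))\<^sup>2) \<le> 2 / N * (\<Sum>e\<in>D. (a e)\<^sup>2)"
proof -
  let ?M = "hash_pmf A N"
  define J where "J h e = (case e of (x, y) \<Rightarrow> collide h x y - 1 / N)" for h e
  have "D \<subseteq> A \<times> A" by (auto simp: D_def)
  then have finD: "finite D" by (rule finite_subset) (use A in simp)
  have sq: "collide h x y * collide h x y = collide h x y" for h x y by (simp add: collide_def)
  have expand: "mean ?M (\<lambda>h. J h (x, y) * J h (z, w)) = mean ?M (\<lambda>h. collide h x y * collide h z w) - 1 / (real N)\<^sup>2"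
    if "x \<in> A" "y \<in> A" "x \<noteq> y" "z \<in> A" "w \<in> A" "z \<noteq> w" for x y z w
  proof -
    have "mean ?M (\<lambda>h. J h (x, y) * J h (z, w)) = mean ?M (\<lambda>h. (collide h x y * collide h z w
        - (1 / N) * collide h x y) - (1 / N) * collide h z w + 1 / (real N)\<^sup>2)"
      by (simp add: J_def algebra_simps power2_eq_square)
    then show ?thesis using that
      by (simp only: mean_add_const mean_diff mean_cmult finite_hash_pmf mean_collide)
         (simp add: power2_eq_square)
  qed
  have JJ: "mean ?M (\<lambda>h. J h e * J h f) = (if f = e \<or> f = prod.swap e then 1 / N - 1 / (real N)\<^sup>2 else 0)"
    if "e \<in> D" "f \<in> D" for e f
  proof -
    obtain x y z w where ef: "e = (x, y)" "f = (z, w)" by (metis surj_pair)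
    have in_A: "x \<in> A" "y \<in> A" "x \<noteq> y" "z \<in> A" "w \<in> A" "z \<noteq> w" using that ef by (auto simp: D_def)
    show ?thesis
    proof (cases "f = e \<or> f = prod.swap e")
      case True
      then show ?thesis using in_A ef expand[OF in_A]
        by (auto simp: sq mean_collide collide_commute[of _ y x])
    next
      case False
      then have "{x, y} \<noteq> {z, w}" using ef by (auto simp: doubleton_eq_iff)
      with False ef expand[OF in_A] mean_collide_collide[OF in_A] show ?thesis by auto
    qed
  qed
  have swap: "prod.swap e \<in> D" "prod.swap e \<noteq> e" if "e \<in> D" for e
    using that by (auto simp: D_def)
  \<comment> \<open>The pairs (x, y) and (y, x) share their collision indicator; this coincidence is
    the source of the factor 2.\<close>
  have swap_sum: "(\<Sum>e\<in>D. f (prod.swap e)) = (\<Sum>e\<in>D. f e)" for f :: "nat \<times> nat \<Rightarrow> real"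
    by (rule sum.reindex_bij_witness[of _ prod.swap prod.swap]) (auto simp: D_def)
  let ?c = "1 / N - 1 / (real N)\<^sup>2"
  have c: "0 \<le> ?c" "?c \<le> 1 / N"
    using N by (auto simp: power2_eq_square field_simps)
  have "mean ?M (\<lambda>h. (\<Sum>(x, y)\<in>D. a (x, y) * (collide h x y - 1 / N))\<^sup>2)
      = mean ?M (\<lambda>h. \<Sum>e\<in>D. \<Sum>f\<in>D. (a e * a f) * (J h e * J h f))"
    by (simp add: power2_eq_square sum_product J_def case_prod_beta algebra_simps)
  also have "\<dots> = (\<Sum>e\<in>D. \<Sum>f\<in>D. (a e * a f) * mean ?M (\<lambda>h. J h e * J h f))"
    by (simp only: mean_sum finite_hash_pmf mean_cmult)
  also have "\<dots> = (\<Sum>e\<in>D. \<Sum>f\<in>D. (if f = e then ?c * (a e)\<^sup>2 else 0)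
      + (if f = prod.swap e then ?c * (a e * a (prod.swap e)) else 0))"
    using swap by (intro sum.cong refl) (auto simp: JJ power2_eq_square)
  also have "\<dots> = (\<Sum>e\<in>D. ?c * (a e)\<^sup>2 + ?c * (a e * a (prod.swap e)))"
    using finD swap by (intro sum.cong refl) (simp add: sum.distrib sum.delta)
  also have "\<dots> \<le> (\<Sum>e\<in>D. ?c * (a e)\<^sup>2 + ?c * (((a e)\<^sup>2 + (a (prod.swap e))\<^sup>2) / 2))"
  proof (intro sum_mono add_left_mono mult_left_mono c)
    fix e show "a e * a (prod.swap e) \<le> ((a e)\<^sup>2 + (a (prod.swap e))\<^sup>2) / 2"
      using sum_squares_bound[of "a e" "a (prod.swap e)"] by simp
  qed
  also have "\<dots> = ?c * (\<Sum>e\<in>D. (a e)\<^sup>2) + ?c * (((\<Sum>e\<in>D. (a e)\<^sup>2) + (\<Sum>e\<in>D. (a (prod.swap e))\<^sup>2)) / 2)"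
    by (simp only: sum.distrib sum_distrib_left[symmetric] sum_divide_distrib[symmetric])
  also have "\<dots> = 2 * ?c * (\<Sum>e\<in>D. (a e)\<^sup>2)"
    using swap_sum[of "\<lambda>e. (a e)\<^sup>2"] by simp
  also have "\<dots> \<le> 2 * (1 / N) * (\<Sum>e\<in>D. (a e)\<^sup>2)"
    using c by (intro mult_right_mono mult_left_mono sum_nonneg) auto
  finally show ?thesis by simp
qed

text \<open>Since \<open>d\<close> sums to zero, the off-diagonal products sum to minus the diagonal
  \<Phi>. The mean is thus \<Phi> * (1 - 1 / N), and no term with the sum of \<open>g\<close>
  arises.\<close>

lemma mean_inner_product_deviation:
  assumes d: "(\<Sum>x\<in>A. d x) = 0"
  shows "mean (hash_pmf A N) (\<lambda>h. ((\<Sum>b<N. fibre_sum A d h b * fibre_sum A g h b) - (\<Sum>x\<in>A. d x * g x))\<^sup>2)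
    \<le> 4 / N * ((\<Sum>x\<in>A. (d x)\<^sup>2) * (\<Sum>x\<in>A. (g x)\<^sup>2)) + 2 * (\<Sum>x\<in>A. d x * g x)\<^sup>2 / (real N)\<^sup>2"
proof -
  let ?M = "hash_pmf A N"
  define D where "D = {(x, y). x \<in> A \<and> y \<in> A \<and> x \<noteq> y}"
  define \<Phi> where "\<Phi> = (\<Sum>x\<in>A. d x * g x)"
  define X where "X h = (\<Sum>(x, y)\<in>D. d x * g y * (collide h x y - 1 / N))" for h
  have DA: "A \<times> A = D \<union> (\<lambda>x. (x, x)) ` A" and disj: "D \<inter> (\<lambda>x. (x, x)) ` A = {}"
    by (auto simp: D_def)
  have "D \<subseteq> A \<times> A" by (auto simp: D_def)
  then have finD: "finite D" by (rule finite_subset) (use A in simp)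
  have split: "(\<Sum>x\<in>A. \<Sum>y\<in>A. f x y) = (\<Sum>(x, y)\<in>D. f x y) + (\<Sum>x\<in>A. f x x)" for f :: "nat \<Rightarrow> nat \<Rightarrow> real"
  proof -
    have "(\<Sum>x\<in>A. \<Sum>y\<in>A. f x y) = (\<Sum>(x, y)\<in>A \<times> A. f x y)" by (rule sum.cartesian_product)
    also have "\<dots> = (\<Sum>(x, y)\<in>D. f x y) + (\<Sum>(x, y)\<in>(\<lambda>x. (x, x)) ` A. f x y)"
      unfolding DA using finD A disj by (intro sum.union_disjoint) auto
    also have "(\<Sum>(x, y)\<in>(\<lambda>x. (x, x)) ` A. f x y) = (\<Sum>x\<in>A. f x x)"
      by (subst sum.reindex) (auto simp: inj_on_def)
    finally show ?thesis .
  qed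
  have "0 = (\<Sum>x\<in>A. d x) * (\<Sum>y\<in>A. g y)" using d by simp
  also have "\<dots> = (\<Sum>(x, y)\<in>D. d x * g y) + \<Phi>" unfolding sum_product split \<Phi>_def ..
  finally have off: "(\<Sum>(x, y)\<in>D. d x * g y) = - \<Phi>" by simp
  have eq: "(\<Sum>b<N. fibre_sum A d h b * fibre_sum A g h b) - \<Phi> = X h - \<Phi> / N"
    if "h \<in> set_pmf ?M" for h
  proof -
    have "(\<Sum>b<N. fibre_sum A d h b * fibre_sum A g h b) = (\<Sum>x\<in>A. \<Sum>y\<in>A. d x * g y * collide h x y)"
      using that by (simp add: fibre_sum_mult fibre_sum_collide sum_distrib_left mult.assoc)
    also have "\<dots> = (\<Sum>(x, y)\<in>D. d x * g y * collide h x y) + \<Phi>" unfolding split \<Phi>_def by simp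
    also have "(\<Sum>(x, y)\<in>D. d x * g y * collide h x y) = X h + (\<Sum>(x, y)\<in>D. d x * g y) / N"
      unfolding X_def by (simp add: sum_divide_distrib case_prod_beta right_diff_distrib sum_subtractf)
    finally show ?thesis using off by simp
  qed
  have "mean ?M (\<lambda>h. ((\<Sum>b<N. fibre_sum A d h b * fibre_sum A g h b) - \<Phi>)\<^sup>2)
      = mean ?M (\<lambda>h. (X h - \<Phi> / N)\<^sup>2)" by (intro mean_cong) (simp add: eq)
  also have "\<dots> \<le> mean ?M (\<lambda>h. 2 * (X h)\<^sup>2 + 2 * (\<Phi> / N)\<^sup>2)"
  proof (intro mean_mono finite_hash_pmf)
    fix h show "(X h - \<Phi> / N)\<^sup>2 \<le> 2 * (X h)\<^sup>2 + 2 * (\<Phi> / N)\<^sup>2"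
      using sum_squares_bound[of "X h" "- \<Phi> / N"] by (simp add: power2_diff)
  qed
  also have "\<dots> = 2 * mean ?M (\<lambda>h. (X h)\<^sup>2) + 2 * (\<Phi> / N)\<^sup>2" by (simp only: mean_add_const mean_cmult finite_hash_pmf)
  also have "mean ?M (\<lambda>h. (X h)\<^sup>2) \<le> 2 / N * (\<Sum>(x, y)\<in>D. (d x * g y)\<^sup>2)"
    using off_diagonal_variance[of "\<lambda>(x, y). d x * g y"] unfolding X_def D_def[symmetric]
    by (simp add: case_prod_beta)
  also have "(\<Sum>(x, y)\<in>D. (d x * g y)\<^sup>2) \<le> (\<Sum>(x, y)\<in>A \<times> A. (d x * g y)\<^sup>2)"
    using A \<open>D \<subseteq> A \<times> A\<close> by (intro sum_mono2) auto
  also have "\<dots> = (\<Sum>x\<in>A. (d x)\<^sup>2) * (\<Sum>x\<in>A. (g x)\<^sup>2)"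
    by (simp add: sum_product sum.cartesian_product power_mult_distrib)
  finally show ?thesis unfolding \<Phi>_def[symmetric]
    by (simp add: power_divide divide_right_mono)
qed

end

section \<open>Signal preserved by hashing\<close>

text \<open>The situation before hashing: \<open>d\<close> stands for p - q and \<open>u\<close> for
  p + q.\<close>

locale discrepancy =
  fixes A :: "nat set" and N :: nat and L :: real and d u :: "nat \<Rightarrow> real"
  assumes A: "finite A" and L: "1 \<le> L" and N: "real N = 1024 * L"
    and d_le_u: "\<And>x. \<bar>d x\<bar> \<le> u x" and sum_u: "(\<Sum>x\<in>A. u x) \<le> 2" and sum_d: "(\<Sum>x\<in>A. d x) = 0"
begin

definition g :: "nat \<Rightarrow> real" where "g x = d x / (1 + L * u x)"

text \<open>The weighted signal that exact weights would give in the absence of collisions, see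
  \<open>energy_eq\<close>.\<close>

definition energy :: real where "energy = (\<Sum>x\<in>A. d x * g x)"

lemma u_nonneg: "0 \<le> u x" using d_le_u[of x] by simp

lemma denom: "1 \<le> 1 + L * u x" using u_nonneg[of x] L by simp

lemma energy_eq: "energy = (\<Sum>x\<in>A. (d x)\<^sup>2 / (1 + L * u x))"
  by (simp add: energy_def g_def power2_eq_square)

lemma energy_nonneg: "0 \<le> energy"
  unfolding energy_eq using denom by (intro sum_nonneg divide_nonneg_nonneg) (auto intro: order_trans[OF _ denom])

lemma u_le_2: "x \<in> A \<Longrightarrow> u x \<le> 2"
  using member_le_sum[of x A u] u_nonneg A sum_u by fastforce

lemma sum_g_square_le: "(\<Sum>x\<in>A. (g x)\<^sup>2) \<le> energy"
  unfolding energy_def power2_eq_square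
proof (intro sum_mono)
  fix x assume "x \<in> A"
  have "\<bar>g x\<bar> * \<bar>g x\<bar> \<le> \<bar>d x\<bar> * \<bar>g x\<bar>"
    using denom[of x] by (intro mult_right_mono) (auto simp: g_def divide_le_eq mult_left_le intro: order_trans[OF _ mult_left_mono[of 1]])
  also have "\<dots> = d x * g x" using denom[of x] by (simp add: g_def flip: abs_mult)
  finally show "g x * g x \<le> d x * g x" by simp
qed

lemma sum_d_square_le: "(\<Sum>x\<in>A. (d x)\<^sup>2) \<le> 3 * L * energy"
  unfolding energy_eq sum_distrib_left
proof (intro sum_mono)
  fix x assume "x \<in> A"
  then have "L * u x \<le> L * 2" using u_le_2 L by (intro mult_left_mono) auto
  then have "1 + L * u x \<le> 3 * L" using L by linarith
  then have "(d x)\<^sup>2 * (1 + L * u x) \<le> (d x)\<^sup>2 * (3 * L)" by (intro mult_left_mono) auto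
  then show "(d x)\<^sup>2 \<le> 3 * L * ((d x)\<^sup>2 / (1 + L * u x))"
    using denom[of x] by (simp add: pos_le_divide_eq mult_ac)
qed

lemma sum_L_u_g_square_le: "(\<Sum>x\<in>A. L * u x * (g x)\<^sup>2) \<le> energy"
  unfolding energy_eq
proof (intro sum_mono)
  fix x
  have "L * u x * (g x)\<^sup>2 = (d x)\<^sup>2 / (1 + L * u x) * (L * u x / (1 + L * u x))"
    by (simp add: g_def power2_eq_square)
  also have "\<dots> \<le> (d x)\<^sup>2 / (1 + L * u x) * 1"
    using denom[of x] by (intro mult_left_mono) auto
  finally show "L * u x * (g x)\<^sup>2 \<le> (d x)\<^sup>2 / (1 + L * u x)" by simp
qed

text \<open>Since \<open>d\<close> sums to zero, the sum of \<open>g\<close> is carried by the heavy elements only.\<close>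

lemma sum_g_le: "(\<Sum>x\<in>A. g x)\<^sup>2 \<le> 2 * L * energy"
proof -
  let ?r = "\<lambda>x. sqrt (1 + L * u x)"
  have r: "?r x > 0" "?r x * ?r x = 1 + L * u x" for x
    using denom[of x] by auto
  have "(\<Sum>x\<in>A. g x) = (\<Sum>x\<in>A. g x) - (\<Sum>x\<in>A. d x)" using sum_d by simp
  \<comment> \<open>g - d = - d * L u / (1 + L u), split evenly so that Cauchy-Schwarz yields the
    energy and L times the sum of \<open>u\<close>.\<close>
  also have "\<dots> = - (\<Sum>x\<in>A. (d x / ?r x) * (L * u x / ?r x))"
  proof -
    have "g x - d x = - ((d x / ?r x) * (L * u x / ?r x))" for x
      using r[of x] denom[of x] by (simp add: g_def field_simps)
    then show ?thesis by (simp add: sum_subtractf[symmetric] sum_negf[symmetric])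
  qed
  finally have "(\<Sum>x\<in>A. g x)\<^sup>2 = (\<Sum>x\<in>A. (d x / ?r x) * (L * u x / ?r x))\<^sup>2" by simp
  also have "\<dots> \<le> (\<Sum>x\<in>A. (d x / ?r x)\<^sup>2) * (\<Sum>x\<in>A. (L * u x / ?r x)\<^sup>2)"
    by (rule Cauchy_Schwarz_ineq_sum)
  also have "(\<Sum>x\<in>A. (d x / ?r x)\<^sup>2) = energy"
    unfolding energy_eq using denom by (simp add: power_divide abs_of_nonneg order_trans[OF zero_le_one])
  also have "(\<Sum>x\<in>A. (L * u x / ?r x)\<^sup>2) \<le> (\<Sum>x\<in>A. L * u x)"
  proof (intro sum_mono)
    fix x
    have "(L * u x / ?r x)\<^sup>2 = L * u x * (L * u x / (1 + L * u x))"
      using denom[of x] by (simp add: power_divide power2_eq_square)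
    also have "\<dots> \<le> L * u x * 1" using denom[of x] by (intro mult_left_mono) auto
    finally show "(L * u x / ?r x)\<^sup>2 \<le> L * u x" by simp
  qed
  also have "\<dots> \<le> L * 2" using sum_u L by (simp flip: sum_distrib_left)
  finally show ?thesis using energy_nonneg by (simp add: mult_right_mono mult_ac)
qed

text \<open>Cauchy-Schwarz against 1 + L * u, whose total is at most k + 2 * L <= 3 * k. This turns
  the total variation distance into energy.\<close>

lemma energy_lower:
  assumes k: "card A \<le> k" "L \<le> k"
  shows "(\<Sum>x\<in>A. \<bar>d x\<bar>)\<^sup>2 \<le> 3 * real k * energy"
proof -
  let ?r = "\<lambda>x. sqrt (1 + L * u x)"
  have r: "?r x > 0" for x using denom[of x] by auto
  have "(\<Sum>x\<in>A. \<bar>d x\<bar>)\<^sup>2 = (\<Sum>x\<in>A. (\<bar>d x\<bar> / ?r x) * ?r x)\<^sup>2"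
  proof -
    have "\<bar>d x\<bar> / ?r x * ?r x = \<bar>d x\<bar>" for x using less_imp_neq[OF r, of x] by simp
    then show ?thesis by simp
  qed
  also have "\<dots> \<le> (\<Sum>x\<in>A. (\<bar>d x\<bar> / ?r x)\<^sup>2) * (\<Sum>x\<in>A. (?r x)\<^sup>2)"
    by (rule Cauchy_Schwarz_ineq_sum)
  also have "(\<Sum>x\<in>A. (\<bar>d x\<bar> / ?r x)\<^sup>2) = energy"
    unfolding energy_eq using denom by (simp add: power_divide abs_of_nonneg order_trans[OF zero_le_one])
  also have "(\<Sum>x\<in>A. (?r x)\<^sup>2) = card A + L * (\<Sum>x\<in>A. u x)"
    using denom by (simp add: abs_of_nonneg order_trans[OF zero_le_one] sum.distrib sum_distrib_left)
  also have "\<dots> \<le> real k + real k * 2"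
    using k L sum_u sum_nonneg[of A u] u_nonneg by (intro add_mono mult_mono) auto
  finally show ?thesis using energy_nonneg by (simp add: mult_right_mono mult_ac)
qed

lemma N_pos: "N > 0" using N L by (cases N) auto

text \<open>The mass of a cell is the sum of u z over its elements z, which reduces the second term
  to \<open>mean_square_at\<close>. The constant is 1 + 2 + 2 + 2 * 5.\<close>

lemma mean_weighted_energy:
  "mean (hash_pmf A N) (\<lambda>h. \<Sum>b<N. (fibre_sum A g h b)\<^sup>2 * (1 + L * fibre_sum A u h b)) \<le> 15 * energy"
proof -
  note fin = finite_hash_pmf[OF A N_pos]
  have NL: "L / N \<le> 1" "1 / real N \<le> 1" using N L by auto
  let ?S = "(\<Sum>x\<in>A. g x)\<^sup>2" and ?Q = "\<Sum>x\<in>A. (g x)\<^sup>2"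
  have eq: "(\<Sum>b<N. (fibre_sum A g h b)\<^sup>2 * (1 + L * fibre_sum A u h b))
      = (\<Sum>b<N. (fibre_sum A g h b)\<^sup>2) + L * (\<Sum>z\<in>A. u z * (fibre_sum A g h (h z))\<^sup>2)"
    if "h \<in> set_pmf (hash_pmf A N)" for h
  proof -
    have "(\<Sum>b<N. (fibre_sum A g h b)\<^sup>2 * (1 + L * fibre_sum A u h b))
        = (\<Sum>b<N. (fibre_sum A g h b)\<^sup>2) + L * (\<Sum>b<N. fibre_sum A u h b * (fibre_sum A g h b)\<^sup>2)"
      by (simp add: algebra_simps sum.distrib sum_distrib_left)
    then show ?thesis by (simp add: fibre_sum_mult[OF A N_pos that])
  qed
  have "mean (hash_pmf A N) (\<lambda>h. \<Sum>b<N. (fibre_sum A g h b)\<^sup>2 * (1 + L * fibre_sum A u h b))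
      = mean (hash_pmf A N) (\<lambda>h. \<Sum>b<N. (fibre_sum A g h b)\<^sup>2)
        + L * (\<Sum>z\<in>A. u z * mean (hash_pmf A N) (\<lambda>h. (fibre_sum A g h (h z))\<^sup>2))"
    by (subst mean_cong[OF eq], assumption) (simp only: mean_add[OF fin] mean_cmult mean_sum[OF fin, of _ A])
  also have "\<dots> \<le> (?Q + ?S / N) + L * (\<Sum>z\<in>A. u z * (2 * (g z)\<^sup>2 + ?Q / N + 2 * ?S / (real N)\<^sup>2))"
    using L u_nonneg mean_square_at[OF A N_pos, of _ g]
    by (intro add_mono mean_fibre_sum_square[OF A N_pos] mult_left_mono sum_mono) auto
  also have "\<dots> = ?Q + ?S / N + 2 * (\<Sum>z\<in>A. L * u z * (g z)\<^sup>2)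
      + L * (?Q / N + 2 * ?S / (real N)\<^sup>2) * (\<Sum>z\<in>A. u z)"
  proof -
    have "(\<Sum>z\<in>A. u z * (2 * (g z)\<^sup>2 + c + e)) = 2 * (\<Sum>z\<in>A. u z * (g z)\<^sup>2) + (c + e) * (\<Sum>z\<in>A. u z)"
      for c e by (simp add: sum_distrib_left flip: sum.distrib) (simp add: algebra_simps)
    moreover have "(\<Sum>z\<in>A. L * u z * (g z)\<^sup>2) = L * (\<Sum>z\<in>A. u z * (g z)\<^sup>2)"
      by (simp add: sum_distrib_left mult.assoc)
    ultimately show ?thesis by (simp only:) (simp add: algebra_simps)
  qed
  also have "\<dots> \<le> energy + 2 * energy + 2 * energy + (energy + 4 * energy) * 2"
  proof (intro add_mono mult_left_mono mult_mono sum_g_square_le sum_L_u_g_square_le sum_u)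
    have S1: "?S / N \<le> 2 * energy * (L / N)"
      using sum_g_le N_pos by (simp add: divide_right_mono mult_ac)
    also have "\<dots> \<le> 2 * energy * 1" using NL energy_nonneg by (intro mult_left_mono) auto
    finally show S: "?S / N \<le> 2 * energy" by simp
    have "L * (?Q / N + 2 * ?S / (real N)\<^sup>2) = (L / N) * (?Q + 2 * (?S / N))"
      by (simp add: power2_eq_square[of "real N"] distrib_left add_divide_distrib)
    also have "\<dots> \<le> 1 * (energy + 2 * (2 * energy))"
      using NL S sum_g_square_le energy_nonneg L
      by (intro mult_mono add_mono mult_left_mono add_nonneg_nonneg sum_nonneg) auto
    finally show "L * (?Q / N + 2 * ?S / (real N)\<^sup>2) \<le> energy + 4 * energy" by simp
  qed (use energy_nonneg u_nonneg in \<open>auto intro: sum_nonneg\<close>)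
  finally show ?thesis by simp
qed

text \<open>The two penalties of \<open>far_error\<close> with \<Phi> = energy: Chebyshev
  contributes 4 * 14 / 1024 and Markov 15 / 180, together less than 1 / 6.\<close>

lemma mean_hash_error:
  assumes e: "energy > 0"
  shows "mean (hash_pmf A N) (\<lambda>h. 4 * ((\<Sum>b<N. fibre_sum A d h b * fibre_sum A g h b) - energy)\<^sup>2 / energy\<^sup>2
    + (\<Sum>b<N. (fibre_sum A g h b)\<^sup>2 * (1 + L * fibre_sum A u h b)) / (180 * energy)) \<le> 1 / 6"
    (is "mean ?M (\<lambda>h. 4 * (?G h)\<^sup>2 / _ + ?H h / _) \<le> _")
proof -
  note fin = finite_hash_pmf[OF A N_pos]
  have "mean ?M (\<lambda>h. (?G h)\<^sup>2) \<le> 4 / N * ((\<Sum>x\<in>A. (d x)\<^sup>2) * (\<Sum>x\<in>A. (g x)\<^sup>2)) + 2 * energy\<^sup>2 / (real N)\<^sup>2"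
    using mean_inner_product_deviation[OF A N_pos sum_d, of g] unfolding energy_def .
  also have "\<dots> \<le> 4 / N * ((3 * L * energy) * energy) + 2 * energy\<^sup>2 / real N"
  proof (intro add_mono mult_left_mono mult_mono divide_left_mono sum_d_square_le sum_g_square_le)
    show "real N \<le> (real N)\<^sup>2" using N L by (simp add: power2_eq_square)
  qed (use e L N_pos in \<open>auto intro: sum_nonneg\<close>)
  also have "\<dots> \<le> 4 / N * ((3 * L * energy) * energy) + 2 * energy\<^sup>2 * L / real N"
    using L e by (intro add_left_mono divide_right_mono) auto
  also have "\<dots> = (14 / 1024) * energy\<^sup>2"
    unfolding N using L by (simp add: field_simps power2_eq_square)
  finally have G: "mean ?M (\<lambda>h. (?G h)\<^sup>2) \<le> (14 / 1024) * energy\<^sup>2" .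
  have "mean ?M (\<lambda>h. 4 * (?G h)\<^sup>2 / energy\<^sup>2 + ?H h / (180 * energy))
      = mean ?M (\<lambda>h. (4 / energy\<^sup>2) * (?G h)\<^sup>2 + (1 / (180 * energy)) * ?H h)" by simp
  also have "\<dots> = (4 / energy\<^sup>2) * mean ?M (\<lambda>h. (?G h)\<^sup>2) + (1 / (180 * energy)) * mean ?M ?H"
    by (simp only: mean_add mean_cmult fin)
  also have "\<dots> \<le> (4 / energy\<^sup>2) * ((14 / 1024) * energy\<^sup>2) + (1 / (180 * energy)) * (15 * energy)"
    using e by (intro add_mono mult_left_mono G mean_weighted_energy) auto
  also have "\<dots> \<le> 1 / 6" using e by simp
  finally show ?thesis .
qed

end

section \<open>Coupling of binomial noise\<close>

lemma finite_set_shuffle [simp]: "finite (set_pmf (shuffle ms))"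
proof -
  have "{\<sigma>. \<sigma> permutes {..<length ms}} \<noteq> {}" using permutes_id by blast
  then show ?thesis by (simp add: shuffle_def set_pmf_of_set finite_permutations)
qed

text \<open>Composition with a fixed permutation is a bijection of the permutations, so the uniform
  choice absorbs it.\<close>

lemma shuffle_cong:
  assumes "mset ms = mset ms'"
  shows "shuffle ms = shuffle ms'"
proof -
  obtain p where p: "p permutes {..<length ms'}" "permute_list p ms' = ms"
    using assms by (rule mset_eq_permutation)
  have len: "length ms = length ms'" using assms by (rule mset_eq_length)
  let ?P = "{\<sigma>. \<sigma> permutes {..<length ms'}}"
  have P: "finite ?P" "?P \<noteq> {}" using permutes_id by (blast intro: finite_permutations)+
  have bij: "bij_betw (\<lambda>\<sigma>. p \<circ> \<sigma>) ?P ?P"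
    by (rule bij_betw_byWitness[of _ "\<lambda>\<sigma>. inv p \<circ> \<sigma>"])
       (use p in \<open>auto simp: fun_eq_iff permutes_inverses intro: permutes_compose permutes_inv\<close>)
  have "shuffle ms = map_pmf (\<lambda>\<sigma>. permute_list (p \<circ> \<sigma>) ms') (pmf_of_set ?P)"
    unfolding shuffle_def len using P
    by (intro map_pmf_cong refl) (auto simp: p(2)[symmetric] permute_list_compose)
  also have "\<dots> = map_pmf (\<lambda>\<sigma>. permute_list \<sigma> ms') (map_pmf (\<lambda>\<sigma>. p \<circ> \<sigma>) (pmf_of_set ?P))"
    by (simp add: pmf.map_comp o_def)
  also have "map_pmf (\<lambda>\<sigma>. p \<circ> \<sigma>) (pmf_of_set ?P) = pmf_of_set ?P"
    using P bij by (intro map_pmf_of_set_bij_betw) auto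
  finally show ?thesis by (simp add: shuffle_def)
qed

lemma bind_shuffle_mset: "bind_pmf (shuffle ms) (\<lambda>s. F (mset s)) = F (mset ms)"
proof -
  have P: "finite {\<sigma>. \<sigma> permutes {..<length ms}}" "{\<sigma>. \<sigma> permutes {..<length ms}} \<noteq> {}"
    using permutes_id by (blast intro: finite_permutations)+
  have "bind_pmf (shuffle ms) (\<lambda>s. F (mset s)) = bind_pmf (shuffle ms) (\<lambda>_. F (mset ms))"
    using P by (intro bind_pmf_cong refl) (auto simp: shuffle_def)
  then show ?thesis by simp
qed

lemma pmf_replicate_pmf:
  "length xs = n \<Longrightarrow> pmf (replicate_pmf n p) xs = (\<Prod>i<n. pmf p (xs ! i))"
proof (induction n arbitrary: xs)
  case 0
  then show ?case by simp
next
  case (Suc n)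
  then obtain y ys where xs: "xs = y # ys" "length ys = n" by (auto simp: length_Suc_conv)
  have "replicate_pmf (Suc n) p = map_pmf (\<lambda>(x, xs). x # xs) (pair_pmf p (replicate_pmf n p))"
    by (simp add: map_pmf_def pair_pmf_def bind_assoc_pmf bind_return_pmf)
  moreover have "xs = (\<lambda>(x, xs). x # xs) (y, ys)" using xs by simp
  ultimately have "pmf (replicate_pmf (Suc n) p) xs = pmf (pair_pmf p (replicate_pmf n p)) (y, ys)"
    by (simp only:) (rule pmf_map_inj', auto simp: inj_def)
  then show ?case using Suc.IH[OF xs(2)] xs(1)
    by (simp add: pmf_pair prod.lessThan_Suc_shift del: prod.lessThan_Suc replicate_pmf.simps)
qed

lemma map_nth_replicate_pmf: "i < n \<Longrightarrow> map_pmf (\<lambda>xs. xs ! i) (replicate_pmf n p) = p"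
proof (induction n arbitrary: i)
  case (Suc n)
  have "map_pmf (\<lambda>xs. xs ! i) (replicate_pmf (Suc n) p)
      = (do {x \<leftarrow> p; xs \<leftarrow> replicate_pmf n p; return_pmf ((x # xs) ! i)})"
    by (simp add: map_bind_pmf)
  also have "\<dots> = p"
    using Suc by (cases i) (simp_all add: bind_return_pmf' flip: map_pmf_def)
  finally show ?case .
qed simp

text \<open>
  Privacy by coupling the noise of two runs: \<open>\<phi>\<close> maps the noise of one run to noise of the other run
  that hides the difference between the datasets.
\<close>

lemma coupling_bound:
  fixes f g :: "'a \<Rightarrow> 'b pmf"
  assumes fin: "finite (set_pmf A)" and fg: "\<And>m. finite (set_pmf (f m))" "\<And>m. finite (set_pmf (g m))"
    and inj: "inj_on \<phi> (set_pmf A \<inter> G)"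
    and le: "\<And>m. m \<in> set_pmf A \<Longrightarrow> m \<in> G \<Longrightarrow> pmf A m \<le> exp \<epsilon> * pmf A (\<phi> m)"
    and eq: "\<And>m. m \<in> set_pmf A \<Longrightarrow> m \<in> G \<Longrightarrow> f m = g (\<phi> m)"
    and bad: "measure_pmf.prob A (- G) \<le> \<delta>"
  shows "measure_pmf.prob (bind_pmf A f) S \<le> exp \<epsilon> * measure_pmf.prob (bind_pmf A g) S + \<delta>"
proof -
  let ?p = "\<lambda>h m. measure_pmf.prob (h m) S"
  have sum: "measure_pmf.prob (bind_pmf A h) S = (\<Sum>m\<in>set_pmf A. pmf A m * ?p h m)"
    if "\<And>m. finite (set_pmf (h m))" for h :: "'a \<Rightarrow> 'b pmf"
    using fin that by (subst prob_bind) (auto simp: integral_measure_pmf_real[of "set_pmf A"] mult_ac)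
  \<comment> \<open>The probability comparison already forces the image into the support, so the
    reindexed sum is part of the full sum.\<close>
  have \<phi>: "\<phi> m \<in> set_pmf A" if "m \<in> set_pmf A" "m \<in> G" for m
  proof -
    have "0 < exp \<epsilon> * pmf A (\<phi> m)" using le[OF that] pmf_positive[OF that(1)] by linarith
    then show ?thesis by (simp add: zero_less_mult_iff pmf_positive_iff)
  qed
  have "measure_pmf.prob (bind_pmf A f) S
      = (\<Sum>m\<in>set_pmf A \<inter> G. pmf A m * ?p f m) + (\<Sum>m\<in>set_pmf A - G. pmf A m * ?p f m)"
    unfolding sum[OF fg(1)] using fin by (subst sum.union_disjoint[symmetric]) (auto intro!: sum.cong)
  also have "(\<Sum>m\<in>set_pmf A - G. pmf A m * ?p f m) \<le> (\<Sum>m\<in>set_pmf A - G. pmf A m)"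
    by (intro sum_mono) (simp add: mult_left_le)
  also have "\<dots> = measure_pmf.prob A (set_pmf A - G)"
    using fin by (simp add: measure_measure_pmf_finite)
  also have "\<dots> \<le> measure_pmf.prob A (- G)" by (intro measure_pmf.finite_measure_mono) auto
  also have "\<dots> \<le> \<delta>" by (rule bad)
  also have "(\<Sum>m\<in>set_pmf A \<inter> G. pmf A m * ?p f m)
      \<le> (\<Sum>m\<in>set_pmf A \<inter> G. exp \<epsilon> * (pmf A (\<phi> m) * ?p g (\<phi> m)))"
  proof (intro sum_mono)
    fix m assume "m \<in> set_pmf A \<inter> G"
    then have "pmf A m * ?p g (\<phi> m) \<le> exp \<epsilon> * pmf A (\<phi> m) * ?p g (\<phi> m)"
      using le by (intro mult_right_mono) auto
    then show "pmf A m * ?p f m \<le> exp \<epsilon> * (pmf A (\<phi> m) * ?p g (\<phi> m))"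
      using eq \<open>m \<in> set_pmf A \<inter> G\<close> by (simp add: mult.assoc)
  qed
  also have "\<dots> = exp \<epsilon> * (\<Sum>m\<in>\<phi> ` (set_pmf A \<inter> G). pmf A m * ?p g m)"
    by (simp add: sum.reindex[OF inj] sum_distrib_left)
  also have "\<dots> \<le> exp \<epsilon> * (\<Sum>m\<in>set_pmf A. pmf A m * ?p g m)"
    using \<phi> fin by (intro mult_left_mono sum_mono2) auto
  finally show ?thesis unfolding sum[OF fg(2)] by simp
qed

section \<open>The central window of the symmetric binomial distribution\<close>

context
  fixes t :: nat and \<epsilon> :: real
  assumes \<epsilon>: "0 < \<epsilon>" "\<epsilon> \<le> 1" and t: "16 \<le> \<epsilon> * t"
begin

text \<open>In this window a shift of the noise by one costs a factor of at most exp (\<epsilon> /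
  2); two cells get shifted, which uses up \<epsilon>.\<close>

definition central :: "nat \<Rightarrow> bool" where
  "central m \<longleftrightarrow> \<bar>real m - t / 2\<bar> < \<epsilon> * t / 16"

lemma t_pos: "t > 0" using t by (cases t) auto

text \<open>The worst ratio at the edge of the window, with 1 for the off-by-one in (m + 1) / (t -
  m). By 1 + x <= exp x it reduces to \<epsilon> * t / 8 - \<epsilon>^2 * t / 32 >= 1, for which
  \<epsilon> * t >= 16 suffices.\<close>

lemma balance: "(t / 2 + \<epsilon> * t / 16 + 1) \<le> exp (\<epsilon> / 2) * (t / 2 - \<epsilon> * t / 16)"
proof -
  have "(1 + \<epsilon> / 2) * (t / 2 - \<epsilon> * t / 16) \<le> exp (\<epsilon> / 2) * (t / 2 - \<epsilon> * t / 16)"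
  proof (intro mult_right_mono)
    show "1 + \<epsilon> / 2 \<le> exp (\<epsilon> / 2)" by simp
    have "\<epsilon> * t \<le> 1 * real t" using \<epsilon> by (intro mult_right_mono) auto
    then show "0 \<le> t / 2 - \<epsilon> * t / 16" by simp
  qed
  moreover have "t / 2 + \<epsilon> * t / 16 + 1 \<le> (1 + \<epsilon> / 2) * (t / 2 - \<epsilon> * t / 16)"
  proof -
    have "\<epsilon> * (\<epsilon> * t) \<le> 1 * (\<epsilon> * t)" using \<epsilon> by (intro mult_right_mono) auto
    then show ?thesis using t by (simp add: field_simps)
  qed
  ultimately show ?thesis by linarith
qed

lemma central_bounds:
  assumes "central m"
  shows "0 < m" "m < t" "real m + 1 \<le> exp (\<epsilon> / 2) * (real t - m)" "real t - m + 1 \<le> exp (\<epsilon> / 2) * m"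
proof -
  have "\<epsilon> * t \<le> 1 * real t" using \<epsilon> by (intro mult_right_mono) auto
  moreover have "0 < real t" using t_pos by simp
  ultimately have "0 < real m" "real m < real t"
    using assms unfolding central_def by linarith+
  then show "0 < m" "m < t" by simp_all
  have "exp (\<epsilon> / 2) * (t / 2 - \<epsilon> * t / 16) \<le> exp (\<epsilon> / 2) * (real t - m)"
    using assms unfolding central_def by (intro mult_left_mono) (linarith, simp)
  then show "real m + 1 \<le> exp (\<epsilon> / 2) * (real t - m)"
    using balance assms unfolding central_def by linarith
  have "exp (\<epsilon> / 2) * (t / 2 - \<epsilon> * t / 16) \<le> exp (\<epsilon> / 2) * m"
    using assms unfolding central_def by (intro mult_left_mono) (linarith, simp)
  then show "real t - m + 1 \<le> exp (\<epsilon> / 2) * m"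
    using balance assms unfolding central_def by linarith
qed

text \<open>The binomial coefficient at m divided by its right and left neighbour is (m + 1) / (t -
  m) and (t - m + 1) / m.\<close>

lemma binomial_half_ratio:
  assumes "central m"
  shows "pmf (binomial_pmf t (1/2)) m \<le> exp (\<epsilon> / 2) * pmf (binomial_pmf t (1/2)) (m + 1)"
    and "pmf (binomial_pmf t (1/2)) m \<le> exp (\<epsilon> / 2) * pmf (binomial_pmf t (1/2)) (m - 1)"
proof -
  note b = central_bounds[OF assms]
  have half: "(1/2::real) ^ k * (1/2) ^ (t - k) = (1/2) ^ t" if "k \<le> t" for k
    using that by (simp flip: power_add)
  have pmf: "pmf (binomial_pmf t (1/2)) k = (t choose k) * (1/2) ^ t" if "k \<le> t" for k
    using half[OF that] by (simp add: mult.assoc)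
  have up: "real (t choose m) \<le> exp (\<epsilon> / 2) * real (t choose (m + 1))"
  proof -
    have "(t choose m) * (t - m) = Suc m * (t choose Suc m)"
      using b(2) by (metis binomial_absorb_comp binomial_absorption mult.commute Suc_diff_1 t_pos)
    then have "real (t choose m) * (real t - m) = (real m + 1) * real (t choose (m + 1))"
      using b(2) by (metis Suc_eq_plus1 less_imp_le_nat of_nat_Suc of_nat_diff of_nat_mult add.commute)
    also have "\<dots> \<le> exp (\<epsilon> / 2) * (real t - m) * real (t choose (m + 1))"
      using b(3) by (intro mult_right_mono) auto
    finally have "real (t choose m) * (real t - m) \<le> exp (\<epsilon> / 2) * real (t choose (m + 1)) * (real t - m)"
      by (simp add: mult_ac)
    then show ?thesis using b(2) by simp
  qed
  have down: "real (t choose m) \<le> exp (\<epsilon> / 2) * real (t choose (m - 1))"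
  proof -
    obtain j where j: "m = Suc j" using b(1) by (cases m) auto
    have "(t choose j) * (t - j) = Suc j * (t choose Suc j)"
      using b(2) by (metis binomial_absorb_comp binomial_absorption mult.commute Suc_diff_1 t_pos)
    then have "real (t choose j) * (real t - j) = real m * real (t choose m)"
      using b(2) j by (metis Suc_lessD less_imp_le_nat of_nat_diff of_nat_mult)
    moreover have "real t - j = real t - m + 1" using j by simp
    ultimately have "real m * real (t choose m) \<le> (exp (\<epsilon> / 2) * m) * real (t choose j)"
      using b(4) by (metis mult.commute mult_left_mono of_nat_0_le_iff)
    then show ?thesis using b(1) j by (simp add: mult_ac)
  qed
  show "pmf (binomial_pmf t (1/2)) m \<le> exp (\<epsilon> / 2) * pmf (binomial_pmf t (1/2)) (m + 1)"
    using up b(2) by (simp add: pmf mult.assoc[symmetric] del: pmf_binomial)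
  show "pmf (binomial_pmf t (1/2)) m \<le> exp (\<epsilon> / 2) * pmf (binomial_pmf t (1/2)) (m - 1)"
    using down b(2) by (simp add: pmf mult.assoc[symmetric] del: pmf_binomial)
qed

text \<open>Hoeffding at distance \<epsilon> * t / 16 from the mean.\<close>

lemma prob_not_central:
  "measure_pmf.prob (binomial_pmf t (1/2)) {m. \<not> central m} \<le> 2 * exp (- (\<epsilon>\<^sup>2 * t / 128))"
proof -
  interpret binomial_distribution t "1/2" by standard simp
  have "measure_pmf.prob (binomial_pmf t (1/2)) {m. \<not> central m}
      = measure_pmf.prob (binomial_pmf t (1/2)) {x. \<epsilon> * t / 16 \<le> \<bar>real x - t * (1/2)\<bar>}"
    by (intro arg_cong[where f = "measure_pmf.prob _"]) (auto simp: central_def)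
  also have "\<dots> \<le> 2 * exp (- 2 * (\<epsilon> * t / 16)\<^sup>2 / t)"
    by (rule prob_abs_ge) (use t_pos \<epsilon> in auto)
  also have "- 2 * (\<epsilon> * t / 16)\<^sup>2 / t = - (\<epsilon>\<^sup>2 * t / 128)"
    using t_pos by (simp add: power2_eq_square field_simps)
  finally show ?thesis .
qed

end

section \<open>Private noisy histograms\<close>

text \<open>Noise travels as messages, so it is nonnegative and written in unary; the analyzer
  subtracts its mean.\<close>

definition noise_msgs :: "nat list \<Rightarrow> nat list" where
  "noise_msgs m = concat (map (\<lambda>c. replicate (m ! c) c) [0..<length m])"

text \<open>The shuffler erases the sender, so the message itself carries the block i div n of user
  i next to the hash value.\<close>

definition cell :: "nat \<Rightarrow> nat \<Rightarrow> nat \<Rightarrow> nat \<Rightarrow> nat" where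
  "cell n N i b = (i div n) * N + b"

text \<open>The three blocks have separate noise, which keeps them independent.\<close>

definition noise_pmf :: "nat \<Rightarrow> nat \<Rightarrow> nat list pmf" where
  "noise_pmf N t = replicate_pmf (3 * N) (binomial_pmf t (1/2))"

text \<open>Privacy concerns the shuffled output of the whole group, so a single user can supply the
  noise for everybody.\<close>

definition noisy_rand :: "nat \<Rightarrow> nat \<Rightarrow> nat \<Rightarrow> (bool list \<Rightarrow> nat \<Rightarrow> nat) \<Rightarrow> nat randomizer" where
  "noisy_rand n N t hash i u x = (if i = 0
     then map_pmf (\<lambda>m. cell n N i (hash u x) # noise_msgs m) (noise_pmf N t)
     else return_pmf [cell n N i (hash u x)])"

definition transcript :: "nat \<Rightarrow> nat \<Rightarrow> (nat \<Rightarrow> nat) \<Rightarrow> nat list \<Rightarrow> nat list \<Rightarrow> nat list" where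
  "transcript n N h xs m = map (\<lambda>i. cell n N i (h (xs ! i))) [0..<length xs] @ noise_msgs m"

lemma finite_noise_pmf [simp]: "finite (set_pmf (noise_pmf N t))"
  by (simp add: noise_pmf_def)

lemma length_noise: "m \<in> set_pmf (noise_pmf N t) \<Longrightarrow> length m = 3 * N"
  by (simp add: noise_pmf_def set_replicate_pmf)

lemma count_noise_msgs: "count (mset (noise_msgs m)) c = (if c < length m then m ! c else 0)"
proof -
  have "count (mset (concat (map (\<lambda>c. replicate (m ! c) c) cs))) c
      = (\<Sum>c'\<leftarrow>cs. if c' = c then m ! c' else 0)" for cs
    by (induction cs) auto
  then have "count (mset (noise_msgs m)) c = (\<Sum>c'\<in>{0..<length m}. if c' = c then m ! c' else 0)"
    unfolding noise_msgs_def by (simp add: interv_sum_list_conv_sum_set_nat)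
  then show ?thesis by (simp add: sum.delta)
qed

lemma shuffler_output_noisy:
  assumes "xs \<noteq> []"
  shows "shuffler_output (noisy_rand n N t hash) u xs
    = bind_pmf (noise_pmf N t) (\<lambda>m. shuffle (transcript n N (hash u) xs m))"
proof -
  let ?R = "\<lambda>i. noisy_rand n N t hash i u (xs ! i)"
  let ?c = "\<lambda>i. cell n N i (hash u (xs ! i))"
  define f where "f = (\<lambda>i. if i \<in> {1..<length xs} then [?c i] else [])"
  obtain l where l: "length xs = Suc l" using assms by (cases xs) auto
  have ins: "{..<length xs} = insert 0 {1..<length xs}" using l by auto
  have "Pi_pmf {1..<length xs} [] ?R = Pi_pmf {1..<length xs} [] (\<lambda>i. return_pmf [?c i])"
    by (intro Pi_pmf_cong) (auto simp: noisy_rand_def)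
  also have "\<dots> = return_pmf f"
    unfolding f_def by (rule Pi_pmf_return_pmf) simp
  finally have rest: "Pi_pmf {1..<length xs} [] ?R = return_pmf f" .
  have "Pi_pmf {..<length xs} [] ?R
      = (do {y \<leftarrow> ?R 0; f \<leftarrow> Pi_pmf {1..<length xs} [] ?R; return_pmf (f(0 := y))})"
    unfolding ins by (rule Pi_pmf_insert') auto
  also have "\<dots> = map_pmf (\<lambda>m. f(0 := ?c 0 # noise_msgs m)) (noise_pmf N t)"
    unfolding rest by (simp add: noisy_rand_def map_pmf_def bind_assoc_pmf bind_return_pmf)
  finally have "shuffler_output (noisy_rand n N t hash) u xs = bind_pmf (noise_pmf N t)
      (\<lambda>m. shuffle (concat (map (f(0 := ?c 0 # noise_msgs m)) [0..<length xs])))"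
    unfolding shuffler_output_def by (simp add: map_pmf_def bind_assoc_pmf bind_return_pmf)
  \<comment> \<open>The noise follows the first message instead of standing at the end; the shuffler
    erases this difference.\<close>
  also have "\<dots> = bind_pmf (noise_pmf N t) (\<lambda>m. shuffle (transcript n N (hash u) xs m))"
  proof (intro bind_pmf_cong refl shuffle_cong)
    fix m
    have *: "[0..<length xs] = 0 # [1..<length xs]" using l by (simp add: upt_conv_Cons)
    have "map (f(0 := ?c 0 # noise_msgs m)) [1..<length xs] = map (\<lambda>i. [?c i]) [1..<length xs]"
      by (auto simp: f_def)
    moreover have "concat (map (\<lambda>i. [?c i]) is) = map ?c is" for "is" by (induction "is") auto
    ultimately have ls: "concat (map (f(0 := ?c 0 # noise_msgs m)) [1..<length xs]) = map ?c [1..<length xs]"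
      by (simp only:)
    show "mset (concat (map (f(0 := ?c 0 # noise_msgs m)) [0..<length xs]))
        = mset (transcript n N (hash u) xs m)"
      unfolding transcript_def * list.map concat.simps ls by simp
  qed
  finally show ?thesis .
qed

text \<open>If the dataset change moves one message from \<open>c\<close> to \<open>c'\<close>, then this noise compensates for it.\<close>

definition move_noise :: "nat \<Rightarrow> nat \<Rightarrow> nat list \<Rightarrow> nat list" where
  "move_noise c c' m = m[c := m ! c + 1, c' := m ! c' - 1]"

lemma prod_two:
  fixes f :: "nat \<Rightarrow> real"
  assumes "c < K" "c' < K" "c \<noteq> c'"
  shows "(\<Prod>i<K. f i) = f c * f c' * (\<Prod>i\<in>{..<K} - {c, c'}. f i)"
proof -
  have "(\<Prod>i<K. f i) = f c * (f c' * (\<Prod>i\<in>{..<K} - {c} - {c'}. f i))"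
    using assms by (simp add: prod.remove[of "{..<K}" c] prod.remove[of "{..<K} - {c}" c'])
  moreover have "{..<K} - {c} - {c'} = {..<K} - {c, c'}" by auto
  ultimately show ?thesis by simp
qed

text \<open>A changed entry moves one message between cells \<open>c\<close> and \<open>c'\<close>
  of the same block, which \<open>move_noise\<close> hides. Two cells with a two-sided tail each
  give the factor 4.\<close>

lemma noisy_counts_private:
  assumes \<epsilon>: "0 < \<epsilon>" "\<epsilon> \<le> 1" and t: "16 \<le> \<epsilon> * t" and \<delta>: "4 * exp (- (\<epsilon>\<^sup>2 * t / 128)) \<le> \<delta>"
    and hash: "\<And>x. x \<in> X \<Longrightarrow> hash u x < N" and n: "n > 0"
  shows "differentially_private \<epsilon> \<delta> X (3 * n) (shuffler_output (noisy_rand n N t hash) u)"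
  unfolding differentially_private_def
proof (intro allI impI)
  fix xs ys S
  assume *: "set xs \<subseteq> X \<and> set ys \<subseteq> X \<and> length xs = 3 * n \<and> length ys = 3 * n \<and> neighbouring xs ys"
  then obtain i y where i: "i < length xs" "ys = xs[i := y]" by (auto simp: neighbouring_def)
  have len: "length xs = 3 * n" "length ys = 3 * n" using * by auto
  define h where "h = hash u"
  define c where "c = cell n N i (h (xs ! i))"
  define c' where "c' = cell n N i (h y)"
  have "i div n < 3" using i len n by (simp add: less_mult_imp_div_less)
  then have "i div n \<le> 2" by simp
  then have cell_less: "cell n N i b < 3 * N" if "b < N" for b
  proof -
    have "i div n * N \<le> 2 * N" using \<open>i div n \<le> 2\<close> by (intro mult_right_mono) auto
    then show ?thesis using that unfolding cell_def by linarith
  qed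
  have "xs ! i \<in> X" using * i by auto
  moreover have "y \<in> X" using * i by (metis len(1) len(2) nth_list_update_eq nth_mem subsetD)
  ultimately have c: "c < 3 * N" "c' < 3 * N"
    unfolding c_def c'_def h_def by (auto intro!: cell_less hash)
  define l where "l = map (\<lambda>i. cell n N i (h (xs ! i))) [0..<length xs]"
  have l: "length l = length xs" "l ! i = c" using i by (auto simp: l_def c_def)
  have l': "map (\<lambda>i. cell n N i (h (ys ! i))) [0..<length ys] = l[i := c']"
    by (rule nth_equalityI) (use i(1) in \<open>auto simp: l_def i(2) c'_def nth_list_update\<close>)
  show "measure_pmf.prob (shuffler_output (noisy_rand n N t hash) u xs) S
    \<le> exp \<epsilon> * measure_pmf.prob (shuffler_output (noisy_rand n N t hash) u ys) S + \<delta>"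
  proof (cases "c = c'")
    \<comment> \<open>Equal hash values hide the change by themselves; the other case relies on two
      distinct cells.\<close>
    case True
    have "l[i := c'] = l" using l True by (metis list_update_id)
    then have "transcript n N h xs m = transcript n N h ys m" for m
      unfolding transcript_def l' l_def[symmetric] by simp
    moreover have "xs \<noteq> []" "ys \<noteq> []" using len n by auto
    ultimately have eq: "shuffler_output (noisy_rand n N t hash) u xs = shuffler_output (noisy_rand n N t hash) u ys"
      by (simp add: shuffler_output_noisy h_def)
    have "0 \<le> \<delta>" using \<delta> by (rule order_trans[rotated]) simp
    moreover have "1 * measure_pmf.prob (shuffler_output (noisy_rand n N t hash) u ys) S
        \<le> exp \<epsilon> * measure_pmf.prob (shuffler_output (noisy_rand n N t hash) u ys) S"
      using \<epsilon> by (intro mult_right_mono) auto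
    ultimately show ?thesis unfolding eq by simp
  next
    case False
    let ?A = "noise_pmf N t" and ?b = "binomial_pmf t (1/2)"
    define G where "G = {m. central t \<epsilon> (m ! c) \<and> central t \<epsilon> (m ! c')}"
    let ?\<phi> = "move_noise c c'"
    note cb = central_bounds[OF \<epsilon> t]
    have move: "?\<phi> m ! c = m ! c + 1" "?\<phi> m ! c' = m ! c' - 1"
      "\<And>j. j \<noteq> c \<Longrightarrow> j \<noteq> c' \<Longrightarrow> ?\<phi> m ! j = m ! j" "length (?\<phi> m) = 3 * N"
      if "m \<in> set_pmf ?A" for m
      using length_noise[OF that] c False by (auto simp: move_noise_def nth_list_update)
    have pmfA: "pmf ?A m = pmf ?b (m ! c) * pmf ?b (m ! c') * (\<Prod>j\<in>{..<3 * N} - {c, c'}. pmf ?b (m ! j))"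
      if "length m = 3 * N" for m
      unfolding noise_pmf_def pmf_replicate_pmf[OF that] using c False by (rule prod_two)
    have "measure_pmf.prob (bind_pmf ?A (\<lambda>m. shuffle (transcript n N h xs m))) S
        \<le> exp \<epsilon> * measure_pmf.prob (bind_pmf ?A (\<lambda>m. shuffle (transcript n N h ys m))) S + \<delta>"
    proof (rule coupling_bound[where \<phi> = ?\<phi> and G = G])
      show "inj_on ?\<phi> (set_pmf ?A \<inter> G)"
      proof (intro inj_onI nth_equalityI)
        fix m m' assume m: "m \<in> set_pmf ?A \<inter> G" "m' \<in> set_pmf ?A \<inter> G" and eq: "?\<phi> m = ?\<phi> m'"
        show "length m = length m'" using m length_noise by auto
        fix j
        \<comment> \<open>Positivity makes the truncated subtraction in \<open>move_noise\<close>
          injective.\<close>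
        have "0 < m ! c'" "0 < m' ! c'" using m cb(1) by (auto simp: G_def)
        moreover have "?\<phi> m ! j = ?\<phi> m' ! j" using eq by simp
        moreover have "m \<in> set_pmf ?A" "m' \<in> set_pmf ?A" using m by auto
        ultimately show "m ! j = m' ! j"
          by (cases "j = c"; cases "j = c'") (simp_all add: move)
      qed
    next
      fix m assume m: "m \<in> set_pmf ?A" "m \<in> G"
      have "pmf ?b (m ! c) * pmf ?b (m ! c')
          \<le> (exp (\<epsilon> / 2) * pmf ?b (m ! c + 1)) * (exp (\<epsilon> / 2) * pmf ?b (m ! c' - 1))"
        using m(2) unfolding G_def
        by (intro mult_mono binomial_half_ratio[OF \<epsilon> t]) auto
      also have "\<dots> = exp \<epsilon> * (pmf ?b (m ! c + 1) * pmf ?b (m ! c' - 1))"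
        by (simp add: exp_add[symmetric] mult_ac del: pmf_binomial)
      finally have "pmf ?b (m ! c) * pmf ?b (m ! c') * (\<Prod>j\<in>{..<3 * N} - {c, c'}. pmf ?b (m ! j))
          \<le> exp \<epsilon> * (pmf ?b (m ! c + 1) * pmf ?b (m ! c' - 1)) * (\<Prod>j\<in>{..<3 * N} - {c, c'}. pmf ?b (m ! j))"
        by (intro mult_right_mono prod_nonneg) auto
      moreover have "(\<Prod>j\<in>{..<3 * N} - {c, c'}. pmf ?b (?\<phi> m ! j)) = (\<Prod>j\<in>{..<3 * N} - {c, c'}. pmf ?b (m ! j))"
        using move(3)[OF m(1)] by (intro prod.cong) auto
      ultimately show "pmf ?A m \<le> exp \<epsilon> * pmf ?A (?\<phi> m)"
        by (simp only: pmfA[OF length_noise[OF m(1)]] pmfA[OF move(4)[OF m(1)]] move(1,2)[OF m(1)] mult.assoc)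
      have "0 < m ! c'" using m cb(1) by (auto simp: G_def)
      show "shuffle (transcript n N h xs m) = shuffle (transcript n N h ys (?\<phi> m))"
      proof (rule shuffle_cong, rule multiset_eqI)
        fix z
        have "count (mset (l[i := c'])) z = count (mset l) z - of_bool (z = c) + of_bool (z = c')"
          using i l by (auto simp: mset_update)
        moreover have "0 < count (mset l) c" using i l by (metis count_greater_zero_iff nth_mem_mset)
        ultimately show "count (mset (transcript n N h xs m)) z = count (mset (transcript n N h ys (?\<phi> m))) z"
          using move[OF m(1)] length_noise[OF m(1)] c False \<open>0 < m ! c'\<close>
          unfolding transcript_def l' l_def[symmetric]
          by (cases "z = c"; cases "z = c'") (auto simp: count_noise_msgs)
      qed
    next
      have marginal: "measure_pmf.prob ?A {m. \<not> central t \<epsilon> (m ! j)} \<le> 2 * exp (- (\<epsilon>\<^sup>2 * t / 128))"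
        if "j < 3 * N" for j
      proof -
        have "measure_pmf.prob ?A {m. \<not> central t \<epsilon> (m ! j)}
            = measure_pmf.prob (map_pmf (\<lambda>m. m ! j) ?A) {k. \<not> central t \<epsilon> k}" by (simp add: vimage_def)
        also have "map_pmf (\<lambda>m. m ! j) ?A = ?b" unfolding noise_pmf_def using that by (rule map_nth_replicate_pmf)
        finally show ?thesis using prob_not_central[OF \<epsilon> t] by simp
      qed
      have "- G = {m. \<not> central t \<epsilon> (m ! c)} \<union> {m. \<not> central t \<epsilon> (m ! c')}" by (auto simp: G_def)
      then have "measure_pmf.prob ?A (- G)
          \<le> measure_pmf.prob ?A {m. \<not> central t \<epsilon> (m ! c)} + measure_pmf.prob ?A {m. \<not> central t \<epsilon> (m ! c')}"
        by (simp add: measure_Un_le)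
      also have "\<dots> \<le> 2 * exp (- (\<epsilon>\<^sup>2 * t / 128)) + 2 * exp (- (\<epsilon>\<^sup>2 * t / 128))"
        using c by (intro add_mono marginal)
      finally show "measure_pmf.prob ?A (- G) \<le> \<delta>" using \<delta> by simp
    qed simp_all
    moreover have "xs \<noteq> []" "ys \<noteq> []" using len n by auto
    ultimately show ?thesis by (simp add: shuffler_output_noisy h_def)
  qed
qed

section \<open>The protocol\<close>

lemma bind_interleave:
  "bind_pmf R (\<lambda>a. bind_pmf R (\<lambda>b. bind_pmf R (\<lambda>c. bind_pmf Q (\<lambda>x. bind_pmf Q (\<lambda>y. bind_pmf Q (K a b c x y))))))
    = bind_pmf R (\<lambda>a. bind_pmf Q (\<lambda>x. bind_pmf R (\<lambda>b. bind_pmf Q (\<lambda>y. bind_pmf R (\<lambda>c. bind_pmf Q (K a b c x y))))))"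
proof -
  have 1: "bind_pmf R (\<lambda>b. bind_pmf R (\<lambda>c. bind_pmf Q (H b c))) = bind_pmf Q (\<lambda>x. bind_pmf R (\<lambda>b. bind_pmf R (\<lambda>c. H b c x)))"
    for H
  proof -
    have "bind_pmf R (\<lambda>b. bind_pmf R (\<lambda>c. bind_pmf Q (H b c))) = bind_pmf R (\<lambda>b. bind_pmf Q (\<lambda>x. bind_pmf R (\<lambda>c. H b c x)))"
      by (intro bind_pmf_cong refl bind_commute_pmf)
    also have "\<dots> = bind_pmf Q (\<lambda>x. bind_pmf R (\<lambda>b. bind_pmf R (\<lambda>c. H b c x)))"
      by (rule bind_commute_pmf)
    finally show ?thesis .
  qed
  show ?thesis
    by (subst 1) (intro bind_pmf_cong refl bind_commute_pmf)
qed

definition block_freq :: "nat \<Rightarrow> nat \<Rightarrow> nat \<Rightarrow> nat multiset \<Rightarrow> nat \<Rightarrow> nat \<Rightarrow> real" where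
  "block_freq n N t M j b = (real (count M (j * N + b)) - t / 2) / n"

text \<open>The counterpart of \<open>block_freq\<close> before shuffling, from the samples and the
  noise of one block.\<close>

definition raw_freq :: "('a \<Rightarrow> nat) \<Rightarrow> nat \<Rightarrow> nat \<Rightarrow> 'a list \<Rightarrow> nat list \<Rightarrow> nat \<Rightarrow> real" where
  "raw_freq h n t xs m b = (real (count_list (map h xs) b) + real (m ! b) - t / 2) / n"

lemma block_raw_freq: "block h n N t p
  = bind_pmf (replicate_pmf n p) (\<lambda>xs. bind_pmf (replicate_pmf N (binomial_pmf t (1/2))) (\<lambda>m. return_pmf (raw_freq h n t xs m)))"
  by (simp add: block_def raw_freq_def[abs_def])

text \<open>Cell numbers are written in base \<open>N\<close> with the block as leading digit, so a
  cell determines both block and hash value.\<close>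

lemma count_shifted:
  fixes h :: "'a \<Rightarrow> nat"
  assumes "b < N" "\<And>x. x \<in> set xs \<Longrightarrow> h x < N"
  shows "count (mset (map (\<lambda>x. j' * N + h x) xs)) (j * N + b) = (if j = j' then count_list (map h xs) b else 0)"
  using assms(2)
proof (induction xs)
  case (Cons x xs)
  have "j' * N + h x = j * N + b \<longleftrightarrow> j' = j \<and> h x = b"
  proof
    assume eq: "j' * N + h x = j * N + b"
    have hx: "h x < N" using Cons.prems by simp
    have "j' = (j' * N + h x) div N" using hx by simp
    also have "\<dots> = j" unfolding eq using assms(1) by simp
    finally show "j' = j \<and> h x = b" using eq by simp
  qed simp
  then show ?case using Cons by auto
qed simp

lemma block_freq_transcript:
  assumes len: "length as = n" "length bs = n" "length cs = n" "length ma = N" "length mb = N" "length mc = N"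
    and h: "\<And>x. x \<in> set (as @ bs @ cs) \<Longrightarrow> h x < N" and b: "b < N" and n: "n > 0"
  shows "block_freq n N t (mset (transcript n N h (as @ bs @ cs) (ma @ mb @ mc))) 0 b = raw_freq h n t as ma b"
    and "block_freq n N t (mset (transcript n N h (as @ bs @ cs) (ma @ mb @ mc))) 1 b = raw_freq h n t bs mb b"
    and "block_freq n N t (mset (transcript n N h (as @ bs @ cs) (ma @ mb @ mc))) 2 b = raw_freq h n t cs mc b"
proof -
  let ?xs = "as @ bs @ cs" and ?m = "ma @ mb @ mc"
  have cells: "map (\<lambda>i. cell n N i (h (?xs ! i))) [0..<length ?xs]
      = map (\<lambda>x. 0 * N + h x) as @ map (\<lambda>x. 1 * N + h x) bs @ map (\<lambda>x. 2 * N + h x) cs"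
  proof (rule nth_equalityI)
    fix i assume "i < length (map (\<lambda>i. cell n N i (h (?xs ! i))) [0..<length ?xs])"
    then have i: "i < 3 * n" using len by simp
    consider "i < n" | "n \<le> i" "i < 2 * n" | "2 * n \<le> i" by linarith
    then show "map (\<lambda>i. cell n N i (h (?xs ! i))) [0..<length ?xs] ! i
      = (map (\<lambda>x. 0 * N + h x) as @ map (\<lambda>x. 1 * N + h x) bs @ map (\<lambda>x. 2 * N + h x) cs) ! i"
    proof cases
      case 1
      then show ?thesis using len by (simp add: cell_def nth_append)
    next
      case 2
      then have "i div n = 1" by (intro div_nat_eqI) auto
      moreover have "i - n < n" using 2 by simp
      ultimately show ?thesis using len 2 by (simp add: cell_def nth_append)
    next
      case 3
      then have "i div n = 2" using i by (intro div_nat_eqI) auto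
      with 3 show ?thesis using len i by (simp add: cell_def nth_append)
    qed
  qed simp
  have "count (mset (transcript n N h ?xs ?m)) (j * N + b)
      = (if j = 0 then count_list (map h as) b else 0) + (if j = 1 then count_list (map h bs) b else 0)
        + (if j = 2 then count_list (map h cs) b else 0) + (if j * N + b < 3 * N then ?m ! (j * N + b) else 0)"
    for j
    unfolding transcript_def cells using len b h
    by (simp add: count_noise_msgs count_shifted[of b N _ h _ j, simplified]
        count_shifted[of b N _ h 0 j, simplified] count_shifted[of b N _ h 1 j, simplified])
  note cnt = this[of 0] this[of 1] this[of 2]
  show "block_freq n N t (mset (transcript n N h ?xs ?m)) 0 b = raw_freq h n t as ma b"
    "block_freq n N t (mset (transcript n N h ?xs ?m)) 1 b = raw_freq h n t bs mb b"
    "block_freq n N t (mset (transcript n N h ?xs ?m)) 2 b = raw_freq h n t cs mc b"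
    using cnt len b unfolding block_freq_def raw_freq_def by (simp_all add: nth_append)
qed

text \<open>The condition on \<open>K\<close> restricts it to cells below \<open>N\<close>: beyond
  them \<open>block_freq\<close> reads the next block, while \<open>raw_freq\<close> indexes past
  the end of its noise.\<close>

lemma group_blocks:
  fixes K :: "(nat \<Rightarrow> real) \<Rightarrow> (nat \<Rightarrow> real) \<Rightarrow> (nat \<Rightarrow> real) \<Rightarrow> 'b pmf"
  assumes h: "\<And>x. x \<in> set_pmf p \<Longrightarrow> h x < N" and n: "n > 0"
    and K: "\<And>A A' B B' C C'. (\<And>b. b < N \<Longrightarrow> A b = A' b \<and> B b = B' b \<and> C b = C' b) \<Longrightarrow> K A B C = K A' B' C'"
  shows "(do {xs \<leftarrow> replicate_pmf (3 * n) p; m \<leftarrow> noise_pmf N t;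
      let M = mset (transcript n N h xs m); v = block_freq n N t M in K (v 0) (v 1) (v 2)})
    = (do {A \<leftarrow> block h n N t p; B \<leftarrow> block h n N t p; C \<leftarrow> block h n N t p; K A B C})"
proof -
  let ?R = "replicate_pmf n p" and ?Q = "replicate_pmf N (binomial_pmf t (1/2))"
  let ?r = "raw_freq h n t"
  have R3: "replicate_pmf (3 * n) p = (do {as \<leftarrow> ?R; bs \<leftarrow> ?R; cs \<leftarrow> ?R; return_pmf (as @ bs @ cs)})"
  proof -
    have "3 * n = n + (n + n)" by simp
    then show ?thesis by (simp only: replicate_pmf_distrib) (simp add: bind_assoc_pmf bind_return_pmf)
  qed
  have Q3: "noise_pmf N t = (do {as \<leftarrow> ?Q; bs \<leftarrow> ?Q; cs \<leftarrow> ?Q; return_pmf (as @ bs @ cs)})"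
  proof -
    have "3 * N = N + (N + N)" by simp
    then show ?thesis unfolding noise_pmf_def
      by (simp only: replicate_pmf_distrib) (simp add: bind_assoc_pmf bind_return_pmf)
  qed
  have "(do {xs \<leftarrow> replicate_pmf (3 * n) p; m \<leftarrow> noise_pmf N t;
      let M = mset (transcript n N h xs m); v = block_freq n N t M in K (v 0) (v 1) (v 2)})
    = (do {as \<leftarrow> ?R; bs \<leftarrow> ?R; cs \<leftarrow> ?R; ma \<leftarrow> ?Q; mb \<leftarrow> ?Q; mc \<leftarrow> ?Q;
        let M = mset (transcript n N h (as @ bs @ cs) (ma @ mb @ mc)); v = block_freq n N t M
        in K (v 0) (v 1) (v 2)})"
    unfolding R3 Q3 by (simp add: bind_assoc_pmf bind_return_pmf)
  also have "\<dots> = (do {as \<leftarrow> ?R; bs \<leftarrow> ?R; cs \<leftarrow> ?R; ma \<leftarrow> ?Q; mb \<leftarrow> ?Q; mc \<leftarrow> ?Q;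
        K (?r as ma) (?r bs mb) (?r cs mc)})"
  proof (intro bind_pmf_cong[OF refl])
    fix as bs cs ma mb mc
    assume s: "as \<in> set_pmf ?R" "bs \<in> set_pmf ?R" "cs \<in> set_pmf ?R"
      "ma \<in> set_pmf ?Q" "mb \<in> set_pmf ?Q" "mc \<in> set_pmf ?Q"
    then have len: "length as = n" "length bs = n" "length cs = n" "length ma = N" "length mb = N" "length mc = N"
      and sub: "set as \<subseteq> set_pmf p" "set bs \<subseteq> set_pmf p" "set cs \<subseteq> set_pmf p"
      by (auto simp: set_replicate_pmf)
    have hx: "h x < N" if "x \<in> set (as @ bs @ cs)" for x using that sub h by auto
    show "(let M = mset (transcript n N h (as @ bs @ cs) (ma @ mb @ mc)); v = block_freq n N t M
        in K (v 0) (v 1) (v 2)) = K (?r as ma) (?r bs mb) (?r cs mc)"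
      unfolding Let_def
      by (rule K) (intro conjI block_freq_transcript[OF len hx _ n], assumption+)
  qed
  also have "\<dots> = (do {as \<leftarrow> ?R; ma \<leftarrow> ?Q; bs \<leftarrow> ?R; mb \<leftarrow> ?Q; cs \<leftarrow> ?R; mc \<leftarrow> ?Q;
        K (?r as ma) (?r bs mb) (?r cs mc)})"
    by (rule bind_interleave)
  also have "\<dots> = (do {A \<leftarrow> block h n N t p; B \<leftarrow> block h n N t p; C \<leftarrow> block h n N t p; K A B C})"
    unfolding block_raw_freq by (simp add: bind_assoc_pmf bind_return_pmf)
  finally show ?thesis .
qed

lemma weighted_stat_cong:
  "(\<And>b. b < N \<Longrightarrow> F b = F' b \<and> V b = V' b \<and> W b = W' b) \<Longrightarrow> weighted_stat N L F V W = weighted_stat N L F' V' W'"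
  unfolding weighted_stat_def weight_def by (intro sum.cong) auto

definition lincomb :: "real \<Rightarrow> (nat \<Rightarrow> real) \<Rightarrow> (nat \<Rightarrow> real) \<Rightarrow> nat \<Rightarrow> real" where
  "lincomb c V W b = 1 * V b + c * W b"

text \<open>The factor 1 is kept to match \<open>cov_dominated_lincomb\<close> with a = 1.\<close>

definition lincomb_pmf :: "real \<Rightarrow> (nat \<Rightarrow> real) pmf \<Rightarrow> (nat \<Rightarrow> real) pmf \<Rightarrow> (nat \<Rightarrow> real) pmf" where
  "lincomb_pmf c M M' = do {V \<leftarrow> M; W \<leftarrow> M'; return_pmf (\<lambda>b. 1 * V b + c * W b)}"

text \<open>
  The first block of each group estimates the weights, the other two blocks are two independent
  estimates of the difference of the hashed distributions.
\<close>

definition tester ::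
    "nat \<Rightarrow> nat \<Rightarrow> nat \<Rightarrow> real \<Rightarrow> nat \<Rightarrow> nat \<Rightarrow> nat \<Rightarrow> (bool list \<Rightarrow> nat \<Rightarrow> nat) \<Rightarrow> real \<Rightarrow> nat shuffle_protocol" where
  "tester n n' N L t t' r hash T = \<lparr>users1 = 3 * n, users2 = 3 * n', coins = r,
     rand1 = noisy_rand n N t hash, rand2 = noisy_rand n' N t' hash,
     analyzer = (\<lambda>s s' u. let v = block_freq n N t (mset s); v' = block_freq n' N t' (mset s') in
       return_pmf (weighted_stat N L (lincomb 1 (v 0) (v' 0)) (lincomb (-1) (v 1) (v' 1)) (lincomb (-1) (v 2) (v' 2)) \<le> T))\<rparr>"

text \<open>The analyzer reads only multisets, so the shufflers drop out. Regrouping the draws by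
  blocks leaves, for each public string, one trial on independent blocks.\<close>

lemma run_tester:
  assumes h: "\<And>u x. u \<in> set_pmf (public_string r) \<Longrightarrow> x \<in> set_pmf p \<union> set_pmf q \<Longrightarrow> hash u x < N"
    and n: "n > 0" "n' > 0"
  shows "run_protocol (tester n n' N L t t' r hash T) p q = map_pmf (\<lambda>z. z \<le> T)
    (do {u \<leftarrow> public_string r;
      trial N L (lincomb_pmf 1 (block (hash u) n N t p) (block (hash u) n' N t' q))
        (lincomb_pmf (-1) (block (hash u) n N t p) (block (hash u) n' N t' q))})"
proof -
  let ?st = "\<lambda>A A' B B' C C'. return_pmf (weighted_stat N L (lincomb 1 A A') (lincomb (-1) B B') (lincomb (-1) C C') \<le> T)"
  let ?P = "tester n n' N L t t' r hash T"
  have "(do {xs \<leftarrow> replicate_pmf (3 * n) p; ys \<leftarrow> replicate_pmf (3 * n') q;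
      s1 \<leftarrow> shuffler_output (noisy_rand n N t hash) u xs; s2 \<leftarrow> shuffler_output (noisy_rand n' N t' hash) u ys;
      analyzer ?P s1 s2 u})
    = map_pmf (\<lambda>z. z \<le> T) (trial N L (lincomb_pmf 1 (block (hash u) n N t p) (block (hash u) n' N t' q))
        (lincomb_pmf (-1) (block (hash u) n N t p) (block (hash u) n' N t' q)))"
    (is "?lhs = ?rhs") if u: "u \<in> set_pmf (public_string r)" for u
  proof -
    let ?h = "hash u"
    let ?v = "\<lambda>xs m. block_freq n N t (mset (transcript n N ?h xs m))"
    let ?v' = "\<lambda>xs m. block_freq n' N t' (mset (transcript n' N ?h xs m))"
    have "?lhs = (do {xs \<leftarrow> replicate_pmf (3 * n) p; ys \<leftarrow> replicate_pmf (3 * n') q;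
        m \<leftarrow> noise_pmf N t; m' \<leftarrow> noise_pmf N t';
        ?st (?v xs m 0) (?v' ys m' 0) (?v xs m 1) (?v' ys m' 1) (?v xs m 2) (?v' ys m' 2)})"
    proof (intro bind_pmf_cong[OF refl])
      fix xs ys assume xs: "xs \<in> set_pmf (replicate_pmf (3 * n) p)" and ys: "ys \<in> set_pmf (replicate_pmf (3 * n') q)"
      define F where "F M M' = (let v = block_freq n N t M; v' = block_freq n' N t' M' in
          ?st (v 0) (v' 0) (v 1) (v' 1) (v 2) (v' 2))" for M M'
      have an: "analyzer ?P s1 s2 u = F (mset s1) (mset s2)" for s1 s2
        by (simp add: tester_def F_def Let_def)
      have ne: "xs \<noteq> []" "ys \<noteq> []" using xs ys n by (auto simp: set_replicate_pmf)
      have "(do {s1 \<leftarrow> shuffler_output (noisy_rand n N t hash) u xs;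
          s2 \<leftarrow> shuffler_output (noisy_rand n' N t' hash) u ys; analyzer ?P s1 s2 u})
        = (do {m \<leftarrow> noise_pmf N t; s1 \<leftarrow> shuffle (transcript n N ?h xs m); m' \<leftarrow> noise_pmf N t';
            F (mset s1) (mset (transcript n' N ?h ys m'))})"
        by (simp add: shuffler_output_noisy ne bind_assoc_pmf an bind_shuffle_mset)
      also have "\<dots> = (do {m \<leftarrow> noise_pmf N t; m' \<leftarrow> noise_pmf N t';
            F (mset (transcript n N ?h xs m)) (mset (transcript n' N ?h ys m'))})"
        using bind_shuffle_mset[where F = "\<lambda>M. bind_pmf (noise_pmf N t') (\<lambda>m'. F M (mset (transcript n' N ?h ys m')))"]
        by simp
      finally show "(do {s1 \<leftarrow> shuffler_output (noisy_rand n N t hash) u xs;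
          s2 \<leftarrow> shuffler_output (noisy_rand n' N t' hash) u ys; analyzer ?P s1 s2 u})
        = (do {m \<leftarrow> noise_pmf N t; m' \<leftarrow> noise_pmf N t';
            ?st (?v xs m 0) (?v' ys m' 0) (?v xs m 1) (?v' ys m' 1) (?v xs m 2) (?v' ys m' 2)})"
        by (simp add: F_def Let_def)
    qed
    \<comment> \<open>With samples and noise of each group adjacent, \<open>group_blocks\<close> can
      rewrite the second group and then the first.\<close>
    also have "\<dots> = (do {xs \<leftarrow> replicate_pmf (3 * n) p; m \<leftarrow> noise_pmf N t;
        ys \<leftarrow> replicate_pmf (3 * n') q; m' \<leftarrow> noise_pmf N t';
        ?st (?v xs m 0) (?v' ys m' 0) (?v xs m 1) (?v' ys m' 1) (?v xs m 2) (?v' ys m' 2)})"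
      by (intro bind_pmf_cong refl bind_commute_pmf)
    also have "\<dots> = (do {xs \<leftarrow> replicate_pmf (3 * n) p; m \<leftarrow> noise_pmf N t;
        let M = mset (transcript n N ?h xs m); v = block_freq n N t M in
        (do {A' \<leftarrow> block ?h n' N t' q; B' \<leftarrow> block ?h n' N t' q; C' \<leftarrow> block ?h n' N t' q;
          ?st (v 0) A' (v 1) B' (v 2) C'})})"
    proof (intro bind_pmf_cong[OF refl])
      fix xs m
      have "(do {ys \<leftarrow> replicate_pmf (3 * n') q; m' \<leftarrow> noise_pmf N t';
          let M = mset (transcript n' N ?h ys m'); v' = block_freq n' N t' M in
          ?st (?v xs m 0) (v' 0) (?v xs m 1) (v' 1) (?v xs m 2) (v' 2)})
        = (do {A' \<leftarrow> block ?h n' N t' q; B' \<leftarrow> block ?h n' N t' q; C' \<leftarrow> block ?h n' N t' q;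
          ?st (?v xs m 0) A' (?v xs m 1) B' (?v xs m 2) C'})"
        using h u n by (intro group_blocks) (auto simp: lincomb_def intro!: arg_cong[where f = "\<lambda>z. z \<le> T"] weighted_stat_cong)
      then show "(do {ys \<leftarrow> replicate_pmf (3 * n') q; m' \<leftarrow> noise_pmf N t';
          ?st (?v xs m 0) (?v' ys m' 0) (?v xs m 1) (?v' ys m' 1) (?v xs m 2) (?v' ys m' 2)})
        = (let M = mset (transcript n N ?h xs m); v = block_freq n N t M in
        (do {A' \<leftarrow> block ?h n' N t' q; B' \<leftarrow> block ?h n' N t' q; C' \<leftarrow> block ?h n' N t' q;
          ?st (v 0) A' (v 1) B' (v 2) C'}))"
        unfolding Let_def .
    qed
    also have "\<dots> = (do {A \<leftarrow> block ?h n N t p; B \<leftarrow> block ?h n N t p; C \<leftarrow> block ?h n N t p;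
        A' \<leftarrow> block ?h n' N t' q; B' \<leftarrow> block ?h n' N t' q; C' \<leftarrow> block ?h n' N t' q; ?st A A' B B' C C'})"
      using h u n by (intro group_blocks)
        (auto simp: lincomb_def intro!: bind_pmf_cong arg_cong[where f = "\<lambda>z. z \<le> T"] weighted_stat_cong)
    also have "\<dots> = (do {A \<leftarrow> block ?h n N t p; A' \<leftarrow> block ?h n' N t' q; B \<leftarrow> block ?h n N t p;
        B' \<leftarrow> block ?h n' N t' q; C \<leftarrow> block ?h n N t p; C' \<leftarrow> block ?h n' N t' q; ?st A A' B B' C C'})"
      by (rule bind_interleave)
    also have "\<dots> = ?rhs"
      unfolding trial_def lincomb_pmf_def
      by (simp add: map_pmf_def bind_assoc_pmf bind_return_pmf lincomb_def[abs_def])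
    finally show ?thesis .
  qed
  then show ?thesis
    unfolding run_protocol_def map_bind_pmf
    by (intro bind_pmf_cong) (simp_all add: tester_def)
qed

lemma pmf_map_fibre_sum:
  assumes "set_pmf p \<subseteq> A" "finite A"
  shows "pmf (map_pmf h p) b = fibre_sum A (pmf p) h b"
proof -
  have "pmf (map_pmf h p) b = mean p (indicator (h -` {b}))" by (simp add: pmf_map)
  also have "\<dots> = (\<Sum>x\<in>A. indicator (h -` {b}) x * pmf p x)"
    using assms by (intro integral_measure_pmf_real) auto
  also have "\<dots> = fibre_sum A (pmf p) h b"
    unfolding fibre_sum_def by (intro sum.cong) (auto simp: indicator_def)
  finally show ?thesis .
qed

section \<open>Correctness\<close>

text \<open>Strings of k * b bits are as numerous as functions from [k] to 2 ^ b cells, so any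
  bijection turns the coins into an exactly uniform hash function.\<close>

lemma hash_from_coins:
  obtains hash :: "bool list \<Rightarrow> nat \<Rightarrow> nat"
  where "map_pmf hash (public_string (k * b)) = hash_pmf {1..k} (2 ^ b)"
proof -
  let ?U = "{u :: bool list. length u = k * b}" and ?H = "PiE_dflt {1..k} 0 (\<lambda>_. {..<2 ^ b}) :: (nat \<Rightarrow> nat) set"
  have U: "finite ?U" "card ?U = 2 ^ (k * b)"
    using finite_lists_length_eq[of "UNIV :: bool set" "k * b"] card_lists_length_eq[of "UNIV :: bool set" "k * b"]
    by simp_all
  have "card ?H = (2 ^ b) ^ k" by (subst card_PiE_dflt) simp_all
  then have "card ?U = card ?H" by (simp only: U power_mult[symmetric] mult.commute[of b k])
  moreover have "finite ?H" by (intro finite_PiE_dflt) auto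
  ultimately obtain hash where bij: "bij_betw hash ?U ?H"
    using finite_same_card_bij[OF U(1)] by blast
  have "?U \<noteq> {}" using U by (metis card.empty power_not_zero zero_neq_numeral)
  then have "map_pmf hash (public_string (k * b)) = pmf_of_set ?H"
    unfolding public_string_def using bij U(1) by (intro map_pmf_of_set_bij_betw) auto
  also have "\<dots> = hash_pmf {1..k} (2 ^ b)"
    unfolding hash_pmf_def by (rule Pi_pmf_of_set[symmetric]) (auto simp: lessThan_empty_iff)
  finally show ?thesis by (rule that)
qed

lemma sum_pmf_le_1: "finite B \<Longrightarrow> (\<Sum>b\<in>B. pmf p b) \<le> 1"
  by (simp flip: measure_measure_pmf_finite)

text \<open>\<open>S0\<close> comes from the far case: the energy is at least 4 * \<alpha>^2 / (3 *
  k), and \<open>far_error\<close> keeps 1 / 1440 of it. The factor 2352 = 12 * 196 limits the noise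
  term there to 1 / 12.\<close>

locale tester_params =
  fixes k n n' N t t' r :: nat and L \<alpha> \<tau> S0 :: real and hash :: "bool list \<Rightarrow> nat \<Rightarrow> nat"
  assumes hash: "map_pmf hash (public_string r) = hash_pmf {1..k} N"
    and k: "k \<ge> 1" and N: "real N = 1024 * L" and L: "1 \<le> L" "L \<le> k" "L \<le> n" and n: "n \<le> n'"
    and \<tau>: "t / (4 * (real n)\<^sup>2) + t' / (4 * (real n')\<^sup>2) \<le> \<tau>" "L\<^sup>2 * \<tau> \<le> 1" and \<alpha>: "\<alpha> > 0"
    and S0: "S0 = \<alpha>\<^sup>2 / (1080 * k)"
    and var: "2352 * (16400 / (L * (real n)\<^sup>2) + 2048 * L * \<tau>\<^sup>2) \<le> S0\<^sup>2"
begin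

lemma n_pos: "0 < n" "0 < n'" and N_pos: "0 < N" using L N n by (cases n; cases N; simp)+

lemma S0_pos: "0 < S0" using \<alpha> k by (simp add: S0)

lemma hash_less_N: "u \<in> set_pmf (public_string r) \<Longrightarrow> x \<in> {1..k} \<Longrightarrow> hash u x < N"
proof -
  assume "u \<in> set_pmf (public_string r)" "x \<in> {1..k}"
  then have "hash u \<in> set_pmf (hash_pmf {1..k} N)" unfolding hash[symmetric] by simp
  then show "hash u x < N" using \<open>x \<in> {1..k}\<close> by (intro hash_less[OF _ N_pos]) auto
qed

context
  fixes p q :: "nat pmf"
  assumes pq: "set_pmf p \<subseteq> {1..k}" "set_pmf q \<subseteq> {1..k}"
begin

definition diff where "diff x = pmf p x - pmf q x"
definition total where "total x = pmf p x + pmf q x"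

definition hash_trial :: "(nat \<Rightarrow> nat) \<Rightarrow> real pmf" where
  "hash_trial h = trial N L (lincomb_pmf 1 (block h n N t p) (block h n' N t' q))
     (lincomb_pmf (-1) (block h n N t p) (block h n' N t' q))"

lemma fin_pq: "finite (set_pmf p)" "finite (set_pmf q)"
  using pq finite_subset by blast+

text \<open>The bound \<open>s\<close> depends on the hash function, hence the existential. Sum and
  difference share it, as the coefficients 1 and -1 have equal squares.\<close>

lemma trial_setup_hash:
  "\<exists>s. trial_setup N L n \<tau> (lincomb_pmf 1 (block h n N t p) (block h n' N t' q))
     (lincomb_pmf (-1) (block h n N t p) (block h n' N t' q))
     (fibre_sum {1..k} total h) (fibre_sum {1..k} diff h) s"
proof
  let ?P = "pmf (map_pmf h p)" and ?Q = "pmf (map_pmf h q)"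
  let ?s = "\<lambda>b. ?P b / n + t / (4 * (real n)\<^sup>2) + (?Q b / n' + t' / (4 * (real n')\<^sup>2))"
  have tot: "fibre_sum {1..k} total h b = ?P b + ?Q b" for b
    using pq by (simp add: pmf_map_fibre_sum fibre_sum_def total_def distrib_right sum.distrib)
  have dif: "fibre_sum {1..k} diff h b = ?P b - ?Q b" for b
    using pq by (simp add: pmf_map_fibre_sum fibre_sum_def diff_def left_diff_distrib sum_subtractf)
  note blocks = cov_dominated_block[OF fin_pq(1) n_pos(1)] cov_dominated_block[OF fin_pq(2) n_pos(2)]
  have cov: "cov_dominated {..<N} (lincomb_pmf c (block h n N t p) (block h n' N t' q))
      (\<lambda>b. 1 * ?P b + c * ?Q b) ?s" if "c\<^sup>2 = 1" for c
    unfolding lincomb_pmf_def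
    by (rule cov_dominated_mono[OF cov_dominated_lincomb[OF blocks]]) (simp_all add: that)
  show "trial_setup N L n \<tau> (lincomb_pmf 1 (block h n N t p) (block h n' N t' q))
     (lincomb_pmf (-1) (block h n N t p) (block h n' N t' q))
     (fibre_sum {1..k} total h) (fibre_sum {1..k} diff h) ?s"
  proof
    show "cov_dominated {..<N} (lincomb_pmf 1 (block h n N t p) (block h n' N t' q)) (fibre_sum {1..k} total h) ?s"
      by (rule cov_dominated_mono[OF cov]) (simp_all add: tot del: One_nat_def)
    show "cov_dominated {..<N} (lincomb_pmf (-1) (block h n N t p) (block h n' N t' q)) (fibre_sum {1..k} diff h) ?s"
      by (rule cov_dominated_mono[OF cov]) (simp_all add: dif del: One_nat_def)
    show "0 \<le> fibre_sum {1..k} total h b" for b by (simp add: tot del: One_nat_def)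
    show "0 \<le> ?s b" for b by simp
    show "?s b \<le> fibre_sum {1..k} total h b / n + \<tau>" for b
    proof -
      have "?Q b / n' \<le> ?Q b / n" using n n_pos by (intro divide_left_mono) auto
      then show ?thesis using \<tau>(1) by (simp add: tot add_divide_distrib del: One_nat_def)
    qed
    show "(\<Sum>b<N. fibre_sum {1..k} total h b) \<le> 2"
      using sum_pmf_le_1[of "{..<N}" "map_pmf h p"] sum_pmf_le_1[of "{..<N}" "map_pmf h q"]
      by (simp add: tot sum.distrib del: One_nat_def)
    have "0 \<le> t / (4 * (real n)\<^sup>2) + t' / (4 * (real n')\<^sup>2)" by simp
    then show "0 \<le> \<tau>" using \<tau>(1) by linarith
  qed (use L \<tau> N in auto)
qed

lemma run_eq: "run_protocol (tester n n' N L t t' r hash (S0 / 2)) p q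
    = map_pmf (\<lambda>z. z \<le> S0 / 2) (bind_pmf (hash_pmf {1..k} N) hash_trial)"
proof -
  have "run_protocol (tester n n' N L t t' r hash (S0 / 2)) p q
      = map_pmf (\<lambda>z. z \<le> S0 / 2) (bind_pmf (public_string r) (\<lambda>u. hash_trial (hash u)))"
    unfolding hash_trial_def by (rule run_tester[OF hash_less_N n_pos]) (use pq in auto)
  then show ?thesis unfolding hash[symmetric] by (simp add: bind_map_pmf)
qed

lemma fin_hash_trial: "finite (set_pmf (hash_trial h))"
  using trial_setup_hash[of h] trial_setup.fin_trial unfolding hash_trial_def by blast

lemma prob_hash_trial:
  "measure_pmf.prob (bind_pmf (hash_pmf {1..k} N) hash_trial) S
    = mean (hash_pmf {1..k} N) (\<lambda>h. measure_pmf.prob (hash_trial h) S)"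
  by (rule prob_bind) (simp_all add: finite_hash_pmf N_pos fin_hash_trial)

lemma error_var: "196 * (16400 / (L * (real n)\<^sup>2) + 2048 * L * \<tau>\<^sup>2) / S0\<^sup>2 \<le> 1 / 12"
  using var S0_pos by (simp add: divide_le_eq)

text \<open>Equal distributions agree on every cell under every hash function, so the bound holds
  before averaging over the hash.\<close>

lemma accept: "p = q \<Longrightarrow> 2 / 3 \<le> pmf (run_protocol (tester n n' N L t t' r hash (S0 / 2)) p q) True"
proof -
  assume "p = q"
  let ?X = "bind_pmf (hash_pmf {1..k} N) hash_trial"
  have "measure_pmf.prob (hash_trial h) {z. z > S0 / 2} \<le> 1 / 3" for h
  proof -
    obtain s where s: "trial_setup N L n \<tau> (lincomb_pmf 1 (block h n N t p) (block h n' N t' q))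
     (lincomb_pmf (-1) (block h n N t p) (block h n' N t' q))
     (fibre_sum {1..k} total h) (fibre_sum {1..k} diff h) s" using trial_setup_hash by blast
    have "fibre_sum {1..k} diff h b = 0" for b
      unfolding fibre_sum_def diff_def using \<open>p = q\<close> by simp
    then have "measure_pmf.prob (hash_trial h) {z. z > S0 / 2}
        \<le> (16400 / (L * (real n)\<^sup>2) + 2048 * L * \<tau>\<^sup>2) / (S0 / 2)\<^sup>2"
      using trial_setup.null_error[OF s, of "S0 / 2"] S0_pos
      unfolding trial_setup.var_bound_def[OF s] hash_trial_def by simp
    also have "\<dots> = 4 / 196 * (196 * (16400 / (L * (real n)\<^sup>2) + 2048 * L * \<tau>\<^sup>2) / S0\<^sup>2)"
    proof -
      have "x / (S0 / 2)\<^sup>2 = 4 / 196 * (196 * x / S0\<^sup>2)" for x by (simp add: power_divide)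
      then show ?thesis .
    qed
    also have "\<dots> \<le> 4 / 196 * (1 / 12)" by (intro mult_left_mono error_var) simp
    finally show ?thesis by simp
  qed
  then have "measure_pmf.prob ?X {z. z > S0 / 2} \<le> mean (hash_pmf {1..k} N) (\<lambda>h. 1 / 3)"
    unfolding prob_hash_trial by (intro mean_mono finite_hash_pmf N_pos) simp
  then have "measure_pmf.prob ?X {z. z > S0 / 2} \<le> 1 / 3" by simp
  moreover have "{z. z \<le> S0 / 2} = space (measure_pmf ?X) - {z. z > S0 / 2}" by auto
  then have "measure_pmf.prob ?X {z. z \<le> S0 / 2} = 1 - measure_pmf.prob ?X {z. z > S0 / 2}"
    by (metis measure_pmf.prob_compl sets_measure_pmf UNIV_I)
  ultimately show ?thesis unfolding run_eq by (simp add: pmf_map vimage_def)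
qed

lemma discrepancy_diff: "discrepancy {1..k} N L diff total"
proof
  show "\<bar>diff x\<bar> \<le> total x" for x unfolding diff_def total_def by (simp add: abs_le_iff)
  show "sum total {1..k} \<le> 2" "sum diff {1..k} = 0"
    using pq by (simp_all add: total_def diff_def sum.distrib sum_subtractf sum_pmf_eq_1)
qed (use L N in auto)

text \<open>Averaging \<open>far_error\<close> over the hash function gives 1 / 6 for the lost
  signal, besides the 1 / 12 + 1 / 12 that hold for every hash.\<close>

lemma reject:
  assumes far: "tv_dist k p q > \<alpha>"
  shows "2 / 3 \<le> pmf (run_protocol (tester n n' N L t t' r hash (S0 / 2)) p q) False"
proof -
  interpret D: discrepancy "{1..k}" N L diff total by (rule discrepancy_diff)
  let ?X = "bind_pmf (hash_pmf {1..k} N) hash_trial"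
  have "2 * \<alpha> \<le> (\<Sum>x\<in>{1..k}. \<bar>diff x\<bar>)"
    using far by (simp add: tv_dist_def diff_def)
  then have "(2 * \<alpha>)\<^sup>2 \<le> (\<Sum>x\<in>{1..k}. \<bar>diff x\<bar>)\<^sup>2" using \<alpha> by (intro power_mono) auto
  also have "\<dots> \<le> 3 * real k * D.energy" using L by (intro D.energy_lower) auto
  finally have e: "4 * \<alpha>\<^sup>2 \<le> 3 * real k * D.energy" by (simp add: power_mult_distrib)
  then have S0_le: "S0 \<le> D.energy / 1440" using k unfolding S0 by (simp add: field_simps)
  then have e_pos: "D.energy > 0" using S0_pos by linarith
  let ?err = "\<lambda>h. 4 * ((\<Sum>b<N. fibre_sum {1..k} diff h b * fibre_sum {1..k} D.g h b) - D.energy)\<^sup>2 / D.energy\<^sup>2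
    + (\<Sum>b<N. (fibre_sum {1..k} D.g h b)\<^sup>2 * (1 + L * fibre_sum {1..k} total h b)) / (180 * D.energy)"
  have "measure_pmf.prob (hash_trial h) {z. z \<le> S0 / 2} \<le> ?err h + 1 / 6" for h
  proof -
    obtain s where s: "trial_setup N L n \<tau> (lincomb_pmf 1 (block h n N t p) (block h n' N t' q))
     (lincomb_pmf (-1) (block h n N t p) (block h n' N t' q))
     (fibre_sum {1..k} total h) (fibre_sum {1..k} diff h) s" using trial_setup_hash by blast
    show ?thesis
      using trial_setup.far_error[OF s e_pos S0_pos S0_le, of "fibre_sum {1..k} D.g h"] error_var
      unfolding trial_setup.var_bound_def[OF s] hash_trial_def by linarith
  qed
  then have "measure_pmf.prob ?X {z. z \<le> S0 / 2} \<le> mean (hash_pmf {1..k} N) (\<lambda>h. ?err h + 1 / 6)"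
    unfolding prob_hash_trial by (intro mean_mono finite_hash_pmf N_pos) simp
  also have "\<dots> = mean (hash_pmf {1..k} N) ?err + 1 / 6"
    by (rule mean_add_const) (simp add: finite_hash_pmf N_pos)
  also have "\<dots> \<le> 1 / 6 + 1 / 6" using D.mean_hash_error[OF e_pos] by (intro add_right_mono)
  finally have "measure_pmf.prob ?X {z. z \<le> S0 / 2} \<le> 1 / 3" by simp
  moreover have "{z. \<not> z \<le> S0 / 2} = space (measure_pmf ?X) - {z. z \<le> S0 / 2}" by auto
  then have "measure_pmf.prob ?X {z. \<not> z \<le> S0 / 2} = 1 - measure_pmf.prob ?X {z. z \<le> S0 / 2}"
    by (metis measure_pmf.prob_compl sets_measure_pmf UNIV_I)
  ultimately show ?thesis unfolding run_eq by (simp add: pmf_map vimage_def)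
qed

end

lemma closeness_tester_tester: "closeness_tester k \<alpha> (tester n n' N L t t' r hash (S0 / 2))"
  unfolding closeness_tester_def using accept reject by blast

end

section \<open>Choice of the parameters\<close>

text \<open>
  Balances the loss of hashing, \<open>\<kappa> / sqrt L\<close> samples, against the cost \<open>L powr (1/4) * D\<close> of the
  privacy noise in \<open>L\<close> cells; \<open>B\<close> is the common value of both at the optimum
  \<open>L = (\<kappa> / B)\<^sup>2\<close>, which is then clamped to \<open>[1, k]\<close>.
\<close>

lemma optimal_bins:
  fixes k \<alpha> \<sigma> \<kappa> A B D :: real
  assumes k: "1 \<le> k" and \<alpha>: "0 < \<alpha>" "\<alpha> \<le> 1" and \<sigma>: "1 \<le> \<sigma>"
    and \<kappa>: "\<kappa> = k / \<alpha>\<^sup>2" and A: "A = sqrt k / \<alpha>\<^sup>2" and D: "D = sqrt k / \<alpha> * \<sigma>"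
    and B: "0 < B" "B ^ 3 = \<kappa> * D\<^sup>2"
  obtains L where "1 \<le> L" "L \<le> k" "\<kappa> \<le> sqrt L * (A + B + D)" "sqrt L * D\<^sup>2 \<le> (A + B + D)\<^sup>2"
    "L * \<sigma> \<le> A + B + D"
proof -
  have pos: "0 < A" "0 < D" "0 < \<kappa>" using k \<alpha> \<sigma> by (auto simp: A D \<kappa>)
  have sk: "1 \<le> sqrt k" using k by simp
  have "\<alpha> \<le> sqrt k" using sk \<alpha> by linarith
  then have sa: "sqrt k / \<alpha> \<ge> 1" using \<alpha> by (simp add: pos_le_divide_eq)
  have D_ge: "sqrt k / \<alpha> \<le> D" unfolding D using sa \<sigma> mult_left_mono[of 1 \<sigma> "sqrt k / \<alpha>"] by simp
  have \<sigma>_le: "\<sigma> \<le> D" unfolding D using sa \<sigma> mult_right_mono[of 1 "sqrt k / \<alpha>" \<sigma>] by simp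
  \<comment> \<open>The square root of the unclamped optimum.\<close>
  define m where "m = \<kappa> / B"
  have m: "0 < m" "m * B = \<kappa>" using pos B by (auto simp: m_def)
  have mD: "m * D\<^sup>2 = B\<^sup>2"
  proof -
    have "(m * D\<^sup>2) * B = B\<^sup>2 * B" using B m by (simp add: power2_eq_square power3_eq_cube mult_ac)
    then show ?thesis using B by simp
  qed
  \<comment> \<open>By \<kappa>^2 * \<sigma> = \<kappa> * (sqrt k / \<alpha>) * D <= \<kappa> * D^2
    = B^3. This later secures L^2 * \<tau> <= 1.\<close>
  have m\<sigma>: "m\<^sup>2 * \<sigma> \<le> B"
  proof -
    have "m\<^sup>2 * \<sigma> * B\<^sup>2 = \<kappa>\<^sup>2 * \<sigma>" using m by (simp add: power_mult_distrib[symmetric] mult_ac)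
    also have "\<dots> = \<kappa> * (sqrt k / \<alpha> * D)"
    proof -
      have "\<kappa> = (sqrt k / \<alpha>) * (sqrt k / \<alpha>)" using k by (simp add: \<kappa> power2_eq_square)
      then show ?thesis by (simp add: power2_eq_square D)
    qed
    also have "\<dots> \<le> \<kappa> * (D * D)" using pos D_ge by (intro mult_left_mono mult_right_mono) auto
    also have "\<dots> = B * B\<^sup>2" using B by (simp add: power2_eq_square power3_eq_cube)
    finally show ?thesis using B by simp
  qed
  let ?X = "A + B + D"
  have X: "A \<le> ?X" "B \<le> ?X" "D \<le> ?X" using pos B by auto
  \<comment> \<open>The clamp: at L = 1 the hashing loss \<kappa> is already at most B, and at L = k
    the loss \<kappa> / sqrt k is the nonprivate term A.\<close>
  consider "m \<le> 1" | "1 < m" "m\<^sup>2 \<le> k" | "1 < m" "k < m\<^sup>2" by linarith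
  then show ?thesis
  proof cases
    case 1
    have "\<kappa> \<le> B" using m mult_right_mono[of m 1 B] 1 B by simp
    moreover have "D\<^sup>2 \<le> ?X\<^sup>2" using X pos by (intro power_mono) auto
    ultimately show ?thesis using that[of 1] k X \<sigma>_le by simp
  next
    case 2
    have sq: "sqrt (m\<^sup>2) = m" using m by simp
    have "\<kappa> \<le> m * ?X" using m X mult_left_mono[of B ?X m] by simp
    moreover have "m * D\<^sup>2 \<le> ?X\<^sup>2" unfolding mD using X B by (intro power_mono) auto
    moreover have "1 \<le> m\<^sup>2" using 2 by simp
    moreover have "m\<^sup>2 * \<sigma> \<le> ?X" using m\<sigma> X by linarith
    ultimately show ?thesis using that[of "m\<^sup>2"] 2 sq by simp
  next
    case 3
    have sm: "sqrt k \<le> m" using 3 m by (intro real_le_lsqrt) auto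
    have "\<kappa> = sqrt k * A" using k by (simp add: \<kappa> A)
    also have "\<dots> \<le> sqrt k * ?X" using X sk by (intro mult_left_mono) auto
    finally have "\<kappa> \<le> sqrt k * ?X" .
    moreover have "sqrt k * D\<^sup>2 \<le> ?X\<^sup>2"
    proof -
      have "sqrt k * D\<^sup>2 \<le> m * D\<^sup>2" using sm by (intro mult_right_mono) auto
      also have "\<dots> \<le> ?X\<^sup>2" unfolding mD using X B by (intro power_mono) auto
      finally show ?thesis .
    qed
    moreover have "k * \<sigma> \<le> ?X"
    proof -
      have "k * \<sigma> \<le> m\<^sup>2 * \<sigma>" using 3 \<sigma> by (intro mult_right_mono) auto
      then show ?thesis using m\<sigma> X by linarith
    qed
    ultimately show ?thesis using that[of k] k by simp
  qed
qed

lemma power_of_two_below: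
  fixes x :: real
  assumes "1 \<le> x"
  obtains j :: nat where "2 ^ j \<le> x" "x < 2 * 2 ^ j"
proof -
  have "1 \<le> nat \<lfloor>x\<rfloor>" using assms by (simp add: le_nat_iff)
  then obtain j where j: "2 ^ j \<le> nat \<lfloor>x\<rfloor>" "nat \<lfloor>x\<rfloor> < 2 ^ (j + 1)"
    using ex_power_ivl1[of 2 "nat \<lfloor>x\<rfloor>"] by auto
  have "real (2 ^ j) \<le> real (nat \<lfloor>x\<rfloor>)" using j(1) by (rule of_nat_mono)
  also have "\<dots> \<le> x" using assms by simp
  finally have 1: "2 ^ j \<le> x" by simp
  have "real (nat \<lfloor>x\<rfloor>) + 1 \<le> real (2 ^ (j + 1))" using j(2) by linarith
  moreover have "x < real (nat \<lfloor>x\<rfloor>) + 1" using assms by linarith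
  ultimately have "x < 2 * 2 ^ j" by simp
  with 1 show ?thesis by (rule that)
qed

text \<open>Hypothesis \<open>1\<close> handles the sampling part of the variance (its 2 is the loss
  from rounding \<open>L\<close> down to a power of two), \<open>2\<close> the privacy part,
  \<open>3\<close> the accuracy of the weights. With 20000000 the dominant sampling part, 2352 *
  32800 / (4 * 10^14 * \<kappa>^2), stays below 1 / (1080 * \<kappa>)^2.\<close>

lemma sample_size_suffices:
  fixes \<kappa> X D \<sigma> L n \<tau> :: real
  assumes \<kappa>: "0 < \<kappa>" and X: "0 < X" and \<sigma>: "1 \<le> \<sigma>" and L: "1 \<le> L"
    and 1: "\<kappa>\<^sup>2 \<le> 2 * L * X\<^sup>2" and 2: "L * D ^ 4 \<le> X ^ 4" and 3: "L * \<sigma> \<le> X"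
    and D: "D ^ 4 = \<kappa>\<^sup>2 * \<sigma> ^ 4" and n: "20000000 * X \<le> n" and \<tau>: "\<tau> = 193 * \<sigma>\<^sup>2 / n\<^sup>2"
  shows "L \<le> n" "L\<^sup>2 * \<tau> \<le> 1"
    "2352 * (16400 / (L * n\<^sup>2) + 2048 * L * \<tau>\<^sup>2) \<le> (1 / (1080 * \<kappa>))\<^sup>2"
proof -
  have "L * 1 \<le> L * \<sigma>" using L \<sigma> by (intro mult_left_mono) auto
  then show "L \<le> n" using 3 n X by linarith
  have n_pos: "0 < n" using n X by linarith
  have n2: "(20000000 * X)\<^sup>2 \<le> n\<^sup>2" using n X by (intro power_mono) auto
  have n4: "(20000000 * X) ^ 4 \<le> n ^ 4" using n X by (intro power_mono) auto
  have "(L * \<sigma>)\<^sup>2 \<le> X\<^sup>2" using 3 L \<sigma> by (intro power_mono) auto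
  moreover have X2: "400000000000000 * X\<^sup>2 \<le> n\<^sup>2" using n2 by (simp add: power_mult_distrib)
  moreover have "0 \<le> X\<^sup>2" by simp
  ultimately have "193 * (L * \<sigma>)\<^sup>2 \<le> n\<^sup>2" by linarith
  then show "L\<^sup>2 * \<tau> \<le> 1" using n_pos by (simp add: \<tau> power_mult_distrib mult_ac)
  have a: "16400 / (L * n\<^sup>2) \<le> 32800 / (4 * 10 ^ 14 * \<kappa>\<^sup>2)"
  proof -
    have "L * (4 * 10 ^ 14 * X\<^sup>2) \<le> L * n\<^sup>2"
      using X2 L by (intro mult_left_mono) simp_all
    then have "4 * 10 ^ 14 * \<kappa>\<^sup>2 \<le> 2 * (L * n\<^sup>2)" using 1 by simp
    moreover have "0 < L * n\<^sup>2" using L n_pos by simp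
    ultimately show ?thesis using \<kappa> by (simp add: divide_le_eq le_divide_eq field_simps)
  qed
  \<comment> \<open>37249 = 193^2, and 10^28 is less than the fourth power of 20000000.\<close>
  have b: "L * \<tau>\<^sup>2 \<le> 37249 / (10 ^ 28 * \<kappa>\<^sup>2)"
  proof -
    have "L * \<sigma> ^ 4 * \<kappa>\<^sup>2 \<le> X ^ 4" using 2 D by (simp add: mult_ac)
    then have "10 ^ 28 * (L * \<sigma> ^ 4 * \<kappa>\<^sup>2) \<le> 10 ^ 28 * X ^ 4" by (intro mult_left_mono) simp_all
    also have "\<dots> \<le> (20000000 * X) ^ 4" using X by (simp add: power_mult_distrib)
    also have "\<dots> \<le> n ^ 4" by (rule n4)
    finally have *: "10 ^ 28 * (L * \<sigma> ^ 4 * \<kappa>\<^sup>2) \<le> n ^ 4" .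
    have "L * \<tau>\<^sup>2 = 37249 * (L * \<sigma> ^ 4) / n ^ 4"
      by (simp add: \<tau> power_divide power_mult_distrib)
    also have "\<dots> \<le> 37249 / (10 ^ 28 * \<kappa>\<^sup>2)"
    proof -
      have "37249 * (L * \<sigma> ^ 4) * (10 ^ 28 * \<kappa>\<^sup>2) \<le> 37249 * n ^ 4" using * by (simp add: mult_ac)
      moreover have "0 < n ^ 4" "0 < 10 ^ 28 * \<kappa>\<^sup>2" using n_pos \<kappa> by auto
      ultimately show ?thesis by (simp only: pos_divide_le_eq pos_le_divide_eq times_divide_eq_left)
    qed
    finally show ?thesis .
  qed
  have "2352 * (16400 / (L * n\<^sup>2) + 2048 * L * \<tau>\<^sup>2)
      \<le> 2352 * (32800 / (4 * 10 ^ 14 * \<kappa>\<^sup>2) + 2048 * (37249 / (10 ^ 28 * \<kappa>\<^sup>2)))"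
    using a b by (simp add: mult.assoc)
  also have "\<dots> = 2352 * (32800 / (4 * 10 ^ 14) + 2048 * (37249 / 10 ^ 28)) * (1 / \<kappa>\<^sup>2)"
    using \<kappa> by (simp add: field_simps)
  also have "\<dots> \<le> (1 / 1080\<^sup>2) * (1 / \<kappa>\<^sup>2)"
    using \<kappa> by (intro mult_right_mono) simp_all
  also have "\<dots> = (1 / (1080 * \<kappa>))\<^sup>2" by (simp add: power_divide power_mult_distrib)
  finally show "2352 * (16400 / (L * n\<^sup>2) + 2048 * L * \<tau>\<^sup>2) \<le> (1 / (1080 * \<kappa>))\<^sup>2" .
qed

text \<open>384 = 3 * 128 makes the Hoeffding exponent at least 3 * log_inv \<delta> >= 2 + ln (1 /
  \<delta>), where the 2 absorbs the factor 4 <= exp 2.\<close>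

definition noise_size :: "real \<Rightarrow> real \<Rightarrow> nat" where
  "noise_size \<epsilon> \<delta> = nat \<lceil>384 * log_inv \<delta> / \<epsilon>\<^sup>2\<rceil>"

lemma noise_size:
  fixes \<epsilon> \<delta> :: real
  assumes \<epsilon>: "0 < \<epsilon>" "\<epsilon> \<le> 1" and \<delta>: "0 < \<delta>" "\<delta> \<le> 1"
  shows "16 \<le> \<epsilon> * noise_size \<epsilon> \<delta>" "4 * exp (- (\<epsilon>\<^sup>2 * noise_size \<epsilon> \<delta> / 128)) \<le> \<delta>"
    "noise_size \<epsilon> \<delta> \<le> 385 * log_inv \<delta> / \<epsilon>\<^sup>2"
proof -
  have \<Lambda>: "1 \<le> log_inv \<delta>" "ln (1 / \<delta>) \<le> log_inv \<delta>" by (auto simp: log_inv_def)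
  have e2: "0 < \<epsilon>\<^sup>2" "\<epsilon>\<^sup>2 \<le> 1" using \<epsilon> by (auto simp: power_le_one)
  have lower: "384 * log_inv \<delta> / \<epsilon>\<^sup>2 \<le> noise_size \<epsilon> \<delta>"
    unfolding noise_size_def by (rule real_nat_ceiling_ge)
  have "0 \<le> 384 * log_inv \<delta> / \<epsilon>\<^sup>2" using \<Lambda> by simp
  then have "noise_size \<epsilon> \<delta> \<le> 384 * log_inv \<delta> / \<epsilon>\<^sup>2 + 1"
    unfolding noise_size_def by linarith
  also have "1 \<le> log_inv \<delta> / \<epsilon>\<^sup>2" using \<Lambda> e2 by (simp add: pos_le_divide_eq)
  finally show "noise_size \<epsilon> \<delta> \<le> 385 * log_inv \<delta> / \<epsilon>\<^sup>2" by simp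
  have e: "384 * log_inv \<delta> \<le> \<epsilon>\<^sup>2 * noise_size \<epsilon> \<delta>"
    using lower e2 by (simp add: pos_divide_le_eq mult.commute)
  have "\<epsilon> * (\<epsilon> * noise_size \<epsilon> \<delta>) \<le> 1 * (\<epsilon> * noise_size \<epsilon> \<delta>)" using \<epsilon> by (intro mult_right_mono) auto
  then show "16 \<le> \<epsilon> * noise_size \<epsilon> \<delta>" using e \<Lambda> by (simp add: power2_eq_square mult.assoc)
  have "2 \<le> exp (1::real)" using exp_ge_add_one_self[of 1] by simp
  then have "2 * 2 \<le> exp (1::real) * exp 1" by (intro mult_mono) auto
  then have 4: "4 \<le> exp (2::real)" by (simp flip: exp_add)
  have "4 * exp (- (\<epsilon>\<^sup>2 * noise_size \<epsilon> \<delta> / 128)) \<le> exp 2 * exp (- 2 - ln (1 / \<delta>))"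
    using e \<Lambda> 4 by (intro mult_mono) auto
  also have "\<dots> = \<delta>" using \<delta> by (simp add: ln_div flip: exp_add)
  finally show "4 * exp (- (\<epsilon>\<^sup>2 * noise_size \<epsilon> \<delta> / 128)) \<le> \<delta>" .
qed

text \<open>The middle term of the sample bound satisfies the balance equation that
  \<open>optimal_bins\<close> asks for.\<close>

lemma bound_terms:
  fixes k \<alpha> \<epsilon> \<Lambda> :: real
  assumes "0 < k" "0 < \<alpha>" "0 < \<epsilon>" "0 < \<Lambda>"
  defines "B \<equiv> k powr (2/3) / (\<alpha> powr (4/3) * \<epsilon> powr (2/3)) * \<Lambda> powr (1/3)"
  shows "0 < B" "B ^ 3 = k / \<alpha>\<^sup>2 * (sqrt k / \<alpha> * (sqrt \<Lambda> / \<epsilon>))\<^sup>2"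
proof -
  show "0 < B" using assms by (simp add: B_def)
  have cube: "(x powr a) ^ 3 = x powr (a * 3)" if "0 < x" for x a :: real
    using that by (simp add: powr_powr flip: powr_realpow[of "x powr a" 3])
  have "B ^ 3 = k powr 2 / (\<alpha> powr 4 * \<epsilon> powr 2) * \<Lambda> powr 1"
    using assms unfolding B_def power_mult_distrib power_divide by (simp add: cube)
  also have "\<dots> = k\<^sup>2 / (\<alpha> ^ 4 * \<epsilon>\<^sup>2) * \<Lambda>" using assms by simp
  also have "\<dots> = k / \<alpha>\<^sup>2 * (sqrt k / \<alpha> * (sqrt \<Lambda> / \<epsilon>))\<^sup>2"
    using assms by (simp add: power_mult_distrib power_divide) (simp add: power2_eq_square power4_eq_xxxx)
  finally show "B ^ 3 = k / \<alpha>\<^sup>2 * (sqrt k / \<alpha> * (sqrt \<Lambda> / \<epsilon>))\<^sup>2" .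
qed

text \<open>The second claim ensures that a second group of \<rho> times the size has scaled noise
  variance bounded like that of the first, up to the same constant. Rounding up at most doubles a
  ratio that is at least 1.\<close>

lemma group_ratio:
  fixes \<epsilon>\<^sub>1 \<epsilon>\<^sub>2 :: real
  assumes "0 < \<epsilon>\<^sub>1" "0 < \<epsilon>\<^sub>2"
  shows "1 \<le> nat \<lceil>size_ratio \<epsilon>\<^sub>1 \<epsilon>\<^sub>2\<rceil>" "\<epsilon>\<^sub>1 \<le> \<epsilon>\<^sub>2 * nat \<lceil>size_ratio \<epsilon>\<^sub>1 \<epsilon>\<^sub>2\<rceil>"
    "nat \<lceil>size_ratio \<epsilon>\<^sub>1 \<epsilon>\<^sub>2\<rceil> \<le> 2 * size_ratio \<epsilon>\<^sub>1 \<epsilon>\<^sub>2"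
proof -
  have \<rho>: "1 \<le> size_ratio \<epsilon>\<^sub>1 \<epsilon>\<^sub>2" "(\<epsilon>\<^sub>1 / \<epsilon>\<^sub>2)\<^sup>2 \<le> size_ratio \<epsilon>\<^sub>1 \<epsilon>\<^sub>2" by (auto simp: size_ratio_def)
  show "1 \<le> nat \<lceil>size_ratio \<epsilon>\<^sub>1 \<epsilon>\<^sub>2\<rceil>" using \<rho> by linarith
  show "nat \<lceil>size_ratio \<epsilon>\<^sub>1 \<epsilon>\<^sub>2\<rceil> \<le> 2 * size_ratio \<epsilon>\<^sub>1 \<epsilon>\<^sub>2" using \<rho> by linarith
  have "\<epsilon>\<^sub>1 / \<epsilon>\<^sub>2 \<le> size_ratio \<epsilon>\<^sub>1 \<epsilon>\<^sub>2"
  proof (cases "\<epsilon>\<^sub>1 / \<epsilon>\<^sub>2 \<le> 1")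
    case False
    then have "\<epsilon>\<^sub>1 / \<epsilon>\<^sub>2 \<le> (\<epsilon>\<^sub>1 / \<epsilon>\<^sub>2)\<^sup>2"
      using mult_right_mono[of 1 "\<epsilon>\<^sub>1 / \<epsilon>\<^sub>2" "\<epsilon>\<^sub>1 / \<epsilon>\<^sub>2"] by (simp add: power2_eq_square)
    with \<rho> show ?thesis by linarith
  qed (use \<rho> in linarith)
  also have "\<dots> \<le> nat \<lceil>size_ratio \<epsilon>\<^sub>1 \<epsilon>\<^sub>2\<rceil>" by (rule real_nat_ceiling_ge)
  finally show "\<epsilon>\<^sub>1 \<le> \<epsilon>\<^sub>2 * nat \<lceil>size_ratio \<epsilon>\<^sub>1 \<epsilon>\<^sub>2\<rceil>"
    using assms by (simp add: pos_divide_le_eq mult.commute)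
qed

lemma tester_exists:
  fixes k :: nat and \<alpha> \<epsilon>\<^sub>1 \<epsilon>\<^sub>2 \<delta> :: real
  assumes k: "k \<ge> 1" and \<alpha>: "0 < \<alpha>" "\<alpha> \<le> 1" and \<epsilon>: "0 < \<epsilon>\<^sub>1" "\<epsilon>\<^sub>1 \<le> 1" "0 < \<epsilon>\<^sub>2" "\<epsilon>\<^sub>2 \<le> 1"
    and \<delta>: "0 < \<delta>" "\<delta> \<le> 1"
  defines "X \<equiv> sqrt (real k) / \<alpha>\<^sup>2
         + real k powr (2/3) / (\<alpha> powr (4/3) * \<epsilon>\<^sub>1 powr (2/3)) * log_inv \<delta> powr (1/3)
         + sqrt (real k) / (\<alpha> * \<epsilon>\<^sub>1) * sqrt (log_inv \<delta>)"
  shows "\<exists>P :: nat shuffle_protocol. public_coin P \<and> closeness_tester k \<alpha> P \<and>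
       shuffle_private k \<epsilon>\<^sub>1 \<delta> (coins P) (users1 P) (rand1 P) \<and>
       shuffle_private k \<epsilon>\<^sub>2 \<delta> (coins P) (users2 P) (rand2 P) \<and>
       real (users1 P) \<le> 10 ^ 8 * X \<and>
       real (users2 P) \<le> 10 ^ 8 * (size_ratio \<epsilon>\<^sub>1 \<epsilon>\<^sub>2 * real (users1 P))"
proof -
  define \<Lambda> where "\<Lambda> = log_inv \<delta>"
  define \<sigma> where "\<sigma> = sqrt \<Lambda> / \<epsilon>\<^sub>1"
  define \<kappa> where "\<kappa> = real k / \<alpha>\<^sup>2"
  define A where "A = sqrt (real k) / \<alpha>\<^sup>2"
  define B where "B = real k powr (2/3) / (\<alpha> powr (4/3) * \<epsilon>\<^sub>1 powr (2/3)) * \<Lambda> powr (1/3)"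
  define D where "D = sqrt (real k) / \<alpha> * \<sigma>"
  have X: "X = A + B + D" by (simp add: X_def A_def B_def D_def \<Lambda>_def \<sigma>_def)
  have \<Lambda>: "1 \<le> \<Lambda>" by (simp add: \<Lambda>_def log_inv_def)
  have k_pos: "0 < real k" using k by simp
  have "1 \<le> sqrt \<Lambda>" using \<Lambda> by simp
  then have "\<epsilon>\<^sub>1 \<le> sqrt \<Lambda>" using \<epsilon> by linarith
  then have \<sigma>: "1 \<le> \<sigma>" using \<epsilon> by (simp add: \<sigma>_def)
  have B: "0 < B" "B ^ 3 = \<kappa> * D\<^sup>2"
    using bound_terms[OF k_pos \<alpha>(1) \<epsilon>(1), of \<Lambda>] \<Lambda> by (simp_all add: B_def D_def \<sigma>_def \<kappa>_def)
  have \<kappa>: "0 < \<kappa>" using k_pos \<alpha> by (simp add: \<kappa>_def)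
  have D_pos: "0 < D" using k_pos \<alpha> \<sigma> by (simp add: D_def)
  have A_ge: "1 \<le> A"
  proof -
    have "\<alpha>\<^sup>2 \<le> 1" using \<alpha> by (simp add: power_le_one)
    moreover have "1 \<le> sqrt (real k)" using k by simp
    ultimately have "\<alpha>\<^sup>2 \<le> sqrt (real k)" by linarith
    then show ?thesis using \<alpha> unfolding A_def by (subst pos_le_divide_eq) auto
  qed
  have X1: "1 \<le> X" using A_ge B D_pos by (simp add: X)
  have k1: "1 \<le> real k" using k by simp
  obtain L0 :: real where L0: "1 \<le> L0" "L0 \<le> k" "\<kappa> \<le> sqrt L0 * X" "sqrt L0 * D\<^sup>2 \<le> X\<^sup>2" "L0 * \<sigma> \<le> X"
    unfolding X by (rule optimal_bins[OF k1 \<alpha> \<sigma> \<kappa>_def A_def D_def B])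
  obtain j where j: "2 ^ j \<le> L0" "L0 < 2 * 2 ^ j" using power_of_two_below[OF L0(1)] .
  define L :: real where "L = 2 ^ j"
  have "L \<le> L0" using j by (simp add: L_def)
  moreover have "1 \<le> L" by (simp add: L_def)
  ultimately have L: "1 \<le> L" "L \<le> k" "L \<le> L0" using L0 by linarith+
  \<comment> \<open>2 ^ 10 provides the 1024 cells per unit of \<open>L\<close>.\<close>
  define N :: nat where "N = 2 ^ (10 + j)"
  have N: "real N = 1024 * L" by (simp add: N_def L_def power_add)
  obtain hash where hash: "map_pmf hash (public_string (k * (10 + j))) = hash_pmf {1..k} N"
    unfolding N_def by (rule hash_from_coins)
  define n where "n = nat \<lceil>20000000 * X\<rceil>"
  define \<rho> where "\<rho> = nat \<lceil>size_ratio \<epsilon>\<^sub>1 \<epsilon>\<^sub>2\<rceil>"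
  note ratio = group_ratio[OF \<epsilon>(1) \<epsilon>(3), folded \<rho>_def]
  define n' where "n' = n * \<rho>"
  have n_bounds: "20000000 * X \<le> n" "n \<le> 20000000 * X + 1" using X1 unfolding n_def by linarith+
  have n_pos: "0 < n" "0 < n'" using n_bounds X1 ratio(1) by (auto simp: n'_def intro!: Nat.gr0I)
  define t where "t = noise_size \<epsilon>\<^sub>1 \<delta>"
  define t' where "t' = noise_size \<epsilon>\<^sub>2 \<delta>"
  \<comment> \<open>Each group contributes at most (385 / 4) * \<sigma>^2 / n^2, and 2 * 385 / 4 <=
    193.\<close>
  define \<tau> where "\<tau> = 193 * \<sigma>\<^sup>2 / (real n)\<^sup>2"
  define r where "r = k * (10 + j)"
  define P where "P = tester n n' N L t t' r hash ((1 / (1080 * \<kappa>)) / 2)"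
  have \<sigma>2: "\<sigma>\<^sup>2 = \<Lambda> / \<epsilon>\<^sub>1\<^sup>2" using \<Lambda> by (simp add: \<sigma>_def power_divide)
  have \<tau>: "t / (4 * (real n)\<^sup>2) + t' / (4 * (real n')\<^sup>2) \<le> \<tau>"
  proof -
    have "t / (4 * (real n)\<^sup>2) \<le> (385 * \<sigma>\<^sup>2) / (4 * (real n)\<^sup>2)"
      using noise_size(3)[OF \<epsilon>(1,2) \<delta>] by (intro divide_right_mono) (simp_all add: t_def \<sigma>2 \<Lambda>_def)
    moreover have "t' / (4 * (real n')\<^sup>2) \<le> (385 * \<sigma>\<^sup>2) / (4 * (real n)\<^sup>2)"
    proof -
      have "\<epsilon>\<^sub>1\<^sup>2 \<le> (\<epsilon>\<^sub>2 * \<rho>)\<^sup>2" using ratio(2) \<epsilon> by (intro power_mono) auto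
      then have le: "\<Lambda> / (\<epsilon>\<^sub>2 * \<rho>)\<^sup>2 \<le> \<Lambda> / \<epsilon>\<^sub>1\<^sup>2" using \<Lambda> \<epsilon> ratio(1) by (intro divide_left_mono) auto
      have "t' / (4 * (real n')\<^sup>2) \<le> (385 * \<Lambda> / \<epsilon>\<^sub>2\<^sup>2) / (4 * (real n')\<^sup>2)"
        using noise_size(3)[OF \<epsilon>(3,4) \<delta>] by (intro divide_right_mono) (simp_all add: t'_def \<Lambda>_def)
      also have "\<dots> = (385 * (\<Lambda> / (\<epsilon>\<^sub>2 * \<rho>)\<^sup>2)) / (4 * (real n)\<^sup>2)"
        by (simp add: n'_def power_mult_distrib mult_ac)
      also have "\<dots> \<le> (385 * \<sigma>\<^sup>2) / (4 * (real n)\<^sup>2)"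
        unfolding \<sigma>2 using le by (intro divide_right_mono) auto
      finally show ?thesis .
    qed
    moreover have "(385 * \<sigma>\<^sup>2) / (4 * (real n)\<^sup>2) + (385 * \<sigma>\<^sup>2) / (4 * (real n)\<^sup>2) \<le> \<tau>"
      unfolding \<tau>_def using n_pos by (simp add: field_simps)
    ultimately show ?thesis by linarith
  qed
  have suff: "L \<le> n" "L\<^sup>2 * \<tau> \<le> 1"
    "2352 * (16400 / (L * (real n)\<^sup>2) + 2048 * L * \<tau>\<^sup>2) \<le> (1 / (1080 * \<kappa>))\<^sup>2"
  proof -
    have X_pos: "0 < X" using X1 by simp
    have 1: "\<kappa>\<^sup>2 \<le> 2 * L * X\<^sup>2"
    proof -
      have "\<kappa>\<^sup>2 \<le> (sqrt L0 * X)\<^sup>2" using L0 \<kappa> by (intro power_mono) auto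
      also have "\<dots> = L0 * X\<^sup>2" using L0 by (simp add: power_mult_distrib)
      also have "\<dots> \<le> 2 * L * X\<^sup>2" using j by (intro mult_right_mono) (auto simp: L_def)
      finally show ?thesis .
    qed
    have 2: "L * D ^ 4 \<le> X ^ 4"
    proof -
      have "(sqrt L0 * D\<^sup>2)\<^sup>2 \<le> (X\<^sup>2)\<^sup>2" using L0 by (intro power_mono) auto
      then have "L0 * D ^ 4 \<le> X ^ 4" using L0 by (simp add: power_mult_distrib flip: power_mult)
      moreover have "L * D ^ 4 \<le> L0 * D ^ 4" using L by (intro mult_right_mono) auto
      ultimately show ?thesis by linarith
    qed
    have 3: "L * \<sigma> \<le> X" using L0 L \<sigma> mult_right_mono[of L L0 \<sigma>] by linarith
    have D4: "D ^ 4 = \<kappa>\<^sup>2 * \<sigma> ^ 4"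
    proof -
      have "sqrt (real k) ^ 4 = (real k)\<^sup>2" using power_mult[of "sqrt (real k)" 2 2] by simp
      then show ?thesis by (simp add: D_def \<kappa>_def power_mult_distrib power_divide)
    qed
    note suff = sample_size_suffices[OF \<kappa> X_pos \<sigma> L(1) 1 2 3 D4 n_bounds(1) \<tau>_def]
    show "L \<le> n" "L\<^sup>2 * \<tau> \<le> 1"
      "2352 * (16400 / (L * (real n)\<^sup>2) + 2048 * L * \<tau>\<^sup>2) \<le> (1 / (1080 * \<kappa>))\<^sup>2"
      by (fact suff)+
  qed
  have S0: "1 / (1080 * \<kappa>) = \<alpha>\<^sup>2 / (1080 * k)" by (simp add: \<kappa>_def)
  interpret tester_params k n n' N t t' r L \<alpha> \<tau> "1 / (1080 * \<kappa>)" hash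
    using hash k N L suff \<tau> \<alpha> S0 ratio(1) by unfold_locales (auto simp: r_def n'_def)
  have hash_less: "hash u x < N" if "length u = r" "x \<in> {1..k}" for u x
  proof (rule hash_less_N)
    have "finite {u :: bool list. length u = r}"
      using finite_lists_length_eq[of "UNIV :: bool set" r] by simp
    moreover have "{u :: bool list. length u = r} \<noteq> {}" using that by auto
    ultimately show "u \<in> set_pmf (public_string r)" using that by (simp add: public_string_def)
  qed (rule that)
  have fields: "coins P = r" "users1 P = 3 * n" "users2 P = 3 * n'"
    "rand1 P = noisy_rand n N t hash" "rand2 P = noisy_rand n' N t' hash"
    by (simp_all add: P_def tester_def)
  have "public_coin P" using k by (simp add: public_coin_def fields r_def)
  moreover have "closeness_tester k \<alpha> P" unfolding P_def by (rule closeness_tester_tester)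
  moreover have "shuffle_private k \<epsilon>\<^sub>1 \<delta> (coins P) (users1 P) (rand1 P)"
    unfolding shuffle_private_def fields t_def
    using noisy_counts_private[OF \<epsilon>(1,2) noise_size(1,2)[OF \<epsilon>(1,2) \<delta>]] hash_less n_pos by blast
  moreover have "shuffle_private k \<epsilon>\<^sub>2 \<delta> (coins P) (users2 P) (rand2 P)"
    unfolding shuffle_private_def fields t'_def
    using noisy_counts_private[OF \<epsilon>(3,4) noise_size(1,2)[OF \<epsilon>(3,4) \<delta>]] hash_less n_pos by blast
  \<comment> \<open>3 * (20000000 * X + 1) <= 10^8 * X, as X >= 1.\<close>
  moreover have "real (users1 P) \<le> 10 ^ 8 * X" using n_bounds X1 by (simp add: fields)
  moreover have "real (users2 P) \<le> 10 ^ 8 * (size_ratio \<epsilon>\<^sub>1 \<epsilon>\<^sub>2 * real (users1 P))"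
  proof -
    have "real (users2 P) = \<rho> * real (users1 P)" by (simp add: fields n'_def)
    also have "\<dots> \<le> (2 * size_ratio \<epsilon>\<^sub>1 \<epsilon>\<^sub>2) * real (users1 P)" using ratio(3) by (intro mult_right_mono) auto
    also have "\<dots> \<le> 10 ^ 8 * (size_ratio \<epsilon>\<^sub>1 \<epsilon>\<^sub>2 * real (users1 P))" by (simp add: size_ratio_def)
    finally show ?thesis .
  qed
  ultimately show ?thesis by blast
qed

theorem theorem3p9:
  shows "\<exists>C>0. \<forall>(k::nat) (\<alpha>::real) (\<epsilon>\<^sub>1::real) (\<epsilon>\<^sub>2::real) (\<delta>::real).
    k \<ge> 1 \<and> 0 < \<alpha> \<and> \<alpha> \<le> 1 \<and> 0 < \<epsilon>\<^sub>1 \<and> \<epsilon>\<^sub>1 \<le> 1 \<and> 0 < \<epsilon>\<^sub>2 \<and> \<epsilon>\<^sub>2 \<le> 1 \<and> 0 < \<delta> \<and> \<delta> \<le> 1 \<longrightarrow>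
    (\<exists>P :: nat shuffle_protocol.
       public_coin P \<and>
       closeness_tester k \<alpha> P \<and>
       shuffle_private k \<epsilon>\<^sub>1 \<delta> (coins P) (users1 P) (rand1 P) \<and>
       shuffle_private k \<epsilon>\<^sub>2 \<delta> (coins P) (users2 P) (rand2 P) \<and>
       real (users1 P) \<le> C * (sqrt (real k) / \<alpha>\<^sup>2
         + real k powr (2/3) / (\<alpha> powr (4/3) * \<epsilon>\<^sub>1 powr (2/3)) * log_inv \<delta> powr (1/3)
         + sqrt (real k) / (\<alpha> * \<epsilon>\<^sub>1) * sqrt (log_inv \<delta>)) \<and>
       real (users2 P) \<le> C * (size_ratio \<epsilon>\<^sub>1 \<epsilon>\<^sub>2 * real (users1 P)))"
proof (intro exI[of _ "10 ^ 8"] conjI allI impI, goal_cases)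
  case (2 k \<alpha> \<epsilon>\<^sub>1 \<epsilon>\<^sub>2 \<delta>)
  then show ?case by (elim conjE) (rule tester_exists)
qed simp

end
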